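(* Let $\alpha>0$, $\beta>0$, $\rho>0$, and let the constants $\gamma_1,\dots,\gamma_N$, the matrix $B$ and the feedback $F$ be as described in the context. Consider Fisher's equation with boundary feedback $$u_t-u_{xx}-\alpha u+\beta u^2=0 \text{ in } (0,1)\times(0,\infty),\qquad u(0,t)=0,\quad u(1,t)=U(t)=F(u(\cdot,t)),\quad u(x,0)=u_0(x),$$ with initial data $u_0\in I_C:=\{u\in H^1(0,1):\ F(u)=u(1),\ u(0)=0\}$. Then there exist constants $C>0$, $\mu>0$ and $\delta>0$ such that for all $u_0\in I_C$ with $\|u_0\|\le\delta$, the solution of this closed-loop system satisfies $$\|u(t)\|_1\le Ce^{-\mu t}\|u_0\|_1,\qquad t\ge 0,$$ where $\|\cdot\|$ denotes the norm of $L^2(0,1)$ and $\|\cdot\|_1$ the norm of $H^1(0,1)$.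
   Context: Let $\lambda_j=(\pi j)^2-\alpha$ and $\phi_j(x)=\sin(\pi j x)$, $j=1,2,\dots$; these are the eigenvalues and eigenfunctions of $\mathcal{A}u=-u''-\alpha u$ on $H^2(0,1)\cap H^1_0(0,1)$. Let $N$ be the integer such that $\lambda_j<\rho$ for $j=1,\dots,N$ and $\lambda_j\ge\rho$ for $j\ge N+1$ (with $N\ge1$). Let $\rho<\gamma_1<\gamma_2<\dots<\gamma_N$ be constants chosen sufficiently large that, for each $j$ and each $V\in\mathbb{R}$, the problem $\gamma_j\psi+\psi''-\alpha\psi-2\sum_{k=1}^N\lambda_k\langle\psi,\phi_k\rangle\phi_k=0$ on $(0,1)$, $\psi(0)=0$, $\psi(1)=V$, has a solution (here $\langle\cdot,\cdot\rangle$ is the $L^2(0,1)$ inner product). Let $B_0$ be the $N\times N$ matrix with entries $(B_0)_{ij}=\phi_i'(1)\phi_j'(1)$, let $\Lambda_{\gamma_k}=\mathrm{diag}\big(\frac{1}{\gamma_k-\lambda_i}\big)_{1\le i\le N}$, $B_k=\Lambda_{\gamma_k}B_0\Lambda_{\gamma_k}$ for $k=1,\dots,N$, and $B=(B_1+\dots+B_N)^{-1}$. For $u\in L^2(0,1)$ define $$F_k(u)=\Big\langle B\big(\langle u,\phi_1\rangle,\dots,\langle u,\phi_N\rangle\big)^T,\ \Big(\tfrac{\phi_1'(1)}{\gamma_k-\lambda_1},\dots,\tfrac{\phi_N'(1)}{\gamma_k-\lambda_N}\Big)^T\Big\rangle_{\mathbb{R}^N},\qquad F(u)=\sum_{k=1}^N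 F_k(u),$$ where $\langle\cdot,\cdot\rangle_{\mathbb{R}^N}$ is the Euclidean inner product. *)

theory Defs
  imports "HOL-Analysis.Analysis"
begin

(* Eigenvalues / eigenfunctions of  A u = -u'' - alpha u  on (0,1) with Dirichlet BC *)
definition lam :: "real \<Rightarrow> nat \<Rightarrow> real" where
  "lam \<alpha> j = (pi * real j)^2 - \<alpha>"

definition phi :: "nat \<Rightarrow> real \<Rightarrow> real" where
  "phi j x = sin (pi * real j * x)"

definition dphi1 :: "nat \<Rightarrow> real" where
  "dphi1 j = pi * real j * cos (pi * real j)"

definition L2_inner :: "(real \<Rightarrow> real) \<Rightarrow> (real \<Rightarrow> real) \<Rightarrow> real" where
  "L2_inner u v = integral {0..1} (\<lambda>x. u x * v x)"

definition L2_norm :: "(real \<Rightarrow> real) \<Rightarrow> real" where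
  "L2_norm u = sqrt (integral {0..1} (\<lambda>x. (u x)^2))"

definition L2_fun :: "(real \<Rightarrow> real) \<Rightarrow> bool" where
  "L2_fun g \<longleftrightarrow> g absolutely_integrable_on {0..1} \<and> (\<lambda>x. (g x)^2) integrable_on {0..1}"

(* g is a (weak) derivative of u in L^2(0,1): u is the absolutely continuous
   representative with u(x) = u(0) + int_0^x g *)
definition is_weak_deriv :: "(real \<Rightarrow> real) \<Rightarrow> (real \<Rightarrow> real) \<Rightarrow> bool" where
  "is_weak_deriv u g \<longleftrightarrow> L2_fun g \<and> (\<forall>x\<in>{0..1}. u x = u 0 + integral {0..x} g)"

definition H1 :: "(real \<Rightarrow> real) \<Rightarrow> bool" where
  "H1 u \<longleftrightarrow> (\<exists>g. is_weak_deriv u g)"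

definition weak_deriv :: "(real \<Rightarrow> real) \<Rightarrow> real \<Rightarrow> real" where
  "weak_deriv u = (SOME g. is_weak_deriv u g)"

definition H1_norm :: "(real \<Rightarrow> real) \<Rightarrow> real" where
  "H1_norm u = sqrt (integral {0..1} (\<lambda>x. (u x)^2) + integral {0..1} (\<lambda>x. (weak_deriv u x)^2))"

definition mat_inv_on :: "nat \<Rightarrow> (nat \<Rightarrow> nat \<Rightarrow> real) \<Rightarrow> nat \<Rightarrow> nat \<Rightarrow> real" where
  "mat_inv_on N M = (SOME X. \<forall>i\<in>{1..N}. \<forall>j\<in>{1..N}.
      (\<Sum>l\<in>{1..N}. M i l * X l j) = (if i = j then 1 else 0) \<and>
      (\<Sum>l\<in>{1..N}. X i l * M l j) = (if i = j then 1 else 0))"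

definition B0 :: "nat \<Rightarrow> nat \<Rightarrow> real" where
  "B0 i j = dphi1 i * dphi1 j"

(* B_k = Lambda_{gamma_k} B_0 Lambda_{gamma_k}, Lambda diagonal *)
definition Bk :: "real \<Rightarrow> (nat \<Rightarrow> real) \<Rightarrow> nat \<Rightarrow> nat \<Rightarrow> nat \<Rightarrow> real" where
  "Bk \<alpha> \<gamma> k i j = (1 / (\<gamma> k - lam \<alpha> i)) * B0 i j * (1 / (\<gamma> k - lam \<alpha> j))"

definition Bmat :: "real \<Rightarrow> nat \<Rightarrow> (nat \<Rightarrow> real) \<Rightarrow> nat \<Rightarrow> nat \<Rightarrow> real" where
  "Bmat \<alpha> N \<gamma> = mat_inv_on N (\<lambda>i j. \<Sum>k\<in>{1..N}. Bk \<alpha> \<gamma> k i j)"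

definition Fk :: "real \<Rightarrow> nat \<Rightarrow> (nat \<Rightarrow> real) \<Rightarrow> nat \<Rightarrow> (real \<Rightarrow> real) \<Rightarrow> real" where
  "Fk \<alpha> N \<gamma> k u =
     (\<Sum>i\<in>{1..N}. (\<Sum>j\<in>{1..N}. Bmat \<alpha> N \<gamma> i j * L2_inner u (phi j))
                    * (dphi1 i / (\<gamma> k - lam \<alpha> i)))"

definition Ffb :: "real \<Rightarrow> nat \<Rightarrow> (nat \<Rightarrow> real) \<Rightarrow> (real \<Rightarrow> real) \<Rightarrow> real" where
  "Ffb \<alpha> N \<gamma> u = (\<Sum>k\<in>{1..N}. Fk \<alpha> N \<gamma> k u)"

definition IC :: "real \<Rightarrow> nat \<Rightarrow> (nat \<Rightarrow> real) \<Rightarrow> (real \<Rightarrow> real) set" where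
  "IC \<alpha> N \<gamma> = {u. H1 u \<and> Ffb \<alpha> N \<gamma> u = u 1 \<and> u 0 = 0}"

(* Solution of the closed-loop Fisher system  (u x t = u(x,t)):
   classical (C^{2,1} on [0,1] x (0,oo)) for t > 0, continuous in time with values
   in H^1(0,1) on [0,oo), with u(.,0) = u0 on [0,1]. *)
definition closed_loop_solution ::
  "real \<Rightarrow> real \<Rightarrow> nat \<Rightarrow> (nat \<Rightarrow> real) \<Rightarrow> (real \<Rightarrow> real) \<Rightarrow> (real \<Rightarrow> real \<Rightarrow> real) \<Rightarrow> bool" where
  "closed_loop_solution \<alpha> \<beta> N \<gamma> u0 u \<longleftrightarrow>
     (\<forall>x\<in>{0..1}. u x 0 = u0 x) \<and>
     (\<forall>t\<ge>0. H1 (\<lambda>x. u x t)) \<and>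
     (\<forall>t0\<ge>0. ((\<lambda>t. H1_norm (\<lambda>x. u x t - u x t0)) \<longlongrightarrow> 0) (at t0 within {0..})) \<and>
     (\<forall>t>0. u 0 t = 0 \<and> u 1 t = Ffb \<alpha> N \<gamma> (\<lambda>x. u x t)) \<and>
     (\<exists>ut ux uxx.
        continuous_on ({0..1} \<times> {0<..}) (\<lambda>(x,t). ut x t) \<and>
        continuous_on ({0..1} \<times> {0<..}) (\<lambda>(x,t). ux x t) \<and>
        continuous_on ({0..1} \<times> {0<..}) (\<lambda>(x,t). uxx x t) \<and>
        (\<forall>x\<in>{0..1}. \<forall>t>0.
           ((\<lambda>s. u x s) has_real_derivative ut x t) (at t) \<and>
           ((\<lambda>y. u y t) has_real_derivative ux x t) (at x within {0..1}) \<and>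
           ((\<lambda>y. ux y t) has_real_derivative uxx x t) (at x within {0..1})) \<and>
        (\<forall>x\<in>{0<..<1}. \<forall>t>0.
           ut x t - uxx x t - \<alpha> * u x t + \<beta> * (u x t)^2 = 0))"

end

theory Submission
  imports Defs "HOL-Computational_Algebra.Polynomial"
begin

text \<open>
  The sine coefficients \<open>y\<^sub>k = \<langle>u, \<phi>\<^sub>k\<rangle>\<close> of a solution satisfy
  \<open>y\<^sub>k' = - \<lambda>\<^sub>k y\<^sub>k - \<phi>\<^sub>k'(1) U - \<beta> \<langle>u\<^sup>2, \<phi>\<^sub>k\<rangle>\<close>. Let \<open>V\<^sub>i\<^sub>k = \<phi>\<^sub>i'(1) / (\<gamma>\<^sub>k - \<lambda>\<^sub>i)\<close>, an invertible Cauchy matrix.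
  Then \<open>B = (V V\<^sup>T)\<^sup>-\<^sup>1\<close> and \<open>(F\<^sub>1, \<dots>, F\<^sub>N) = V\<^sup>-\<^sup>1 (y\<^sub>1, \<dots>, y\<^sub>N)\<close>, and in these coordinates the unstable block decouples:
  \<open>F\<^sub>k(u)' = - \<gamma>\<^sub>k F\<^sub>k(u) - \<beta> F\<^sub>k(u\<^sup>2)\<close>. The remaining modes are stable and are forced by \<open>U = \<Sum>F\<^sub>k\<close>.
  Since \<open>\<bar>\<langle>u\<^sup>2, \<phi>\<^sub>k\<rangle>\<bar> \<le> \<parallel>u\<parallel>\<^sup>2\<close>, the variation of constants formula gives
  \<open>\<parallel>u(t)\<parallel> \<le> (C\<^sub>1 \<parallel>u\<^sub>0\<parallel> + C\<^sub>2 K\<^sup>2) exp (- \<mu> t)\<close> as long as \<open>\<parallel>u\<parallel> \<le> K exp (- \<mu> t)\<close>, and a continuity argument closes the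
  \<open>L\<^sup>2\<close> estimate. The \<open>H\<^sup>1\<close> estimate follows from the same formula for \<open>w = u - x U\<close>, which vanishes at both ends.

  For existence the nonlinearity is truncated in \<open>L\<^sup>2\<close>, which makes the mild formulation a contraction in a
  space of continuous functions weighted by \<open>exp (- M t)\<close>. The mild solution is Hoelder continuous in time with
  exponent \<open>5/8\<close> in \<open>L\<^sup>2\<close>; since this exceeds \<open>1/2\<close>, the differentiated sine series converges absolutely for positive times,
  so that the solution is classical. By the decay estimate the truncation is never active for small data.
\<close>

section \<open>Square-integrable functions on the unit interval\<close>


text \<open>The data are small only in L^2, where u^2 is merely in L^1, so its sine coefficients are
  only known to be bounded uniformly in k. The gain 1 / (pi k)^2 of the heat semigroup is what makes
  this enough. The boundary input enters mode k with a factor of size pi k, so it leaves 1 / (pi k),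
  which is square summable in L^2 but not with the H^1 weight; hence the shift by x U, which trades
  the input for U' times the sine coefficient of x.

  The boundary condition is nonlocal and involves the unknown. For existence it is differentiated
  instead of imposed: U is the integral of the rate of change of F along the equation, and u(1,t) =
  F(u) is recovered because the difference is constant in time and vanishes initially for data in
  I_C.

  The exponent 5/8 is the midpoint of two constraints. Interpolating a Duhamel increment between r =
  t - s and 1 / (pi k)^2 leaves r^p times (pi k)^(-2(1-p)), square summable only for p < 3/4; the
  differentiated series is then controlled by (pi k)^(-2p), summable only for p > 1/2.\<close>

lemma L2_fun_measurable: "L2_fun f \<Longrightarrow> f \<in> borel_measurable (lebesgue_on {0..1})"
  by (simp add: L2_fun_def absolutely_integrable_imp_borel_measurable)

text \<open>Integrability of f itself comes from 2 |f| <= 1 + f^2, the unit interval having finite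
  length.\<close>

lemma L2_funI:
  assumes f: "f \<in> borel_measurable (lebesgue_on {0..1})"
    and g: "g integrable_on {0..1}" and le: "\<And>x. x \<in> {0..1} \<Longrightarrow> (f x)\<^sup>2 \<le> g x"
  shows "L2_fun f"
proof -
  have "(\<lambda>x. (f x)\<^sup>2) absolutely_integrable_on {0..1}"
    by (rule measurable_bounded_by_integrable_imp_absolutely_integrable[OF _ _ g])
      (use f le in \<open>auto\<close>)
  moreover have "f absolutely_integrable_on {0..1}"
  proof (rule measurable_bounded_by_integrable_imp_absolutely_integrable[OF f])
    show "(\<lambda>x. 1 + g x) integrable_on {0..1}"
      using g by (intro integrable_add) auto
    show "norm (f x) \<le> 1 + g x" if "x \<in> {0..1}" for x
    proof -
      have "0 \<le> (\<bar>f x\<bar> - 1)\<^sup>2" by simp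
      then have "2 * \<bar>f x\<bar> \<le> 1 + (f x)\<^sup>2" by (simp add: power2_eq_square algebra_simps)
      moreover have "0 \<le> (f x)\<^sup>2" by simp
      ultimately show ?thesis using le[OF that] by simp
    qed
  qed auto
  ultimately show ?thesis
    by (auto simp: L2_fun_def absolutely_integrable_on_def)
qed

lemma L2_fun_mult_integrable:
  assumes "L2_fun f" "L2_fun g"
  shows "(\<lambda>x. f x * g x) absolutely_integrable_on {0..1}"
proof (rule measurable_bounded_by_integrable_imp_absolutely_integrable)
  show "(\<lambda>x. f x * g x) \<in> borel_measurable (lebesgue_on {0..1})"
    using assms[THEN L2_fun_measurable] by (rule borel_measurable_times)
  show "(\<lambda>x. (f x)\<^sup>2 + (g x)\<^sup>2) integrable_on {0..1}"
    using assms by (intro integrable_add) (auto simp: L2_fun_def)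
  show "norm (f x * g x) \<le> (f x)\<^sup>2 + (g x)\<^sup>2" for x
  proof -
    have "0 \<le> (\<bar>f x\<bar> - \<bar>g x\<bar>)\<^sup>2" by simp
    then have "2 * (\<bar>f x\<bar> * \<bar>g x\<bar>) \<le> (f x)\<^sup>2 + (g x)\<^sup>2" by (simp add: power2_eq_square algebra_simps)
    moreover have "0 \<le> (f x)\<^sup>2 + (g x)\<^sup>2" by simp
    ultimately show ?thesis unfolding real_norm_def abs_mult by linarith
  qed
qed auto

lemma L2_fun_mult_integrable': "L2_fun f \<Longrightarrow> L2_fun g \<Longrightarrow> (\<lambda>x. f x * g x) integrable_on {0..1}"
  using L2_fun_mult_integrable absolutely_integrable_on_def by blast

lemma L2_fun_add: assumes "L2_fun f" "L2_fun g" shows "L2_fun (\<lambda>x. f x + g x)"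
proof (rule L2_funI)
  show "(\<lambda>x. f x + g x) \<in> borel_measurable (lebesgue_on {0..1})"
    using assms[THEN L2_fun_measurable] by (rule borel_measurable_add)
  show "(\<lambda>x. 2 * (f x)\<^sup>2 + 2 * (g x)\<^sup>2) integrable_on {0..1}"
    using assms by (intro integrable_add integrable_on_mult_right) (auto simp: L2_fun_def)
  show "(f x + g x)\<^sup>2 \<le> 2 * (f x)\<^sup>2 + 2 * (g x)\<^sup>2" for x
    using sum_squares_bound[of "f x" "g x"] by (simp add: power2_sum)
qed

lemma L2_fun_cmult: assumes "L2_fun f" shows "L2_fun (\<lambda>x. c * f x)"
proof (rule L2_funI)
  show "(\<lambda>x. c * f x) \<in> borel_measurable (lebesgue_on {0..1})"
    using assms[THEN L2_fun_measurable] by simp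
  show "(\<lambda>x. c\<^sup>2 * (f x)\<^sup>2) integrable_on {0..1}"
    using assms by (intro integrable_on_mult_right) (auto simp: L2_fun_def)
qed (simp add: power_mult_distrib)

lemma L2_fun_diff: "L2_fun f \<Longrightarrow> L2_fun g \<Longrightarrow> L2_fun (\<lambda>x. f x - g x)"
  using L2_fun_add[of f "\<lambda>x. -1 * g x"] L2_fun_cmult[of g "-1"] by simp

lemma L2_fun_cont: assumes "continuous_on {0..1} f" shows "L2_fun f"
proof -
  have "continuous_on {0..1} (\<lambda>x. (f x)\<^sup>2)" using assms by (intro continuous_intros)
  with assms show ?thesis
    by (auto simp: L2_fun_def absolutely_integrable_continuous_real integrable_continuous_real)
qed

lemma L2_fun_sum: "(\<And>k. k \<in> K \<Longrightarrow> L2_fun (f k)) \<Longrightarrow> L2_fun (\<lambda>x. \<Sum>k\<in>K. f k x)"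
  by (induction K rule: infinite_finite_induct) (auto intro: L2_fun_add L2_fun_cont)

lemma L2_inner_cong: "(\<And>x. x \<in> {0..1} \<Longrightarrow> f x = f' x) \<Longrightarrow> (\<And>x. x \<in> {0..1} \<Longrightarrow> g x = g' x) \<Longrightarrow>
  L2_inner f g = L2_inner f' g'"
  unfolding L2_inner_def by (rule integral_cong) auto

lemma L2_inner_commute: "L2_inner f g = L2_inner g f"
  by (simp add: L2_inner_def mult.commute)

lemma L2_inner_add_left: "L2_fun f \<Longrightarrow> L2_fun g \<Longrightarrow> L2_fun h \<Longrightarrow>
   L2_inner (\<lambda>x. f x + g x) h = L2_inner f h + L2_inner g h"
  unfolding L2_inner_def distrib_right by (intro integral_add L2_fun_mult_integrable')

lemma L2_inner_diff_left: "L2_fun f \<Longrightarrow> L2_fun g \<Longrightarrow> L2_fun h \<Longrightarrow>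
   L2_inner (\<lambda>x. f x - g x) h = L2_inner f h - L2_inner g h"
  unfolding L2_inner_def left_diff_distrib by (intro integral_diff L2_fun_mult_integrable')

lemma L2_inner_cmult_left: "L2_inner (\<lambda>x. c * f x) h = c * L2_inner f h"
  by (simp add: L2_inner_def mult.assoc)

lemma L2_inner_add_right: "L2_fun f \<Longrightarrow> L2_fun g \<Longrightarrow> L2_fun h \<Longrightarrow>
   L2_inner h (\<lambda>x. f x + g x) = L2_inner h f + L2_inner h g"
  by (simp add: L2_inner_commute[of h] L2_inner_add_left)

lemma L2_inner_diff_right: "L2_fun f \<Longrightarrow> L2_fun g \<Longrightarrow> L2_fun h \<Longrightarrow>
   L2_inner h (\<lambda>x. f x - g x) = L2_inner h f - L2_inner h g"
  by (simp add: L2_inner_commute[of h] L2_inner_diff_left)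

lemma L2_inner_cmult_right: "L2_inner h (\<lambda>x. c * f x) = c * L2_inner h f"
  by (simp add: L2_inner_commute[of h] L2_inner_cmult_left)

lemma L2_inner_sum_left:
  "(\<And>k. k \<in> K \<Longrightarrow> L2_fun (f k)) \<Longrightarrow> L2_fun h \<Longrightarrow>
   L2_inner (\<lambda>x. \<Sum>k\<in>K. f k x) h = (\<Sum>k\<in>K. L2_inner (f k) h)"
proof (induction K rule: infinite_finite_induct)
  case (insert k K)
  then show ?case by (simp add: L2_inner_add_left L2_fun_sum)
qed (auto simp: L2_inner_def)

text \<open>If the square is not integrable, its integral is 0 by convention, so nonnegativity holds
  for every function.\<close>

lemma L2_inner_nonneg: "0 \<le> L2_inner f f"
proof (cases "(\<lambda>x. f x * f x) integrable_on {0..1}")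
  case True
  then show ?thesis unfolding L2_inner_def by (rule integral_nonneg) simp
qed (simp add: L2_inner_def not_integrable_integral)

lemma L2_norm_eq: "L2_norm f = sqrt (L2_inner f f)"
  by (simp add: L2_norm_def L2_inner_def power2_eq_square)

lemma L2_norm_nonneg [simp]: "0 \<le> L2_norm f"
  by (simp add: L2_norm_eq L2_inner_nonneg)

lemma L2_norm_sq: "(L2_norm f)\<^sup>2 = L2_inner f f"
  by (simp add: L2_norm_eq L2_inner_nonneg)

lemma L2_Cauchy_Schwarz:
  assumes f: "L2_fun f" and g: "L2_fun g"
  shows "\<bar>L2_inner f g\<bar> \<le> L2_norm f * L2_norm g"
proof -
  define A B C where "A = L2_inner f f" and "B = L2_inner f g" and "C = L2_inner g g"
  have q: "0 \<le> A - 2 * t * B + t\<^sup>2 * C" for t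
  proof -
    have "0 \<le> L2_inner (\<lambda>x. f x - t * g x) (\<lambda>x. f x - t * g x)" by (rule L2_inner_nonneg)
    also have "\<dots> = A - 2 * t * B + t\<^sup>2 * C"
      using f g by (simp add: L2_inner_diff_left L2_inner_diff_right L2_inner_cmult_left L2_inner_cmult_right
          L2_fun_diff L2_fun_cmult L2_inner_commute[of g f] A_def B_def C_def power2_eq_square algebra_simps)
    finally show ?thesis .
  qed
  have C: "C \<ge> 0" and A: "A \<ge> 0" by (auto simp: A_def C_def L2_inner_nonneg)
  have "B\<^sup>2 \<le> A * C"
  proof (cases "C = 0")
    case True
    show ?thesis
    proof (cases "B = 0")
      case False
      \<comment> \<open>For C = 0 the quadratic is affine in t, and this t gives it the value
        -1.\<close>
      have "A - 2 * ((A + 1) / (2 * B)) * B = -1" using False by (simp add: field_simps)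
      with q[of "(A + 1) / (2 * B)"] True show ?thesis by simp
    qed (use A C in auto)
  next
    case False
    with C have "C > 0" by simp
    \<comment> \<open>t = B / C minimises the quadratic.\<close>
    have "(A - 2 * (B / C) * B + (B / C)\<^sup>2 * C) * C = A * C - B\<^sup>2"
      using \<open>C > 0\<close> by (simp add: field_simps power2_eq_square)
    moreover have "(A - 2 * (B / C) * B + (B / C)\<^sup>2 * C) * C \<ge> 0"
      using q[of "B / C"] \<open>C > 0\<close> by (intro mult_nonneg_nonneg) auto
    ultimately show ?thesis by simp
  qed
  then have "sqrt (B\<^sup>2) \<le> sqrt (A * C)" by (rule real_sqrt_le_mono)
  then show ?thesis by (simp add: real_sqrt_mult A_def B_def C_def L2_norm_eq)
qed

lemma L2_norm_add_le:
  assumes f: "L2_fun f" and g: "L2_fun g"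
  shows "L2_norm (\<lambda>x. f x + g x) \<le> L2_norm f + L2_norm g"
proof (rule power2_le_imp_le)
  have "(L2_norm (\<lambda>x. f x + g x))\<^sup>2 = (L2_norm f)\<^sup>2 + 2 * L2_inner f g + (L2_norm g)\<^sup>2"
    using f g by (simp add: L2_norm_sq L2_inner_add_left L2_inner_add_right L2_fun_add L2_inner_commute[of g f])
  then show "(L2_norm (\<lambda>x. f x + g x))\<^sup>2 \<le> (L2_norm f + L2_norm g)\<^sup>2"
    using L2_Cauchy_Schwarz[OF f g] by (simp add: power2_sum)
qed simp

lemma L2_norm_cmult: "L2_norm (\<lambda>x. c * f x) = \<bar>c\<bar> * L2_norm f"
  by (simp add: L2_norm_eq L2_inner_cmult_left L2_inner_cmult_right real_sqrt_mult flip: mult.assoc power2_eq_square)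

lemma L2_norm_diff_commute: "L2_norm (\<lambda>x. f x - g x) = L2_norm (\<lambda>x. g x - f x)"
  using L2_norm_cmult[of "-1" "\<lambda>x. g x - f x"] by simp

lemma L2_norm_triangle_diff:
  assumes f: "L2_fun f" and g: "L2_fun g"
  shows "\<bar>L2_norm f - L2_norm g\<bar> \<le> L2_norm (\<lambda>x. f x - g x)"
  using L2_norm_add_le[OF L2_fun_diff[OF f g] g] L2_norm_add_le[OF L2_fun_diff[OF g f] f]
  by (simp add: L2_norm_diff_commute[of g f])

lemma L2_norm_cong: "(\<And>x. x \<in> {0..1} \<Longrightarrow> f x = f' x) \<Longrightarrow> L2_norm f = L2_norm f'"
  unfolding L2_norm_def by (intro arg_cong[where f = sqrt] integral_cong) auto

lemma L2_norm_le_sup: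
  assumes f: "continuous_on {0..1} f" and le: "\<And>x. x \<in> {0..1} \<Longrightarrow> \<bar>f x\<bar> \<le> c"
  shows "L2_norm f \<le> c"
proof -
  have c: "0 \<le> c" using le[of 0] by auto
  have "L2_inner f f \<le> integral {0..1} (\<lambda>x::real. c\<^sup>2)"
    unfolding L2_inner_def
  proof (rule integral_le)
    show "(\<lambda>x. f x * f x) integrable_on {0..1}"
      by (intro L2_fun_mult_integrable' L2_fun_cont f)
    show "f x * f x \<le> c\<^sup>2" if "x \<in> {0..1}" for x
      using power_mono[OF le[OF that], of 2] by (simp add: power2_eq_square)
  qed auto
  then have "(L2_norm f)\<^sup>2 \<le> c\<^sup>2" by (simp add: L2_norm_sq)
  then show ?thesis using c by (rule power2_le_imp_le)
qed

lemma L2_inner_le_sup: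
  assumes f: "continuous_on {0..1} f" and le: "\<And>x. x \<in> {0..1} \<Longrightarrow> \<bar>f x\<bar> \<le> c"
    and g: "continuous_on {0..1} g" and leg: "\<And>x. x \<in> {0..1} \<Longrightarrow> \<bar>g x\<bar> \<le> d"
  shows "\<bar>L2_inner f g\<bar> \<le> c * d"
proof -
  have "0 \<le> c" using le[of 0] by auto
  then show ?thesis
    using L2_Cauchy_Schwarz[OF L2_fun_cont[OF f] L2_fun_cont[OF g]]
      mult_mono[OF L2_norm_le_sup[OF f le] L2_norm_le_sup[OF g leg]] by force
qed

text \<open>Dominated convergence is used twice: g is replaced by its truncation at height M, with
  majorant g^2, and the truncation by clipped continuous functions, for which the common bound M
  supplies a constant majorant.\<close>

lemma L2_dense_continuous:
  assumes g: "L2_fun g" and e: "0 < (e::real)"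
  obtains h where "continuous_on {0..1} h" "L2_norm (\<lambda>x. g x - h x) < e"
proof -
  let ?S = "{0..1::real}"
  define cl where "cl M y = max (- real M) (min (real M) y)" for M :: nat and y :: real
  have clm: "(\<lambda>x. cl M (f x)) \<in> borel_measurable (lebesgue_on ?S)"
    if "f \<in> borel_measurable (lebesgue_on ?S)" for f M
    unfolding cl_def using that by simp
  have clb: "\<bar>cl M y\<bar> \<le> real M" for M y unfolding cl_def by auto
  have gi: "(\<lambda>x. (g x)\<^sup>2) integrable_on ?S" using g by (simp add: L2_fun_def)
  have L2cl: "L2_fun (\<lambda>x. cl M (f x))" if "f \<in> borel_measurable (lebesgue_on ?S)" for f M
  proof (rule L2_funI[OF clm[OF that]])
    show "(cl M (f x))\<^sup>2 \<le> (real M)\<^sup>2" for x using clb[of M "f x"] by (simp add: power2_le_iff_abs_le)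
  qed auto
  have gm: "g \<in> borel_measurable (lebesgue_on ?S)" using g by (rule L2_fun_measurable)
  have 1: "(\<lambda>M. integral ?S (\<lambda>x. (g x - cl M (g x))\<^sup>2)) \<longlonglongrightarrow> integral ?S (\<lambda>x. 0)"
  proof (rule dominated_convergence(2)[where h = "\<lambda>x. (g x)\<^sup>2"])
    show "(\<lambda>x. (g x - cl M (g x))\<^sup>2) integrable_on ?S" for M
      using L2_fun_diff[OF g L2cl[OF gm]] by (simp add: L2_fun_def)
    show "norm ((g x - cl M (g x))\<^sup>2) \<le> (g x)\<^sup>2" for M x
    proof -
      have "\<bar>g x - cl M (g x)\<bar> \<le> \<bar>g x\<bar>" unfolding cl_def by (auto simp: max_def min_def)
      then show ?thesis by (simp add: abs_le_square_iff)
    qed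
    show "(\<lambda>M. (g x - cl M (g x))\<^sup>2) \<longlonglongrightarrow> 0" for x
    proof (rule tendsto_eventually)
      obtain M0 :: nat where "\<bar>g x\<bar> \<le> real M0" using real_arch_simple by blast
      then have "(g x - cl M (g x))\<^sup>2 = 0" if "M \<ge> M0" for M
        using that unfolding cl_def by (auto simp: max_def min_def)
      then show "\<forall>\<^sub>F M in sequentially. (g x - cl M (g x))\<^sup>2 = 0"
        by (auto simp: eventually_sequentially)
    qed
  qed (rule gi)
  have e4: "e\<^sup>2 / 4 > 0" using e by simp
  have "\<forall>\<^sub>F M in sequentially. integral ?S (\<lambda>x. (g x - cl M (g x))\<^sup>2) < e\<^sup>2 / 4"
    using order_tendstoD(2)[OF 1, of "e\<^sup>2 / 4"] e4 by simp
  then obtain M where M: "integral ?S (\<lambda>x. (g x - cl M (g x))\<^sup>2) < e\<^sup>2 / 4"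
    using eventually_happens'[OF sequentially_bot] by blast
  \<comment> \<open>This notion of measurability provides continuous functions converging to g off a
    negligible set.\<close>
  have "g measurable_on ?S" using gm by (subst measurable_on_iff_borel_measurable) auto
  then obtain Z F where Z: "negligible Z" and F: "\<And>n. continuous_on UNIV (F n :: real \<Rightarrow> real)"
    and lim: "\<And>x. x \<notin> Z \<Longrightarrow> (\<lambda>n. F n x) \<longlonglongrightarrow> (if x \<in> ?S then g x else 0)"
    unfolding measurable_on_def by blast
  have clF: "continuous_on ?S (\<lambda>x. cl M (F n x))" for n
    unfolding cl_def by (intro continuous_intros continuous_on_subset[OF F]) auto
  have i2: "(\<lambda>x. (cl M (g x) - cl M (F n x))\<^sup>2) integrable_on ?S" for n
    using L2_fun_diff[OF L2cl[OF gm, of M] L2_fun_cont[OF clF[of n]]] by (simp add: L2_fun_def)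
  have 2: "(\<lambda>n. integral ?S (\<lambda>x. if x \<in> Z then 0 else (cl M (g x) - cl M (F n x))\<^sup>2)) \<longlonglongrightarrow> integral ?S (\<lambda>x. 0)"
  proof (rule dominated_convergence(2)[where h = "\<lambda>x. (2 * real M)\<^sup>2"])
    show "(\<lambda>x. if x \<in> Z then 0 else (cl M (g x) - cl M (F n x))\<^sup>2) integrable_on ?S" for n
      by (rule integrable_spike[OF i2[of n] Z]) auto
    show "norm (if x \<in> Z then 0 else (cl M (g x) - cl M (F n x))\<^sup>2) \<le> (2 * real M)\<^sup>2" for n x
    proof -
      have "\<bar>cl M (g x) - cl M (F n x)\<bar> \<le> 2 * real M" using clb[of M "g x"] clb[of M "F n x"] by linarith
      then have "(cl M (g x) - cl M (F n x))\<^sup>2 \<le> (2 * real M)\<^sup>2"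
        using power2_le_iff_abs_le[of "2 * real M"] by simp
      then show ?thesis by simp
    qed
    show "(\<lambda>n. if x \<in> Z then 0 else (cl M (g x) - cl M (F n x))\<^sup>2) \<longlonglongrightarrow> 0" if "x \<in> ?S" for x
    proof (cases "x \<in> Z")
      case False
      have "(\<lambda>n. F n x) \<longlonglongrightarrow> g x" using lim[OF False] that by simp
      then have "(\<lambda>n. (cl M (g x) - cl M (F n x))\<^sup>2) \<longlonglongrightarrow> (cl M (g x) - cl M (g x))\<^sup>2"
        unfolding cl_def by (intro tendsto_intros)
      with False show ?thesis by simp
    qed simp
  qed auto
  have "\<forall>\<^sub>F n in sequentially.
      integral ?S (\<lambda>x. if x \<in> Z then 0 else (cl M (g x) - cl M (F n x))\<^sup>2) < e\<^sup>2 / 4"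
    using order_tendstoD(2)[OF 2, of "e\<^sup>2 / 4"] e4 by simp
  then obtain n
    where n: "integral ?S (\<lambda>x. if x \<in> Z then 0 else (cl M (g x) - cl M (F n x))\<^sup>2) < e\<^sup>2 / 4"
    using eventually_happens'[OF sequentially_bot] by blast
  have n': "integral ?S (\<lambda>x. (cl M (g x) - cl M (F n x))\<^sup>2) < e\<^sup>2 / 4"
    using n integral_spike[OF Z, of ?S "\<lambda>x. (cl M (g x) - cl M (F n x))\<^sup>2"
        "\<lambda>x. if x \<in> Z then 0 else (cl M (g x) - cl M (F n x))\<^sup>2"] by auto
  have hl: "sqrt (e\<^sup>2 / 4) = e / 2" using e by (simp add: real_sqrt_divide)
  have "L2_norm (\<lambda>x. g x - cl M (F n x)) \<le> L2_norm (\<lambda>x. g x - cl M (g x)) + L2_norm (\<lambda>x. cl M (g x) - cl M (F n x))"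
    using L2_norm_add_le[OF L2_fun_diff[OF g L2cl[OF gm, of M]] L2_fun_diff[OF L2cl[OF gm, of M] L2_fun_cont[OF clF[of n]]]]
    by simp
  also have "\<dots> < e / 2 + e / 2"
    unfolding L2_norm_def hl[symmetric] by (intro add_strict_mono real_sqrt_less_mono M n')
  finally show ?thesis using that[OF clF[of n]] by simp
qed

section \<open>Trigonometric systems and weak derivatives\<close>


definition cosf :: "nat \<Rightarrow> real \<Rightarrow> real" where
  "cosf k x = cos (pi * real k * x)"

lemma cosf_cont [continuous_intros]: "continuous_on S (cosf k)"
  unfolding cosf_def by (intro continuous_intros)

lemma phi_cont [continuous_intros]: "continuous_on S (phi k)"
  unfolding phi_def by (intro continuous_intros)

lemma L2_fun_cosf [simp]: "L2_fun (cosf k)" and L2_fun_phi [simp]: "L2_fun (phi k)"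
  by (intro L2_fun_cont continuous_intros)+

lemma abs_cosf_le [simp]: "\<bar>cosf k x\<bar> \<le> 1" and abs_phi_le [simp]: "\<bar>phi k x\<bar> \<le> 1"
  by (simp_all add: cosf_def phi_def)

lemma L2_norm_phi_le: "L2_norm (phi k) \<le> 1" and L2_norm_cosf_le: "L2_norm (cosf k) \<le> 1"
  by (rule L2_norm_le_sup; simp add: continuous_intros)+

lemma phi_0 [simp]: "phi 0 x = 0" by (simp add: phi_def)

lemma phi_at_0 [simp]: "phi k 0 = 0" and phi_at_1 [simp]: "phi k 1 = 0"
  by (simp_all add: phi_def mult.commute)

lemma L2_inner_phi_0 [simp]: "L2_inner f (phi 0) = 0"
  by (simp add: L2_inner_def)

lemma sin_pi_int: "sin (pi * of_int m) = 0"
  using sin_npi_int[of m] by (simp add: mult.commute)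

lemma integral_cos_pi_int:
  "((\<lambda>x. cos (pi * of_int m * x)) has_integral (if m = 0 then 1 else 0)) {0..1}"
proof (cases "m = 0")
  case True
  then show ?thesis using has_integral_const_real[of "1::real" 0 1] by simp
next
  case False
  have "((\<lambda>x. cos (pi * of_int m * x)) has_integral
     (sin (pi * of_int m * 1) / (pi * of_int m) - sin (pi * of_int m * 0) / (pi * of_int m))) {0..1}"
    by (rule fundamental_theorem_of_calculus)
       (use False in \<open>auto intro!: derivative_eq_intros simp flip: has_real_derivative_iff_has_vector_derivative\<close>)
  then show ?thesis using False by (simp add: sin_pi_int)
qed

lemma L2_inner_cosf: "L2_inner (cosf k) (cosf l) = (if k = l then (if k = 0 then 1 else 1/2) else 0)"
proof -
  have eq: "cosf k x * cosf l x = (1/2) * (cos (pi * of_int (int k - int l) * x) + cos (pi * of_int (int k + int l) * x))" for x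
    by (simp add: cosf_def cos_times_cos algebra_simps)
  have "((\<lambda>x. cosf k x * cosf l x) has_integral
     (1/2) * ((if int k - int l = 0 then 1 else 0) + (if int k + int l = 0 then 1 else 0))) {0..1}"
    unfolding eq by (intro has_integral_mult_right has_integral_add integral_cos_pi_int)
  then show ?thesis unfolding L2_inner_def by (auto dest!: integral_unique)
qed

lemma L2_inner_phi: "L2_inner (phi k) (phi l) = (if k = l \<and> k \<noteq> 0 then 1/2 else 0)"
proof -
  have eq: "phi k x * phi l x = (1/2) * (cos (pi * of_int (int k - int l) * x) - cos (pi * of_int (int k + int l) * x))" for x
    by (simp add: phi_def sin_times_sin algebra_simps diff_divide_distrib)
  have "((\<lambda>x. phi k x * phi l x) has_integral
     (1/2) * ((if int k - int l = 0 then 1 else 0) - (if int k + int l = 0 then 1 else 0))) {0..1}"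
    unfolding eq by (intro has_integral_mult_right has_integral_diff integral_cos_pi_int)
  then show ?thesis unfolding L2_inner_def by (auto dest!: integral_unique)
qed

text \<open>The coefficients are fixed by c k <e k, e k> = <v, e k> and not by a quotient, so that
  the zero function \<open>phi 0\<close> and the constant \<open>cosf 0\<close> fit the same
  formula.\<close>

lemma orthogonal_remainder:
  fixes n :: nat
  assumes v: "L2_fun v" and e: "\<And>k. L2_fun (e k)"
    and orth: "\<And>k l. k \<noteq> l \<Longrightarrow> L2_inner (e k) (e l) = 0"
    and c: "\<And>k. c k * L2_inner (e k) (e k) = L2_inner v (e k)"
  defines "r \<equiv> \<lambda>x. v x - (\<Sum>k\<le>n. c k * e k x)"
  shows "m \<le> n \<Longrightarrow> L2_inner r (e m) = 0"
    and "L2_inner r r = L2_inner v v - (\<Sum>k\<le>n. c k * L2_inner v (e k))"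
proof -
  have s: "L2_fun (\<lambda>x. \<Sum>k\<le>n. c k * e k x)" by (intro L2_fun_sum L2_fun_cmult e)
  have r: "L2_fun r" unfolding r_def by (intro L2_fun_diff v s)
  have inner_r: "L2_inner r f = L2_inner v f - (\<Sum>k\<le>n. c k * L2_inner (e k) f)" if "L2_fun f" for f
    unfolding r_def using that
    by (simp add: L2_inner_diff_left[OF v s that] L2_inner_sum_left L2_fun_cmult e L2_inner_cmult_left)
  have 1: "L2_inner r (e m) = 0" if "m \<le> n" for m
  proof -
    have "(\<Sum>k\<le>n. c k * L2_inner (e k) (e m)) = (\<Sum>k\<le>n. if k = m then c k * L2_inner (e m) (e m) else 0)"
      by (intro sum.cong) (auto simp: orth)
    also have "\<dots> = c m * L2_inner (e m) (e m)" using that by simp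
    finally show ?thesis by (simp add: inner_r[OF e] c)
  qed
  then show "m \<le> n \<Longrightarrow> L2_inner r (e m) = 0" .
  have "L2_inner r r = L2_inner r v - L2_inner r (\<lambda>x. \<Sum>k\<le>n. c k * e k x)"
    by (subst (2) r_def) (rule L2_inner_diff_right[OF v s r])
  also have "L2_inner r (\<lambda>x. \<Sum>k\<le>n. c k * e k x) = (\<Sum>k\<le>n. c k * L2_inner r (e k))"
    by (subst L2_inner_commute) (simp add: L2_inner_sum_left L2_fun_cmult e r L2_inner_cmult_left L2_inner_commute[of r])
  also have "\<dots> = 0" using 1 by simp
  also have "L2_inner r v = L2_inner v v - (\<Sum>k\<le>n. c k * L2_inner v (e k))"
    using inner_r[OF v] by (simp add: L2_inner_commute[of "e _" v])
  finally show "L2_inner r r = L2_inner v v - (\<Sum>k\<le>n. c k * L2_inner v (e k))" by simp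
qed

lemma sine_Bessel:
  assumes v: "L2_fun v"
  shows "summable (\<lambda>k. (L2_inner v (phi k))\<^sup>2)" "2 * (\<Sum>k. (L2_inner v (phi k))\<^sup>2) \<le> L2_inner v v"
proof -
  have fin: "(\<Sum>k\<le>n. 2 * (L2_inner v (phi k))\<^sup>2) \<le> L2_inner v v" for n
  proof -
    have "0 \<le> L2_inner v v - (\<Sum>k\<le>n. (2 * L2_inner v (phi k)) * L2_inner v (phi k))"
      using orthogonal_remainder(2)[OF v L2_fun_phi, where c = "\<lambda>k. 2 * L2_inner v (phi k)" and n = n]
        L2_inner_nonneg[of "\<lambda>x. v x - (\<Sum>k\<le>n. 2 * L2_inner v (phi k) * phi k x)"]
      by (simp add: L2_inner_phi)
    then show ?thesis by (simp add: power2_eq_square mult.assoc)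
  qed
  have fin': "(\<Sum>k<n. 2 * (L2_inner v (phi k))\<^sup>2) \<le> L2_inner v v" for n
    by (rule order.trans[OF sum_mono2 fin[of n]]) auto
  have s: "summable (\<lambda>k. 2 * (L2_inner v (phi k))\<^sup>2)"
    by (rule summableI_nonneg_bounded[OF _ fin']) simp
  then show s': "summable (\<lambda>k. (L2_inner v (phi k))\<^sup>2)" by simp
  have "(\<Sum>k. 2 * (L2_inner v (phi k))\<^sup>2) \<le> L2_inner v v"
    by (rule suminf_le_const[OF s fin'])
  then show "2 * (\<Sum>k. (L2_inner v (phi k))\<^sup>2) \<le> L2_inner v v"
    using suminf_mult[OF s', of 2] by simp
qed

text \<open>Cosine polynomials of degree at most n. Generating them by rules lets continuity and
  orthogonality be proved by induction, without coefficient lists.\<close>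

inductive cospoly :: "nat \<Rightarrow> (real \<Rightarrow> real) \<Rightarrow> bool" where
  cos: "k \<le> n \<Longrightarrow> cospoly n (cosf k)"
| add: "cospoly n f \<Longrightarrow> cospoly n g \<Longrightarrow> cospoly n (\<lambda>x. f x + g x)"
| scale: "cospoly n f \<Longrightarrow> cospoly n (\<lambda>x. c * f x)"

lemma cospoly_mono: "cospoly n f \<Longrightarrow> n \<le> m \<Longrightarrow> cospoly m f"
  by (induction rule: cospoly.induct) (auto intro: cospoly.intros)

lemma cospoly_cont: "cospoly n f \<Longrightarrow> continuous_on {0..1} f"
  by (induction rule: cospoly.induct) (auto intro!: continuous_intros)

lemma cospoly_orth:
  "cospoly n f \<Longrightarrow> L2_fun r \<Longrightarrow> (\<And>m. m \<le> n \<Longrightarrow> L2_inner r (cosf m) = 0) \<Longrightarrow> L2_inner r f = 0"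
proof (induction rule: cospoly.induct)
  case (add n f g)
  then show ?case by (simp add: L2_inner_add_right L2_fun_cont cospoly_cont)
qed (auto simp: L2_inner_cmult_right)

lemma cospoly_zero: "cospoly n (\<lambda>x. 0)"
  using cospoly.scale[OF cospoly.cos[of 0 n], of 0] by simp

lemma cospoly_sum: "(\<And>k. k \<in> K \<Longrightarrow> cospoly n (f k)) \<Longrightarrow> cospoly n (\<lambda>x. \<Sum>k\<in>K. f k x)"
  by (induction K rule: infinite_finite_induct) (auto intro: cospoly_zero cospoly.add)

lemma cospoly_diff: "cospoly n f \<Longrightarrow> cospoly n g \<Longrightarrow> cospoly n (\<lambda>x. f x - g x)"
  using cospoly.add[of n f "\<lambda>x. -1 * g x"] cospoly.scale[of n g "-1"] by simp

text \<open>The product formula for cosines raises the degree by one; iterated from the constant it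
  yields the powers of cos (pi x).\<close>

lemma cospoly_times_cos: "cospoly n f \<Longrightarrow> cospoly (Suc n) (\<lambda>x. cos (pi * x) * f x)"
proof (induction rule: cospoly.induct)
  case (cos k n)
  show ?case
  proof (cases k)
    case 0
    have "(\<lambda>x. cos (pi * x) * cosf k x) = cosf 1" by (auto simp: cosf_def 0)
    then show ?thesis using cospoly.cos[of 1 "Suc n"] by simp
  next
    case (Suc m)
    have "(\<lambda>x. cos (pi * x) * cosf k x) = (\<lambda>x. (1/2) * cosf (Suc (Suc m)) x + (1/2) * cosf m x)"
    proof
      fix x
      have "cosf k x * cos (pi * x) = (cos (pi * real k * x - pi * x) + cos (pi * real k * x + pi * x)) / 2"
        unfolding cosf_def by (rule cos_times_cos)
      also have "pi * real k * x - pi * x = pi * real m * x" by (simp add: Suc algebra_simps)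
      also have "pi * real k * x + pi * x = pi * real (Suc (Suc m)) * x" by (simp add: Suc algebra_simps)
      finally show "cos (pi * x) * cosf k x = (1/2) * cosf (Suc (Suc m)) x + (1/2) * cosf m x"
        by (simp add: cosf_def mult.commute)
    qed
    moreover have "cospoly (Suc n) (\<lambda>x. (1/2) * cosf (Suc (Suc m)) x + (1/2) * cosf m x)"
      using cos Suc by (intro cospoly.add cospoly.scale cospoly.cos) auto
    ultimately show ?thesis by simp
  qed
next
  case (add n f g)
  then show ?case using cospoly.add[OF add.IH] by (simp add: algebra_simps)
next
  case (scale n f c)
  then show ?case using cospoly.scale[OF scale.IH, of c] by (simp add: algebra_simps)
qed

lemma cospoly_cos_power: "cospoly i (\<lambda>x. cos (pi * x) ^ i)"
proof (induction i)
  case 0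
  have "cosf 0 = (\<lambda>x. 1)" by (auto simp: cosf_def)
  then show ?case using cospoly.cos[of 0 0] by simp
next
  case (Suc i)
  then show ?case using cospoly_times_cos by simp
qed

text \<open>The substitution y = cos (pi x) maps [0,1] bijectively onto [-1,1], so this is the
  Weierstrass theorem in y, powers of cos (pi x) being cosine polynomials.\<close>

lemma cospoly_dense:
  assumes h: "continuous_on {0..1} h" and e: "0 < (e::real)"
  obtains n p where "cospoly n p" "\<And>x. x \<in> {0..1} \<Longrightarrow> \<bar>h x - p x\<bar> < e"
proof -
  have "continuous_on {-1..1::real} (\<lambda>y. h (arccos y / pi))"
    by (rule continuous_on_compose2[OF h])
      (auto intro!: continuous_intros simp: arccos_lbound arccos_ubound)
  then obtain q where q: "real_polynomial_function q" and
    qe: "\<And>y. y \<in> {-1..1} \<Longrightarrow> \<bar>h (arccos y / pi) - q y\<bar> < e"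
    using Stone_Weierstrass_real_polynomial_function[of "{-1..1::real}" _ e] e by (metis compact_Icc)
  obtain a n where qa: "q = (\<lambda>x. \<Sum>i\<le>n. a i * x ^ i)"
    using q real_polynomial_function_iff_sum by metis
  have "cospoly n (\<lambda>x. \<Sum>i\<le>n. a i * cos (pi * x) ^ i)"
    by (intro cospoly_sum cospoly.scale) (auto intro: cospoly_mono[OF cospoly_cos_power])
  moreover have "\<bar>h x - (\<Sum>i\<le>n. a i * cos (pi * x) ^ i)\<bar> < e" if x: "x \<in> {0..1}" for x
  proof -
    have "arccos (cos (pi * x)) = pi * x" using x by (intro arccos_cos) auto
    then show ?thesis using qe[of "cos (pi * x)"] by (simp add: qa)
  qed
  ultimately show ?thesis by (rule that)
qed

text \<open>The reciprocal of the squared norm of \<open>cosf k\<close>, the weight of this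
  unnormalised system in Parseval's identity.\<close>

definition ccw :: "nat \<Rightarrow> real" where "ccw k = (if k = 0 then 1 else 2)"

lemma cosine_Parseval:
  assumes g: "L2_fun g"
  shows "(\<lambda>k. ccw k * (L2_inner g (cosf k))\<^sup>2) sums L2_inner g g"
proof -
  define c where "c k = ccw k * L2_inner g (cosf k)" for k
  define r where "r n x = g x - (\<Sum>k\<le>n. c k * cosf k x)" for n x
  have cc: "c k * L2_inner (cosf k) (cosf k) = L2_inner g (cosf k)" for k
    by (simp add: c_def ccw_def L2_inner_cosf)
  have orth: "L2_inner (cosf k) (cosf l) = 0" if "k \<noteq> l" for k l using that by (simp add: L2_inner_cosf)
  have rem: "m \<le> n \<Longrightarrow> L2_inner (r n) (cosf m) = 0"
      "L2_inner (r n) (r n) = L2_inner g g - (\<Sum>k\<le>n. c k * L2_inner g (cosf k))" for m n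
    using orthogonal_remainder[where e = cosf and c = c and n = n, OF g L2_fun_cosf orth cc]
    unfolding r_def[abs_def] by blast+
  have s: "cospoly n (\<lambda>x. \<Sum>k\<le>n. c k * cosf k x)" for n
    by (intro cospoly_sum cospoly.scale cospoly.cos) auto
  have rL: "L2_fun (r n)" for n
    using L2_fun_diff[OF g L2_fun_cont[OF cospoly_cont[OF s[of n]]]] by (simp add: r_def[abs_def])
  have small: "\<forall>\<^sub>F n in sequentially. L2_norm (r n) < e" if "e > 0" for e
  proof -
    obtain h where h: "continuous_on {0..1} h" "L2_norm (\<lambda>x. g x - h x) < e / 2"
      using L2_dense_continuous[OF g, of "e/2"] \<open>e > 0\<close> by auto
    obtain n0 p where p: "cospoly n0 p" "\<And>x. x \<in> {0..1} \<Longrightarrow> \<bar>h x - p x\<bar> < e / 2"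
      using cospoly_dense[OF h(1), of "e/2"] \<open>e > 0\<close> by auto
    have pc: "continuous_on {0..1} p" using p(1) by (rule cospoly_cont)
    have "L2_norm (\<lambda>x. h x - p x) \<le> e / 2"
      by (rule L2_norm_le_sup) (use h pc p in \<open>auto intro!: continuous_intros less_imp_le\<close>)
    then have gp: "L2_norm (\<lambda>x. g x - p x) < e"
      using L2_norm_add_le[OF L2_fun_diff[OF g L2_fun_cont[OF h(1)]] L2_fun_cont[OF continuous_on_diff[OF h(1) pc]]] h(2)
      by simp
    have "L2_norm (r n) < e" if "n \<ge> n0" for n
    proof -
      let ?q = "\<lambda>x. (\<Sum>k\<le>n. c k * cosf k x) - p x"
      have q: "cospoly n ?q" by (intro cospoly_diff s cospoly_mono[OF p(1) that])
      have 0: "L2_inner (r n) ?q = 0" by (rule cospoly_orth[OF q rL rem(1)])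
      have gpL: "L2_fun (\<lambda>x. g x - p x)" by (intro L2_fun_diff g L2_fun_cont pc)
      \<comment> \<open>Best approximation: the remainder is orthogonal to every cosine polynomial
        of degree at most n, so its norm is at most the distance from g to p.\<close>
      have "r n = (\<lambda>x. (g x - p x) - ?q x)" by (auto simp: r_def)
      then have "L2_inner (r n) (r n) = L2_inner (r n) (\<lambda>x. (g x - p x) - ?q x)" by simp
      also have "\<dots> = L2_inner (r n) (\<lambda>x. g x - p x)"
        using L2_inner_diff_right[OF gpL L2_fun_cont[OF cospoly_cont[OF q]] rL[of n]] 0 by simp
      also have "\<dots> \<le> L2_norm (r n) * L2_norm (\<lambda>x. g x - p x)"
        using L2_Cauchy_Schwarz[OF rL gpL] abs_le_D1 by blast
      finally have "L2_norm (r n) * L2_norm (r n) \<le> L2_norm (r n) * L2_norm (\<lambda>x. g x - p x)"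
        by (simp add: L2_norm_sq[symmetric] power2_eq_square)
      then have "L2_norm (r n) \<le> L2_norm (\<lambda>x. g x - p x)"
        by (metis L2_norm_nonneg mult_le_cancel_left_pos order_le_less)
      then show ?thesis using gp by simp
    qed
    then show ?thesis by (auto simp: eventually_sequentially)
  qed
  have "(\<lambda>n. L2_norm (r n)) \<longlonglongrightarrow> 0"
    using small by (auto simp: tendsto_iff dist_real_def)
  then have "(\<lambda>n. (L2_norm (r n))\<^sup>2) \<longlonglongrightarrow> 0\<^sup>2" by (rule tendsto_power)
  then have "(\<lambda>n. L2_inner g g - L2_inner (r n) (r n)) \<longlonglongrightarrow> L2_inner g g - 0"
    by (intro tendsto_intros) (simp add: L2_norm_sq)
  moreover have "L2_inner g g - L2_inner (r n) (r n) = (\<Sum>k\<le>n. ccw k * (L2_inner g (cosf k))\<^sup>2)" for n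
    by (simp add: rem(2) c_def power2_eq_square mult.assoc)
  ultimately show ?thesis by (simp add: sums_def_le)
qed

section \<open>Weak derivatives and the norm of H^1\<close>

lemma is_weak_derivD:
  assumes "is_weak_deriv u g"
  shows "L2_fun g" "x \<in> {0..1} \<Longrightarrow> u x = u 0 + integral {0..x} g"
  using assms unfolding is_weak_deriv_def by blast+

lemma L2_fun_integrable: "L2_fun g \<Longrightarrow> g integrable_on {0..1}"
  by (auto simp: L2_fun_def absolutely_integrable_on_def)

lemma weak_deriv_cont: assumes "is_weak_deriv u g" shows "continuous_on {0..1} u"
proof -
  have "g integrable_on {0..1}"
    by (rule L2_fun_integrable[OF is_weak_derivD(1)[OF assms]])
  then have "continuous_on {0..1} (\<lambda>x. u 0 + integral {0..x} g)"
    by (intro continuous_intros indefinite_integral_continuous_1)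
  then show ?thesis
    by (rule continuous_on_eq) (rule is_weak_derivD(2)[OF assms, symmetric])
qed

lemma integral_abs_le_L2_norm:
  assumes g: "L2_fun g" and x: "x \<in> {0..1}"
  shows "\<bar>integral {0..x} g\<bar> \<le> L2_norm g"
proof -
  have ai: "(\<lambda>x. \<bar>g x\<bar>) absolutely_integrable_on {0..1}"
    using g absolutely_integrable_norm[of "{0..1}" g] by (simp add: L2_fun_def comp_def)
  have gi: "g integrable_on {0..1}" using g by (rule L2_fun_integrable)
  have ai': "(\<lambda>x. \<bar>g x\<bar>) integrable_on {0..1}" using ai by (auto simp: absolutely_integrable_on_def)
  have Lg: "L2_fun (\<lambda>x. \<bar>g x\<bar>)" using g ai by (simp add: L2_fun_def)
  have L1: "L2_fun (\<lambda>x. 1)" by (rule L2_fun_cont) simp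
  have sub: "{0..x} \<subseteq> {0..1}" using x by auto
  have "\<bar>integral {0..x} g\<bar> \<le> integral {0..x} (\<lambda>x. \<bar>g x\<bar>)"
    using integral_norm_bound_integral[of g "{0..x}" "\<lambda>x. \<bar>g x\<bar>"]
      integrable_on_subinterval[OF gi sub] integrable_on_subinterval[OF ai' sub] by simp
  also have "\<dots> \<le> integral {0..1} (\<lambda>x. \<bar>g x\<bar>)"
    by (rule integral_subset_le[OF sub integrable_on_subinterval[OF ai' sub] ai']) auto
  also have "\<dots> = L2_inner (\<lambda>x. \<bar>g x\<bar>) (\<lambda>x. 1)" by (simp add: L2_inner_def)
  also have "\<dots> \<le> L2_norm (\<lambda>x. \<bar>g x\<bar>) * L2_norm (\<lambda>x. 1)"
    using L2_Cauchy_Schwarz[OF Lg L1] by linarith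
  also have "L2_norm (\<lambda>x. 1) = 1" by (simp add: L2_norm_def)
  also have "L2_norm (\<lambda>x. \<bar>g x\<bar>) = L2_norm g" by (simp add: L2_norm_def)
  finally show ?thesis by simp
qed

lemma integral_has_derivative:
  fixes h :: "real \<Rightarrow> real"
  assumes "continuous_on {0..1} h" "x \<in> {0..1}"
  shows "((\<lambda>x. c + integral {0..x} h) has_real_derivative h x) (at x within {0..1})"
  using integral_has_vector_derivative[OF assms]
  by (auto intro!: derivative_eq_intros simp: has_real_derivative_iff_has_vector_derivative)

lemma is_weak_derivI:
  assumes "continuous_on {0..1} h"
    and "\<And>x. x \<in> {0..1} \<Longrightarrow> (u has_real_derivative h x) (at x within {0..1})"
  shows "is_weak_deriv u h"
  unfolding is_weak_deriv_def
proof (intro conjI ballI)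
  fix x :: real assume x: "x \<in> {0..1}"
  have "(h has_integral (u x - u 0)) {0..x}"
    by (rule fundamental_theorem_of_calculus)
      (use x assms(2) in \<open>auto simp flip: has_real_derivative_iff_has_vector_derivative
        intro: DERIV_subset[where s = "{0..1}"]\<close>)
  then show "u x = u 0 + integral {0..x} h" by (simp add: integral_unique)
qed (rule L2_fun_cont[OF assms(1)])

text \<open>Integration by parts. The defect \<open>d\<close> vanishes for a continuous derivative
  by the fundamental theorem of calculus. Approximating g in L^2 moves u uniformly by no more than
  the same error, so the defect is at most a fixed multiple of every positive e.\<close>

lemma cosine_coeff_weak_deriv:
  assumes w: "is_weak_deriv u g"
  shows "L2_inner g (cosf k) = u 1 * cos (pi * real k) - u 0 + pi * real k * L2_inner u (phi k)"
proof -
  define d where "d u g = L2_inner g (cosf k) - u 1 * cos (pi * real k) + u 0 - pi * real k * L2_inner u (phi k)"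
    for u g :: "real \<Rightarrow> real"
  have g: "L2_fun g" and ug: "\<And>x. x \<in> {0..1} \<Longrightarrow> u x = u 0 + integral {0..x} g"
    using is_weak_derivD[OF w] by blast+
  have uL: "L2_fun u" by (intro L2_fun_cont weak_deriv_cont[OF w])
  have "\<bar>d u g\<bar> \<le> (2 + pi * real k) * e" if "e > 0" for e
  proof -
    obtain h where h: "continuous_on {0..1} h" "L2_norm (\<lambda>x. g x - h x) < e"
      using L2_dense_continuous[OF g \<open>e > 0\<close>] by auto
    define v where "v x = u 0 + integral {0..x} h" for x
    have dv: "(v has_real_derivative h x) (at x within {0..1})" if "x \<in> {0..1}" for x
      unfolding v_def using h(1) that by (rule integral_has_derivative)
    have vw: "is_weak_deriv v h" using h(1) dv by (rule is_weak_derivI)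
    have vL: "L2_fun v" and vc: "continuous_on {0..1} v" using weak_deriv_cont[OF vw] by (auto intro: L2_fun_cont)
    have hL: "L2_fun h" using h(1) by (rule L2_fun_cont)
    have "((\<lambda>x. h x * cosf k x - pi * real k * (v x * phi k x)) has_integral (v 1 * cosf k 1 - v 0 * cosf k 0)) {0..1}"
    proof (rule fundamental_theorem_of_calculus)
      fix x :: real assume "x \<in> {0..1}"
      then show "((\<lambda>x. v x * cosf k x) has_vector_derivative h x * cosf k x - pi * real k * (v x * phi k x)) (at x within {0..1})"
        unfolding has_real_derivative_iff_has_vector_derivative[symmetric] cosf_def phi_def
        by (auto intro!: derivative_eq_intros dv)
    qed simp
    moreover have "integral {0..1} (\<lambda>x. h x * cosf k x - pi * real k * (v x * phi k x))
        = L2_inner h (cosf k) - pi * real k * L2_inner v (phi k)"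
      unfolding L2_inner_def
      by (subst integral_diff) (auto intro!: integrable_on_mult_right L2_fun_mult_integrable' hL vL)
    ultimately have dv0: "d v h = 0"
      by (auto simp: d_def cosf_def dest!: integral_unique)
    have close: "\<bar>u x - v x\<bar> \<le> e" if x: "x \<in> {0..1}" for x
    proof -
      have sub: "{0..x} \<subseteq> {0..1}" using x by auto
      have "u x - v x = integral {0..x} (\<lambda>x. g x - h x)"
        unfolding v_def using ug[OF x]
        by (subst integral_diff)
          (auto intro!: integrable_on_subinterval[OF L2_fun_integrable[OF g] sub]
            integrable_on_subinterval[OF L2_fun_integrable[OF hL] sub])
      then show ?thesis using integral_abs_le_L2_norm[OF L2_fun_diff[OF g hL] x] h(2) by simp
    qed
    have uv0: "u 0 = v 0" by (simp add: v_def)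
    have "d u g = d u g - d v h" by (simp add: dv0)
    also have "\<dots> = L2_inner (\<lambda>x. g x - h x) (cosf k) - (u 1 - v 1) * cos (pi * real k)
       - pi * real k * L2_inner (\<lambda>x. u x - v x) (phi k)"
      by (simp add: d_def L2_inner_diff_left g hL uL vL uv0 algebra_simps)
    finally have "\<bar>d u g\<bar> \<le> \<bar>L2_inner (\<lambda>x. g x - h x) (cosf k)\<bar> + \<bar>(u 1 - v 1) * cos (pi * real k)\<bar>
       + \<bar>pi * real k * L2_inner (\<lambda>x. u x - v x) (phi k)\<bar>" by linarith
    moreover have "\<bar>L2_inner (\<lambda>x. g x - h x) (cosf k)\<bar> \<le> e * 1"
      by (rule order_trans[OF L2_Cauchy_Schwarz[OF L2_fun_diff[OF g hL] L2_fun_cosf, of k] mult_mono])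
        (use h(2) L2_norm_cosf_le[of k] \<open>e > 0\<close> in auto)
    moreover have "\<bar>(u 1 - v 1) * cos (pi * real k)\<bar> \<le> e * 1"
      unfolding abs_mult by (intro mult_mono close) (use \<open>e > 0\<close> in auto)
    moreover have "\<bar>pi * real k * L2_inner (\<lambda>x. u x - v x) (phi k)\<bar> \<le> pi * real k * (e * 1)"
      unfolding abs_mult using close weak_deriv_cont[OF w] vc
      by (intro mult_mono L2_inner_le_sup) (use \<open>e > 0\<close> in \<open>auto intro!: continuous_intros\<close>)
    ultimately show ?thesis by (simp add: algebra_simps)
  qed
  then have le: "\<bar>d u g\<bar> / (2 + pi * real k) \<le> e" if "e > 0" for e
  proof -
    have "2 + pi * real k > 0" by (simp add: add_pos_nonneg)
    then show ?thesis using \<open>\<And>e. e > 0 \<Longrightarrow> \<bar>d u g\<bar> \<le> (2 + pi * real k) * e\<close>[OF that]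
      by (simp add: pos_divide_le_eq mult.commute)
  qed
  have "\<bar>d u g\<bar> / (2 + pi * real k) \<le> 0"
    by (rule field_le_epsilon) (use le in simp)
  moreover have "2 + pi * real k > 0" by (simp add: add_pos_nonneg)
  ultimately have "d u g = 0" by (simp add: divide_le_0_iff)
  then show ?thesis by (simp add: d_def)
qed

text \<open>\<open>weak_deriv\<close> picks a representative by choice. The cosine coefficients of a
  weak derivative are determined by u, so by Parseval its norm, and hence \<open>H1_norm\<close>,
  does not depend on the choice.\<close>

lemma weak_deriv_norm_unique:
  assumes "is_weak_deriv u g" "is_weak_deriv u h"
  shows "L2_inner g g = L2_inner h h"
proof -
  have "(\<lambda>k. ccw k * (L2_inner g (cosf k))\<^sup>2) = (\<lambda>k. ccw k * (L2_inner h (cosf k))\<^sup>2)"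
    using cosine_coeff_weak_deriv[OF assms(1)] cosine_coeff_weak_deriv[OF assms(2)] by simp
  moreover note gh = assms[THEN is_weak_derivD(1)]
  ultimately show ?thesis
    using sums_unique2[OF cosine_Parseval[OF gh(1)]] cosine_Parseval[OF gh(2)] by simp
qed

lemma H1_norm_eq:
  assumes "is_weak_deriv u g"
  shows "H1_norm u = sqrt ((L2_norm u)\<^sup>2 + (L2_norm g)\<^sup>2)"
proof -
  have "is_weak_deriv u (weak_deriv u)" unfolding weak_deriv_def using assms by (rule someI[of "is_weak_deriv u"])
  from weak_deriv_norm_unique[OF this assms] show ?thesis
    unfolding H1_norm_def L2_norm_sq L2_inner_def by (simp add: power2_eq_square)
qed

lemma H1_norm_bounds:
  assumes "is_weak_deriv u g"
  shows "L2_norm u \<le> H1_norm u" "L2_norm g \<le> H1_norm u" "H1_norm u \<le> L2_norm u + L2_norm g"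
  using assms by (auto simp: H1_norm_eq real_le_rsqrt sqrt_sum_squares_le_sum)

lemma is_weak_deriv_diff:
  assumes "is_weak_deriv u g" "is_weak_deriv v h"
  shows "is_weak_deriv (\<lambda>x. u x - v x) (\<lambda>x. g x - h x)"
  unfolding is_weak_deriv_def
proof (intro conjI ballI)
  show "L2_fun (\<lambda>x. g x - h x)" using assms[THEN is_weak_derivD(1)] by (rule L2_fun_diff)
  fix x :: real assume x: "x \<in> {0..1}"
  then have sub: "{0..x} \<subseteq> {0..1}" by auto
  have "integral {0..x} (\<lambda>x. g x - h x) = integral {0..x} g - integral {0..x} h"
    by (intro integral_diff integrable_on_subinterval[OF L2_fun_integrable sub] assms[THEN is_weak_derivD(1)])
  then show "u x - v x = u 0 - v 0 + integral {0..x} (\<lambda>x. g x - h x)"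
    using assms[THEN is_weak_derivD(2)[OF _ x]] by linarith
qed

lemma continuous_L2_zero:
  assumes "continuous_on {0..1} f" "L2_inner f f = 0" "x \<in> {0..1}"
  shows "f x = 0"
proof -
  have "continuous_on (cbox 0 1) (\<lambda>x. f x * f x)" using assms(1) by (auto intro!: continuous_intros)
  then have "\<forall>x\<in>cbox 0 1. f x * f x = 0"
    using integral_eq_0_iff[of 0 1 "\<lambda>x. f x * f x"] assms(2) by (simp add: L2_inner_def)
  then show ?thesis using assms(3) by auto
qed

text \<open>Completeness of the sines follows from that of the cosines: integration by parts kills
  every cosine coefficient of the primitive \<open>D\<close> with index k >= 1, so \<open>D\<close>
  equals its mean and its derivative v is 0.\<close>

lemma sine_unique:
  assumes v: "continuous_on {0..1} v" and 0: "\<And>k. L2_inner v (phi k) = 0" and x: "x \<in> {0..1}"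
  shows "v x = 0"
proof -
  define D where "D x = 0 + integral {0..x} v" for x
  have dD: "(D has_real_derivative v x) (at x within {0..1})" if "x \<in> {0..1}" for x
    unfolding D_def using v that by (rule integral_has_derivative)
  have Dc: "continuous_on {0..1} D" using dD by (rule DERIV_continuous_on)
  define m where "m = L2_inner D (cosf 0)"
  define E where "E x = D x - m * cosf 0 x" for x
  have Ec: "continuous_on {0..1} E" unfolding E_def using Dc by (intro continuous_intros)
  have EL: "L2_fun E" using Ec by (rule L2_fun_cont)
  have "L2_inner E (cosf k) = 0" for k
  proof -
    have E: "L2_inner E (cosf k) = L2_inner D (cosf k) - m * L2_inner (cosf 0) (cosf k)"
      unfolding E_def by (simp add: L2_inner_diff_left L2_fun_cont Dc L2_fun_cmult L2_inner_cmult_left)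
    show ?thesis
    proof (cases "k = 0")
      case False
      have "((\<lambda>x. v x * phi k x + pi * real k * (D x * cosf k x)) has_integral (D 1 * phi k 1 - D 0 * phi k 0)) {0..1}"
      proof (rule fundamental_theorem_of_calculus)
        fix x :: real assume "x \<in> {0..1}"
        then show "((\<lambda>x. D x * phi k x) has_vector_derivative v x * phi k x + pi * real k * (D x * cosf k x)) (at x within {0..1})"
          unfolding has_real_derivative_iff_has_vector_derivative[symmetric] cosf_def phi_def
          by (auto intro!: derivative_eq_intros dD)
      qed simp
      moreover have "integral {0..1} (\<lambda>x. v x * phi k x + pi * real k * (D x * cosf k x))
          = L2_inner v (phi k) + pi * real k * L2_inner D (cosf k)"
        unfolding L2_inner_def
        by (subst integral_add) (auto intro!: integrable_on_mult_right L2_fun_mult_integrable' L2_fun_cont v Dc continuous_intros)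
      ultimately have "pi * real k * L2_inner D (cosf k) = 0" using 0 by (auto dest!: integral_unique)
      then show ?thesis using False by (simp add: E L2_inner_cosf)
    next
      case True
      then show ?thesis using E by (simp add: L2_inner_cosf m_def)
    qed
  qed
  then have "L2_inner E E = 0" using sums_unique2[OF cosine_Parseval[OF EL], of 0] by simp
  from continuous_L2_zero[OF Ec this] have "D x = m" if "x \<in> {0..1}" for x
    using that by (force simp: E_def cosf_def)
  then have "((\<lambda>x. m) has_real_derivative v x) (at x within {0..1})"
    using has_field_derivative_transform_within[OF dD[OF x] zero_less_one x, of "\<lambda>x. m"] by simp
  then have "((\<lambda>x. m) has_vector_derivative v x) (at x within cbox 0 1)"
    by (simp add: has_real_derivative_iff_has_vector_derivative)
  then show ?thesis
    using vector_derivative_unique_within_closed_interval[of 0 1 x "\<lambda>x. m" "v x" 0] x by auto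
qed


section \<open>Absolutely convergent sine series and functions vanishing at both ends\<close>

lemma summable_inverse_pi_squares: "summable (\<lambda>k. 1 / (pi * real k)\<^sup>2)"
proof -
  have "summable (\<lambda>k. (1 / pi\<^sup>2) * (1 / real k ^ 2))"
    using inverse_power_summable[of 2, where ?'a = real]
    by (intro summable_mult) (simp add: inverse_eq_divide)
  then show ?thesis by (simp add: power_mult_distrib)
qed

text \<open>The bounded factor f serves two purposes: f = 1 gives continuity of the sum, and a
  continuous test function f gives termwise integration.\<close>

lemma sine_series_uniform:
  assumes a: "summable (\<lambda>k. \<bar>a k\<bar>)" and f: "\<And>x. x \<in> S \<Longrightarrow> \<bar>f x\<bar> \<le> K"
  shows "uniform_limit S (\<lambda>n x. \<Sum>k<n. a k * phi k x * f x) (\<lambda>x. \<Sum>k. a k * phi k x * f x) sequentially"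
proof (rule Weierstrass_m_test)
  show "summable (\<lambda>k. \<bar>a k\<bar> * K)" using a by (rule summable_mult2)
  show "norm (a k * phi k x * f x) \<le> \<bar>a k\<bar> * K" if "x \<in> S" for k x
  proof -
    have "\<bar>phi k x\<bar> * \<bar>f x\<bar> \<le> 1 * K" by (intro mult_mono f that) auto
    then have "\<bar>a k\<bar> * (\<bar>phi k x\<bar> * \<bar>f x\<bar>) \<le> \<bar>a k\<bar> * K" by (intro mult_left_mono) auto
    then show ?thesis by (simp add: abs_mult mult.assoc)
  qed
qed

lemma sine_series_summable: "summable (\<lambda>k. \<bar>a k\<bar>) \<Longrightarrow> summable (\<lambda>k. a k * phi k x)"
proof (rule summable_comparison_test')
  show "norm (a k * phi k x) \<le> \<bar>a k\<bar>" for k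
    using mult_left_mono[of "\<bar>phi k x\<bar>" 1 "\<bar>a k\<bar>"] by (simp add: abs_mult)
qed

lemma sine_series_cont:
  assumes a: "summable (\<lambda>k. \<bar>a k\<bar>)"
  shows "continuous_on S (\<lambda>x. \<Sum>k. a k * phi k x)"
proof (rule uniform_limit_theorem)
  show "uniform_limit S (\<lambda>n x. \<Sum>k<n. a k * phi k x) (\<lambda>x. \<Sum>k. a k * phi k x) sequentially"
    using sine_series_uniform[OF a, of S "\<lambda>x. 1" 1] by simp
qed (auto intro!: always_eventually continuous_intros)

lemma sine_series_inner:
  assumes a: "summable (\<lambda>k. \<bar>a k\<bar>)" and f: "continuous_on {0..1} f"
  shows "(\<lambda>k. a k * L2_inner (phi k) f) sums L2_inner (\<lambda>x. \<Sum>k. a k * phi k x) f"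
proof -
  obtain K where "\<forall>x\<in>{0..1}. \<bar>f x\<bar> \<le> K"
    using compact_imp_bounded[OF compact_continuous_image[OF f compact_Icc]] unfolding bounded_iff by auto
  then have K: "\<bar>f x\<bar> \<le> K" if "x \<in> {0..1}" for x using that by blast
  obtain I J where I: "\<And>n. ((\<lambda>x. \<Sum>k<n. a k * phi k x * f x) has_integral I n) {0..1}"
    and J: "((\<lambda>x. \<Sum>k. a k * phi k x * f x) has_integral J) {0..1}" and lim: "I \<longlonglongrightarrow> J"
    by (rule uniform_limit_integral[OF sine_series_uniform[where f = f, OF a K]])
      (use f in \<open>auto intro!: continuous_intros\<close>)
  have "I n = (\<Sum>k<n. a k * L2_inner (phi k) f)" for n
  proof -
    have "((\<lambda>x. \<Sum>k<n. a k * phi k x * f x) has_integral (\<Sum>k<n. a k * L2_inner (phi k) f)) {0..1}"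
    proof (rule has_integral_sum)
      show "((\<lambda>x. a k * phi k x * f x) has_integral a k * L2_inner (phi k) f) {0..1}" for k
        unfolding L2_inner_def mult.assoc
        by (intro has_integral_mult_right integrable_integral L2_fun_mult_integrable' L2_fun_cont f continuous_intros)
    qed auto
    then show ?thesis using I has_integral_unique by blast
  qed
  then have "I = (\<lambda>n. \<Sum>k<n. a k * L2_inner (phi k) f)" by (rule ext)
  moreover have "L2_inner (\<lambda>x. \<Sum>k. a k * phi k x) f = J"
    unfolding L2_inner_def using J
    by (simp add: suminf_mult2[OF sine_series_summable[OF a]] integral_unique)
  ultimately show ?thesis using lim by (simp add: sums_def)
qed

lemma sine_series_coeff:
  assumes a: "summable (\<lambda>k. \<bar>a k\<bar>)"
  shows "L2_inner (\<lambda>x. \<Sum>k. a k * phi k x) (phi m) = (if m = 0 then 0 else a m / 2)"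
proof -
  have "(\<lambda>k. a k * L2_inner (phi k) (phi m)) sums L2_inner (\<lambda>x. \<Sum>k. a k * phi k x) (phi m)"
    by (rule sine_series_inner[OF a]) (intro continuous_intros)
  moreover have "(\<lambda>k. a k * L2_inner (phi k) (phi m)) sums (\<Sum>k\<in>{m}. a k * L2_inner (phi k) (phi m))"
    by (rule sums_finite) (auto simp: L2_inner_phi)
  ultimately show ?thesis using sums_unique2 by (fastforce simp: L2_inner_phi)
qed

lemma sine_series_norm:
  assumes a: "summable (\<lambda>k. \<bar>a k\<bar>)"
  shows "(\<lambda>k. if k = 0 then 0 else (a k)\<^sup>2 / 2) sums (L2_norm (\<lambda>x. \<Sum>k. a k * phi k x))\<^sup>2"
proof -
  let ?s = "\<lambda>x. \<Sum>k. a k * phi k x"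
  have "(\<lambda>k. a k * L2_inner (phi k) ?s) sums L2_inner ?s ?s"
    by (rule sine_series_inner[OF a sine_series_cont[OF a]])
  moreover have "a k * L2_inner (phi k) ?s = (if k = 0 then 0 else (a k)\<^sup>2 / 2)" for k
    by (simp add: L2_inner_commute[of "phi k"] sine_series_coeff[OF a] power2_eq_square)
  ultimately show ?thesis by (simp add: L2_norm_sq)
qed

text \<open>From 2 |a| <= (c a)^2 + 1 / c^2 with c = pi k. The weight vanishes at k = 0, which is
  why \<open>a 0\<close> is prescribed.\<close>

lemma summable_abs_if_weighted_squares:
  assumes s: "summable (\<lambda>k. (pi * real k)\<^sup>2 * (a k)\<^sup>2)" and a0: "a 0 = 0"
  shows "summable (\<lambda>k. \<bar>a k\<bar>)"
proof (rule summable_comparison_test')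
  show "summable (\<lambda>k. (pi * real k)\<^sup>2 * (a k)\<^sup>2 + 1 / (pi * real k)\<^sup>2)"
    using s summable_inverse_pi_squares by (rule summable_add)
  show "norm \<bar>a k\<bar> \<le> (pi * real k)\<^sup>2 * (a k)\<^sup>2 + 1 / (pi * real k)\<^sup>2" for k
  proof (cases "k = 0")
    case False
    define c where "c = pi * real k"
    have c: "c > 0" using False by (simp add: c_def)
    have "0 \<le> (c * \<bar>a k\<bar> - 1 / c)\<^sup>2" by simp
    also have "(c * \<bar>a k\<bar> - 1 / c)\<^sup>2 = c\<^sup>2 * (a k)\<^sup>2 + 1 / c\<^sup>2 - 2 * \<bar>a k\<bar>"
      using c by (simp add: power2_diff power_mult_distrib power_divide)
    finally show ?thesis using abs_ge_zero[of "a k"] unfolding c_def[symmetric] by simp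
  qed (simp add: a0)
qed

text \<open>Vanishing at both ends removes the boundary terms from
  \<open>cosine_coeff_weak_deriv\<close>, so cosine Parseval for g becomes a weighted sum over the
  sine coefficients of v. Absolute convergence and \<open>sine_unique\<close> then give the
  pointwise expansion.\<close>

lemma sine_expansion:
  assumes v: "is_weak_deriv v g" and v0: "v 0 = 0" and v1: "v 1 = 0"
  defines "a \<equiv> \<lambda>k. 2 * L2_inner v (phi k)"
  shows "(\<lambda>k. (pi * real k)\<^sup>2 * (a k)\<^sup>2 / 2) sums (L2_norm g)\<^sup>2"
    and "summable (\<lambda>k. \<bar>a k\<bar>)"
    and "x \<in> {0..1} \<Longrightarrow> v x = (\<Sum>k. a k * phi k x)"
proof -
  have "(\<lambda>k. ccw k * (L2_inner g (cosf k))\<^sup>2) = (\<lambda>k. (pi * real k)\<^sup>2 * (a k)\<^sup>2 / 2)"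
    using cosine_coeff_weak_deriv[OF v] v0 v1 by (auto simp: a_def ccw_def power_mult_distrib)
  then show 1: "(\<lambda>k. (pi * real k)\<^sup>2 * (a k)\<^sup>2 / 2) sums (L2_norm g)\<^sup>2"
    using cosine_Parseval[OF is_weak_derivD(1)[OF v]] by (simp only: L2_norm_sq)
  have "summable (\<lambda>k. 2 * ((pi * real k)\<^sup>2 * (a k)\<^sup>2 / 2))"
    using 1 by (intro summable_mult) (rule sums_summable)
  then have "summable (\<lambda>k. (pi * real k)\<^sup>2 * (a k)\<^sup>2)" by simp
  then show 2: "summable (\<lambda>k. \<bar>a k\<bar>)"
    by (rule summable_abs_if_weighted_squares) (simp add: a_def)
  assume x: "x \<in> {0..1}"
  have vc: "continuous_on {0..1} v" using v by (rule weak_deriv_cont)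
  have sc: "continuous_on {0..1} (\<lambda>x. \<Sum>k. a k * phi k x)" using 2 by (rule sine_series_cont)
  have "v x - (\<Sum>k. a k * phi k x) = 0"
  proof (rule sine_unique[OF _ _ x])
    show "L2_inner (\<lambda>x. v x - (\<Sum>k. a k * phi k x)) (phi k) = 0" for k
      using L2_inner_diff_left[OF L2_fun_cont[OF vc] L2_fun_cont[OF sc] L2_fun_phi[of k]] sine_series_coeff[OF 2, of k]
      by (simp add: a_def)
  qed (intro continuous_intros vc sc)
  then show "v x = (\<Sum>k. a k * phi k x)" by simp
qed

section \<open>The feedback gains as the inverse of a Cauchy matrix\<close>

definition mmul :: "nat set \<Rightarrow> (nat \<Rightarrow> nat \<Rightarrow> real) \<Rightarrow> (nat \<Rightarrow> nat \<Rightarrow> real) \<Rightarrow> nat \<Rightarrow> nat \<Rightarrow> real" where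
  "mmul I A B = (\<lambda>i j. \<Sum>l\<in>I. A i l * B l j)"

text \<open>Matrices are total functions of their indices, so identities are asked for on the block
  I only; entries outside it are arbitrary.\<close>

definition is_one_on :: "nat set \<Rightarrow> (nat \<Rightarrow> nat \<Rightarrow> real) \<Rightarrow> bool" where
  "is_one_on I A \<longleftrightarrow> (\<forall>i\<in>I. \<forall>j\<in>I. A i j = (if i = j then 1 else 0))"

lemma mmul_assoc: "mmul I (mmul I A B) C = mmul I A (mmul I B C)"
proof (intro ext)
  fix i j
  have "mmul I (mmul I A B) C i j = (\<Sum>l\<in>I. \<Sum>m\<in>I. A i m * B m l * C l j)"
    by (simp add: mmul_def sum_distrib_right)
  also have "\<dots> = (\<Sum>m\<in>I. \<Sum>l\<in>I. A i m * B m l * C l j)" by (rule sum.swap)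
  also have "\<dots> = mmul I A (mmul I B C) i j" by (simp add: mmul_def sum_distrib_left mult.assoc)
  finally show "mmul I (mmul I A B) C i j = mmul I A (mmul I B C) i j" .
qed

lemma mmul_one_left:
  assumes "finite I" "is_one_on I A" "i \<in> I" shows "mmul I A B i j = B i j"
proof -
  have "mmul I A B i j = (\<Sum>l\<in>I. if l = i then B l j else 0)"
    unfolding mmul_def using assms by (intro sum.cong) (auto simp: is_one_on_def)
  then show ?thesis using assms by simp
qed

lemma mmul_one_right:
  assumes "finite I" "is_one_on I A" "j \<in> I" shows "mmul I B A i j = B i j"
proof -
  have "mmul I B A i j = (\<Sum>l\<in>I. if l = j then B i l else 0)"
    unfolding mmul_def using assms by (intro sum.cong) (auto simp: is_one_on_def)
  then show ?thesis using assms by simp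
qed

lemma mmul_cong: "(\<And>l. l \<in> I \<Longrightarrow> A i l = A' i l) \<Longrightarrow> (\<And>l. l \<in> I \<Longrightarrow> B l j = B' l j) \<Longrightarrow>
    mmul I A B i j = mmul I A' B' i j"
  unfolding mmul_def by (intro sum.cong) auto

lemma lagrange_interpolation:
  fixes x :: "nat \<Rightarrow> real" and p :: "real poly"
  assumes I: "finite I" and inj: "inj_on x I" and deg: "degree p < card I"
  shows "poly p z = (\<Sum>i\<in>I. poly p (x i) * (\<Prod>l\<in>I-{i}. (z - x l) / (x i - x l)))"
proof -
  define q where "q = (\<Sum>i\<in>I. smult (poly p (x i)) (\<Prod>l\<in>I-{i}. smult (1 / (x i - x l)) [:- x l, 1:]))"
  have pq: "poly q z = (\<Sum>i\<in>I. poly p (x i) * (\<Prod>l\<in>I-{i}. (z - x l) / (x i - x l)))" for z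
    unfolding q_def by (simp add: poly_sum poly_prod diff_divide_distrib)
  have "p = q"
  proof (rule poly_eqI_degree[of "x ` I"])
    fix y assume "y \<in> x ` I"
    then obtain j where j: "j \<in> I" "y = x j" by auto
    have "poly q y = (\<Sum>i\<in>I. if i = j then poly p (x j) else 0)"
      unfolding pq
    proof (rule sum.cong)
      fix i assume i: "i \<in> I"
      show "poly p (x i) * (\<Prod>l\<in>I-{i}. (y - x l) / (x i - x l)) = (if i = j then poly p (x j) else 0)"
      proof (cases "i = j")
        case True
        have "(\<Prod>l\<in>I-{i}. (y - x l) / (x i - x l)) = (\<Prod>l\<in>I-{i}. 1)"
          using j True inj by (intro prod.cong) (auto simp: inj_on_def)
        then show ?thesis using True by simp
      next
        case False
        then have "(\<Prod>l\<in>I-{i}. (y - x l) / (x i - x l)) = 0"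
          using j I by (intro prod_zero) auto
        then show ?thesis using False by simp
      qed
    qed simp
    then show "poly p y = poly q y" using j I by simp
  next
    show "degree p < card (x ` I)" using deg inj by (simp add: card_image)
    have "degree q \<le> card I - 1"
      unfolding q_def
    proof (rule degree_sum_le[OF I])
      fix i assume i: "i \<in> I"
      have "degree (\<Prod>l\<in>I-{i}. smult (1 / (x i - x l)) [:- x l, 1:])
          \<le> sum (degree \<circ> (\<lambda>l. smult (1 / (x i - x l)) [:- x l, 1:])) (I-{i})"
        by (rule degree_prod_sum_le) (use I in auto)
      also have "\<dots> \<le> (\<Sum>l\<in>I-{i}. 1)"
        by (intro sum_mono) (simp add: degree_smult_le)
      also have "\<dots> = card I - 1" using i I by simp
      finally show "degree (smult (poly p (x i)) (\<Prod>l\<in>I-{i}. smult (1 / (x i - x l)) [:- x l, 1:])) \<le> card I - 1"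
        using degree_smult_le order_trans by blast
    qed
    then show "degree q < card (x ` I)" using deg inj by (simp add: card_image)
  qed
  then have "poly p z = poly q z" by (rule arg_cong)
  then show ?thesis unfolding pq .
qed

text \<open>Interpolate \<open>p j\<close>, the product of z - \<open>y k\<close> over k different
  from j, at the nodes x and evaluate at \<open>y k\<close>: up to the factor \<open>w (y k)\<close>
  this is a combination of the entries 1 / (y k - x i), and it vanishes unless k = j. Normalising at
  k = j gives row j of \<open>L\<close>.\<close>

lemma cauchy_left_inverse:
  fixes x y b :: "nat \<Rightarrow> real"
  assumes I: "finite I" and x: "inj_on x I" and y: "inj_on y I"
    and xy: "\<And>i k. i \<in> I \<Longrightarrow> k \<in> I \<Longrightarrow> y k \<noteq> x i" and b: "\<And>i. i \<in> I \<Longrightarrow> b i \<noteq> 0"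
  obtains L where "is_one_on I (mmul I L (\<lambda>i k. b i / (y k - x i)))"
proof -
  define p where "p j = (\<Prod>k\<in>I-{j}. [:- y k, 1:])" for j
  define w where "w z = (\<Prod>l\<in>I. z - x l)" for z
  define L where "L j i = w (y j) / poly (p j) (y j) * poly (p j) (x i) / (\<Prod>l\<in>I-{i}. x i - x l) / b i" for j i
  have "mmul I L (\<lambda>i k. b i / (y k - x i)) j k = (if j = k then 1 else 0)" if j: "j \<in> I" and k: "k \<in> I" for j k
  proof -
    have "degree (p j) \<le> sum (degree \<circ> (\<lambda>k. [:- y k, 1:])) (I-{j})"
      unfolding p_def by (rule degree_prod_sum_le) (use I in auto)
    also have "\<dots> = card I - 1" using j I by simp
    finally have deg: "degree (p j) < card I" using j I card_gt_0_iff[of I] by fastforce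
    have pz: "poly (p j) z = (\<Prod>k\<in>I-{j}. z - y k)" for z unfolding p_def by (simp add: poly_prod)
    have w0: "w (y k) \<noteq> 0" using I xy k by (simp add: w_def)
    have "poly (p j) (y k) = (\<Sum>i\<in>I. poly (p j) (x i) * (\<Prod>l\<in>I-{i}. (y k - x l) / (x i - x l)))"
      by (rule lagrange_interpolation[OF I x deg])
    also have "\<dots> = (\<Sum>i\<in>I. w (y k) * (poly (p j) (x i) / (\<Prod>l\<in>I-{i}. x i - x l) / (y k - x i)))"
    proof (rule sum.cong)
      fix i assume i: "i \<in> I"
      have "w (y k) = (y k - x i) * (\<Prod>l\<in>I-{i}. y k - x l)" unfolding w_def using I i by (rule prod.remove)
      then show "poly (p j) (x i) * (\<Prod>l\<in>I-{i}. (y k - x l) / (x i - x l))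
         = w (y k) * (poly (p j) (x i) / (\<Prod>l\<in>I-{i}. x i - x l) / (y k - x i))"
        using xy[OF i k] by (simp add: prod_dividef)
    qed simp
    finally have "poly (p j) (y k) = w (y k) * (\<Sum>i\<in>I. poly (p j) (x i) / (\<Prod>l\<in>I-{i}. x i - x l) / (y k - x i))"
      by (simp only: sum_distrib_left)
    then have eq: "(\<Sum>i\<in>I. poly (p j) (x i) / (\<Prod>l\<in>I-{i}. x i - x l) / (y k - x i)) = poly (p j) (y k) / w (y k)"
      by (simp only: nonzero_mult_div_cancel_left[OF w0])
    have "mmul I L (\<lambda>i k. b i / (y k - x i)) j k
       = (\<Sum>i\<in>I. w (y j) / poly (p j) (y j) * (poly (p j) (x i) / (\<Prod>l\<in>I-{i}. x i - x l) / (y k - x i)))"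
      unfolding mmul_def L_def using b by (intro sum.cong) auto
    also have "\<dots> = w (y j) / poly (p j) (y j) * (\<Sum>i\<in>I. poly (p j) (x i) / (\<Prod>l\<in>I-{i}. x i - x l) / (y k - x i))"
      by (simp only: sum_distrib_left)
    also have "\<dots> = w (y j) / poly (p j) (y j) * (poly (p j) (y k) / w (y k))"
      by (simp only: eq)
    also have "\<dots> = (if j = k then 1 else 0)"
    proof (cases "j = k")
      case True
      have "poly (p j) (y j) \<noteq> 0" using I y j by (auto simp: pz inj_on_def)
      then show ?thesis using True w0 by simp
    next
      case False
      then have "poly (p j) (y k) = 0" using I k by (auto simp: pz)
      then show ?thesis using False by simp
    qed
    finally show ?thesis .
  qed
  then have "is_one_on I (mmul I L (\<lambda>i k. b i / (y k - x i)))" by (auto simp: is_one_on_def)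
  then show ?thesis by (rule that)
qed

text \<open>Exchanging the roles of x and y turns the transpose, up to sign and the factors b, into
  another Cauchy matrix, whose left inverse yields a right inverse \<open>R\<close> here. A left and
  a right inverse agree.\<close>

lemma cauchy_inverse:
  fixes x y b :: "nat \<Rightarrow> real"
  assumes I: "finite I" and x: "inj_on x I" and y: "inj_on y I"
    and xy: "\<And>i k. i \<in> I \<Longrightarrow> k \<in> I \<Longrightarrow> y k \<noteq> x i" and b: "\<And>i. i \<in> I \<Longrightarrow> b i \<noteq> 0"
  obtains L where "is_one_on I (mmul I L (\<lambda>i k. b i / (y k - x i)))"
    "is_one_on I (mmul I (\<lambda>i k. b i / (y k - x i)) L)"
proof -
  let ?V = "\<lambda>i k. b i / (y k - x i)"
  obtain L where L: "is_one_on I (mmul I L ?V)"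
    by (rule cauchy_left_inverse[OF I x y, of b]) (use xy b in auto)
  obtain L' where L': "is_one_on I (mmul I L' (\<lambda>k i. 1 / (x i - y k)))"
    by (rule cauchy_left_inverse[OF I y x, of "\<lambda>_. 1"]) (use xy in force)+
  define R where "R k j = - L' j k / b j" for k j
  have R: "mmul I ?V R i j = (if i = j then 1 else 0)" if "i \<in> I" "j \<in> I" for i j
  proof -
    have "mmul I ?V R i j = (\<Sum>k\<in>I. b i / b j * (L' j k * (1 / (x i - y k))))"
      unfolding mmul_def R_def
    proof (intro sum.cong)
      fix k assume "k \<in> I"
      then have "y k - x i \<noteq> 0" "x i - y k \<noteq> 0" "b j \<noteq> 0" using xy b that by force+
      then show "b i / (y k - x i) * (- L' j k / b j) = b i / b j * (L' j k * (1 / (x i - y k)))"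
        by (simp add: divide_simps) (simp add: algebra_simps)
    qed simp
    also have "\<dots> = b i / b j * mmul I L' (\<lambda>k i. 1 / (x i - y k)) j i"
      by (simp only: sum_distrib_left mmul_def)
    finally show ?thesis using L' b that by (auto simp: is_one_on_def)
  qed
  then have R1: "is_one_on I (mmul I ?V R)" by (auto simp: is_one_on_def)
  have "L i j = R i j" if "i \<in> I" "j \<in> I" for i j
  proof -
    have "L i j = mmul I L (mmul I ?V R) i j" using mmul_one_right[OF I R1] that by simp
    also have "\<dots> = mmul I (mmul I L ?V) R i j" by (simp add: mmul_assoc)
    also have "\<dots> = R i j" using mmul_one_left[OF I L] that by simp
    finally show ?thesis .
  qed
  then have "is_one_on I (mmul I ?V L)"
    unfolding is_one_on_def using R by (metis (no_types, lifting) mmul_cong)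
  then show ?thesis using L that by blast
qed

section \<open>From the Cauchy matrix to the feedback gains\<close>

lemma lam_strict_mono: "strict_mono (lam \<alpha>)"
proof (rule strict_monoI)
  fix i j :: nat assume "i < j"
  then have "pi * real i < pi * real j" by simp
  then have "(pi * real i)\<^sup>2 < (pi * real j)\<^sup>2" by (intro power_strict_mono) auto
  then show "lam \<alpha> i < lam \<alpha> j" by (simp add: lam_def)
qed

lemma dphi1_nonzero: "k \<noteq> 0 \<Longrightarrow> dphi1 k \<noteq> 0"
proof -
  have "sin (pi * real k) = 0" by (simp add: mult.commute)
  then have "cos (pi * real k) \<noteq> 0" using sin_cos_squared_add[of "pi * real k"] by force
  then show "k \<noteq> 0 \<Longrightarrow> dphi1 k \<noteq> 0" by (simp add: dphi1_def)
qed

text \<open>\<open>Bmat\<close> is defined by choice, so an inverse of M = V V^T has to be exhibited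
  first: L^T L serves, with L the Cauchy inverse of V. The gains c = V^T B then satisfy V c = 1 and
  hence equal L on the index block.\<close>

lemma feedback_gains:
  fixes \<alpha> \<rho> :: real and N :: nat and \<gamma> :: "nat \<Rightarrow> real"
  assumes low: "\<forall>j\<in>{1..N}. lam \<alpha> j < \<rho>" and gam: "\<And>k. k \<in> {1..N} \<Longrightarrow> \<rho> < \<gamma> k" and inj: "inj_on \<gamma> {1..N}"
  defines "V \<equiv> \<lambda>i k. dphi1 i / (\<gamma> k - lam \<alpha> i)"
  obtains c where "\<And>k u. Fk \<alpha> N \<gamma> k u = (\<Sum>j\<in>{1..N}. c k j * L2_inner u (phi j))"
    "is_one_on {1..N} (mmul {1..N} c V)" "is_one_on {1..N} (mmul {1..N} V c)"
proof -
  let ?I = "{1..N}"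
  have fin: "finite ?I" by simp
  obtain L where L: "is_one_on ?I (mmul ?I L V)" "is_one_on ?I (mmul ?I V L)"
    unfolding V_def
  proof (rule cauchy_inverse[OF fin])
    show "inj_on (lam \<alpha>) ?I" using lam_strict_mono strict_mono_imp_inj_on inj_on_subset by blast
    show "\<gamma> k \<noteq> lam \<alpha> i" if "i \<in> ?I" "k \<in> ?I" for i k
      using low gam[of k] that by fastforce
    show "dphi1 i \<noteq> 0" if "i \<in> ?I" for i using that by (intro dphi1_nonzero) auto
  qed (use inj in auto)
  let ?T = "\<lambda>A :: nat \<Rightarrow> nat \<Rightarrow> real. \<lambda>i j. A j i"
  define M where "M i j = (\<Sum>k\<in>?I. Bk \<alpha> \<gamma> k i j)" for i j
  have M: "M = mmul ?I V (?T V)"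
    by (auto simp: M_def mmul_def Bk_def B0_def V_def fun_eq_iff intro!: sum.cong)
  have T: "?T (mmul ?I A B) = mmul ?I (?T B) (?T A)" for A B
    by (auto simp: mmul_def mult.commute)
  have TL: "is_one_on ?I (mmul ?I (?T V) (?T L))" "is_one_on ?I (mmul ?I (?T L) (?T V))"
    using L T[of L V] T[of V L] by (auto simp: is_one_on_def fun_eq_iff)
  define X where "X = mmul ?I (?T L) L"
  have MX: "is_one_on ?I (mmul ?I M X)"
  proof -
    have "mmul ?I M X = mmul ?I V (mmul ?I (mmul ?I (?T V) (?T L)) L)"
      by (simp add: M X_def mmul_assoc)
    moreover have "mmul ?I V (mmul ?I (mmul ?I (?T V) (?T L)) L) i j = mmul ?I V L i j" for i j
      by (rule mmul_cong, rule refl, rule mmul_one_left[OF fin TL(1)])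
    ultimately show ?thesis using L(2) by (simp add: is_one_on_def)
  qed
  have XM: "is_one_on ?I (mmul ?I X M)"
  proof -
    have "mmul ?I X M = mmul ?I (?T L) (mmul ?I (mmul ?I L V) (?T V))"
      by (simp add: M X_def mmul_assoc)
    moreover have "mmul ?I (?T L) (mmul ?I (mmul ?I L V) (?T V)) i j = mmul ?I (?T L) (?T V) i j" for i j
      by (rule mmul_cong, rule refl, rule mmul_one_left[OF fin L(1)])
    ultimately show ?thesis using TL(2) by (simp add: is_one_on_def)
  qed
  have "\<exists>X. \<forall>i\<in>?I. \<forall>j\<in>?I. (\<Sum>l\<in>?I. M i l * X l j) = (if i = j then 1 else 0) \<and>
      (\<Sum>l\<in>?I. X i l * M l j) = (if i = j then 1 else 0)"
    using MX XM unfolding is_one_on_def mmul_def by blast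
  from someI_ex[OF this] have B: "is_one_on ?I (mmul ?I M (Bmat \<alpha> N \<gamma>))"
    unfolding Bmat_def mat_inv_on_def is_one_on_def mmul_def M_def[symmetric] by blast
  define c where "c = mmul ?I (?T V) (Bmat \<alpha> N \<gamma>)"
  have Vc: "is_one_on ?I (mmul ?I V c)" using B by (simp add: M c_def mmul_assoc)
  have "c i j = L i j" if "i \<in> ?I" "j \<in> ?I" for i j
  proof -
    have "L i j = mmul ?I L (mmul ?I V c) i j" using mmul_one_right[OF fin Vc] that by simp
    also have "\<dots> = mmul ?I (mmul ?I L V) c i j" by (simp add: mmul_assoc)
    also have "\<dots> = c i j" using mmul_one_left[OF fin L(1)] that by simp
    finally show ?thesis by simp
  qed
  then have "mmul ?I c V i j = mmul ?I L V i j" if "i \<in> ?I" for i j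
    using that by (intro mmul_cong) auto
  then have cV: "is_one_on ?I (mmul ?I c V)" using L(1) by (simp add: is_one_on_def)
  have "Fk \<alpha> N \<gamma> k u = (\<Sum>j\<in>?I. c k j * L2_inner u (phi j))" for k u
  proof -
    have "Fk \<alpha> N \<gamma> k u = (\<Sum>i\<in>?I. \<Sum>j\<in>?I. V i k * Bmat \<alpha> N \<gamma> i j * L2_inner u (phi j))"
      unfolding Fk_def V_def sum_distrib_right by (intro sum.cong refl) (simp add: mult_ac)
    also have "\<dots> = (\<Sum>j\<in>?I. \<Sum>i\<in>?I. V i k * Bmat \<alpha> N \<gamma> i j * L2_inner u (phi j))" by (rule sum.swap)
    also have "\<dots> = (\<Sum>j\<in>?I. c k j * L2_inner u (phi j))" by (simp add: c_def mmul_def sum_distrib_right)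
    finally show ?thesis .
  qed
  then show ?thesis using that[OF _ cV Vc] by blast
qed

section \<open>Solutions with a time-dependent coefficient and their Fourier modes\<close>


lemma sine_coeff_second_deriv:
  assumes d1: "\<And>x. x \<in> {0..1} \<Longrightarrow> (v has_real_derivative v' x) (at x within {0..1})"
    and d2: "\<And>x. x \<in> {0..1} \<Longrightarrow> (v' has_real_derivative v'' x) (at x within {0..1})"
    and c: "continuous_on {0..1} v''"
  shows "L2_inner v'' (phi k) = pi * real k * v 0 - dphi1 k * v 1 - (pi * real k)\<^sup>2 * L2_inner v (phi k)"
proof -
  \<comment> \<open>Green's identity in one step: the derivative of v' phi - v phi' is v'' phi - v
    phi''.\<close>
  define G where "G x = v' x * phi k x - v x * (pi * real k * cos (pi * real k * x))" for x
  have vc: "continuous_on {0..1} v" using d1 by (rule DERIV_continuous_on)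
  have "((\<lambda>x. v'' x * phi k x + (pi * real k)\<^sup>2 * (v x * phi k x)) has_integral (G 1 - G 0)) {0..1}"
  proof (rule fundamental_theorem_of_calculus)
    fix x :: real assume "x \<in> {0..1}"
    then show "(G has_vector_derivative v'' x * phi k x + (pi * real k)\<^sup>2 * (v x * phi k x)) (at x within {0..1})"
      unfolding has_real_derivative_iff_has_vector_derivative[symmetric] G_def phi_def
      by (auto intro!: derivative_eq_intros d1 d2 simp: power2_eq_square algebra_simps)
  qed simp
  moreover have "integral {0..1} (\<lambda>x. v'' x * phi k x + (pi * real k)\<^sup>2 * (v x * phi k x))
      = L2_inner v'' (phi k) + (pi * real k)\<^sup>2 * L2_inner v (phi k)"
    unfolding L2_inner_def
    by (subst integral_add)
      (auto intro!: integrable_on_mult_right L2_fun_mult_integrable' L2_fun_cont c vc continuous_intros)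
  moreover have "G 1 - G 0 = pi * real k * v 0 - dphi1 k * v 1"
    by (simp add: G_def dphi1_def)
  ultimately show ?thesis by (auto dest!: integral_unique)
qed

text \<open>Sine coefficients of the linear lift that carries the boundary value U.\<close>

definition xc :: "nat \<Rightarrow> real" where "xc k = L2_inner (\<lambda>x. x) (phi k)"

text \<open>The lift has zero second derivative and boundary values 0 and 1, so integration by parts
  leaves only the boundary term.\<close>

lemma xc_eq: "(pi * real k)\<^sup>2 * xc k = - dphi1 k"
proof -
  have "L2_inner (\<lambda>x. 0) (phi k) = pi * real k * 0 - dphi1 k * 1 - (pi * real k)\<^sup>2 * L2_inner (\<lambda>x. x) (phi k)"
    by (rule sine_coeff_second_deriv[where v' = "\<lambda>x. 1"]) (auto intro!: derivative_eq_intros)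
  then show ?thesis by (simp add: xc_def L2_inner_def)
qed

lemma abs_dphi1_le: "\<bar>dphi1 k\<bar> \<le> pi * real k"
  using mult_left_mono[of "\<bar>cos (pi * real k)\<bar>" 1 "pi * real k"] by (simp add: dphi1_def abs_mult)

lemma abs_xc_le: "\<bar>xc k\<bar> \<le> 1 / (pi * real k)"
proof (cases "k = 0")
  case False
  have "(pi * real k)\<^sup>2 * \<bar>xc k\<bar> = \<bar>dphi1 k\<bar>"
    using arg_cong[OF xc_eq[of k], of abs] by (simp add: abs_mult)
  also have "\<dots> \<le> pi * real k" by (rule abs_dphi1_le)
  finally have "(pi * real k) * ((pi * real k) * \<bar>xc k\<bar>) \<le> (pi * real k) * 1"
    by (simp add: power2_eq_square mult.assoc)
  then have "(pi * real k) * \<bar>xc k\<bar> \<le> 1" using False by (subst (asm) mult_le_cancel_left_pos) auto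
  then show ?thesis using False by (simp add: field_simps)
qed (simp add: xc_def)

text \<open>Comparison in place of an integral formula: exp (l s) y(s) - K / (l - \<mu>) exp ((l -
  \<mu>) s) is nonincreasing, so f enters only through its pointwise upper bound on the open
  interval.\<close>

lemma duhamel_upper:
  assumes c: "continuous_on {0..T} y" and t: "t \<in> {0..T}"
    and d: "\<And>s. 0 < s \<Longrightarrow> s < T \<Longrightarrow> (y has_real_derivative - l * y s + f s) (at s)"
    and f: "\<And>s. 0 < s \<Longrightarrow> s < T \<Longrightarrow> f s \<le> K * exp (- \<mu> * s)" and l: "l > \<mu>" and K: "K \<ge> 0"
  shows "y t \<le> exp (- l * t) * \<bar>y 0\<bar> + K / (l - \<mu>) * exp (- \<mu> * t)"
proof (cases "t = 0")
  case True
  then show ?thesis using l K by (simp add: add_increasing2)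
next
  case False
  define K' where "K' = K / (l - \<mu>)"
  have K': "K' * (l - \<mu>) = K" using l by (simp add: K'_def)
  define z where "z s = exp (l * s) * y s - K' * exp ((l - \<mu>) * s)" for s
  have "z t \<le> z 0"
  proof (rule DERIV_nonpos_imp_decreasing_open[of 0 t z])
    show "0 \<le> t" using t by auto
    show "continuous_on {0..t} z" unfolding z_def
      using t by (intro continuous_intros continuous_on_subset[OF c]) auto
    fix s assume s: "0 < s" "s < t"
    then have sT: "s < T" using t by auto
    have "(z has_real_derivative (exp (l * s) * f s - K * exp ((l - \<mu>) * s))) (at s)"
      unfolding z_def K'[symmetric]
      by (auto intro!: derivative_eq_intros d[OF s(1) sT] simp: algebra_simps)
    moreover have "exp (l * s) * f s \<le> exp (l * s) * (K * exp (- \<mu> * s))"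
      by (intro mult_left_mono f s sT) auto
    then have "exp (l * s) * f s - K * exp ((l - \<mu>) * s) \<le> 0"
      by (simp add: left_diff_distrib exp_diff exp_minus field_simps)
    ultimately show "\<exists>y. (z has_real_derivative y) (at s) \<and> y \<le> 0" by blast
  qed
  then have "exp (l * t) * y t \<le> y 0 - K / (l - \<mu>) + K / (l - \<mu>) * exp ((l - \<mu>) * t)"
    by (simp add: z_def K'_def)
  also have "\<dots> \<le> \<bar>y 0\<bar> + K / (l - \<mu>) * exp ((l - \<mu>) * t)"
    using divide_nonneg_pos[OF K, of "l - \<mu>"] l by linarith
  finally have A: "exp (- l * t) * (exp (l * t) * y t) \<le> exp (- l * t) * (\<bar>y 0\<bar> + K / (l - \<mu>) * exp ((l - \<mu>) * t))"
    by (intro mult_left_mono) auto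
  have B: "exp (- l * t) * (exp (l * t) * y t) = y t"
    by (simp add: exp_minus)
  have C: "exp (- l * t) * (\<bar>y 0\<bar> + K / (l - \<mu>) * exp ((l - \<mu>) * t))
      = exp (- l * t) * \<bar>y 0\<bar> + K / (l - \<mu>) * (exp (- l * t) * exp ((l - \<mu>) * t))"
    by (simp add: distrib_left)
  have D: "exp (- l * t) * exp ((l - \<mu>) * t) = exp (- \<mu> * t)"
    by (simp add: exp_add[symmetric] algebra_simps)
  show ?thesis using A unfolding B C D .
qed

lemma duhamel_bound:
  assumes c: "continuous_on {0..T} y" and t: "t \<in> {0..T}"
    and d: "\<And>s. 0 < s \<Longrightarrow> s < T \<Longrightarrow> (y has_real_derivative - l * y s + f s) (at s)"
    and f: "\<And>s. 0 < s \<Longrightarrow> s < T \<Longrightarrow> \<bar>f s\<bar> \<le> K * exp (- \<mu> * s)" and l: "l > \<mu>" and K: "K \<ge> 0"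
  shows "\<bar>y t\<bar> \<le> exp (- l * t) * \<bar>y 0\<bar> + K / (l - \<mu>) * exp (- \<mu> * t)"
proof -
  have 1: "y t \<le> exp (- l * t) * \<bar>y 0\<bar> + K / (l - \<mu>) * exp (- \<mu> * t)"
    by (rule duhamel_upper[OF c t d]) (use f l K in \<open>auto simp: abs_le_iff\<close>)
  have "(\<lambda>s. - y s) t \<le> exp (- l * t) * \<bar>- y 0\<bar> + K / (l - \<mu>) * exp (- \<mu> * t)"
  proof (rule duhamel_upper[where f = "\<lambda>s. - f s", OF _ t])
    show "continuous_on {0..T} (\<lambda>s. - y s)" using c by (intro continuous_intros)
    show "((\<lambda>s. - y s) has_real_derivative - l * - y s + - f s) (at s)" if "0 < s" "s < T" for s
      by (auto intro!: derivative_eq_intros d[OF that])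
    show "- f s \<le> K * exp (- \<mu> * s)" if "0 < s" "s < T" for s using f[OF that] by linarith
  qed (use l K in auto)
  with 1 show ?thesis by (auto simp: abs_le_iff)
qed

text \<open>Bootstrap: at the first time T where f reaches K, left continuity gives the weak bound
  on all of [0,T], and the improved strict bound contradicts f(T) >= K.\<close>

lemma continuity_method:
  fixes f :: "real \<Rightarrow> real"
  assumes c: "continuous_on {0..} f" and 0: "f 0 < K"
    and imp: "\<And>T. T \<ge> 0 \<Longrightarrow> (\<And>t. t \<in> {0..T} \<Longrightarrow> f t \<le> K) \<Longrightarrow> f T < K"
    and t: "t \<ge> 0"
  shows "f t < K"
proof (rule ccontr)
  assume "\<not> f t < K"
  define S where "S = {0..t} \<inter> f -` {K..}"
  have S: "closed S" unfolding S_def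
    by (rule continuous_closed_preimage) (auto intro: continuous_on_subset[OF c])
  have ne: "S \<noteq> {}" and bdd: "bdd_below S" using t \<open>\<not> f t < K\<close> by (auto simp: S_def)
  define T where "T = Inf S"
  have TS: "T \<in> S" unfolding T_def by (rule closed_contains_Inf[OF ne bdd S])
  have less: "f s < K" if "0 \<le> s" "s < T" for s
  proof (rule ccontr)
    assume "\<not> f s < K"
    then have "s \<in> S" using that TS by (auto simp: S_def)
    then show False using cInf_lower[OF _ bdd, of s] that by (simp add: T_def)
  qed
  have "0 < T" using TS 0 by (cases "T = 0") (auto simp: S_def)
  have "f T \<le> K"
  proof (rule tendsto_upperbound)
    have "(f \<longlongrightarrow> f T) (at T within {0..})" using c \<open>0 < T\<close> by (auto simp: continuous_on_def)
    then show "(f \<longlongrightarrow> f T) (at_left T)"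
      using tendsto_within_subset[of f _ T "{0..}" "{0..T}"] at_within_Icc_at_left[OF \<open>0 < T\<close>] by auto
    show "\<forall>\<^sub>F s in at_left T. f s \<le> K"
      using eventually_at_left_real[OF \<open>0 < T\<close>] by (rule eventually_mono) (use less in \<open>auto intro: less_imp_le\<close>)
  qed simp
  then have "f s \<le> K" if "s \<in> {0..T}" for s using less[of s] that by (cases "s = T") auto
  from imp[OF _ this] \<open>0 < T\<close> have "f T < K" by simp
  then show False using TS by (auto simp: S_def)
qed

text \<open>\<open>closed_loop_solution\<close> with \<beta> replaced by a time-dependent
  coefficient b. Solutions of the truncated problem have this form, with b the truncated coefficient
  along the solution, so one set of estimates covers both equations.\<close>

definition gen_sol :: "real \<Rightarrow> nat \<Rightarrow> (nat \<Rightarrow> real) \<Rightarrow> (real \<Rightarrow> real) \<Rightarrow> (real \<Rightarrow> real) \<Rightarrow> (real \<Rightarrow> real \<Rightarrow> real) \<Rightarrow> bool" where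
  "gen_sol \<alpha> N \<gamma> b u0 u \<longleftrightarrow>
     (\<forall>x\<in>{0..1}. u x 0 = u0 x) \<and>
     (\<forall>t\<ge>0. H1 (\<lambda>x. u x t)) \<and>
     (\<forall>t0\<ge>0. ((\<lambda>t. H1_norm (\<lambda>x. u x t - u x t0)) \<longlongrightarrow> 0) (at t0 within {0..})) \<and>
     (\<forall>t>0. u 0 t = 0 \<and> u 1 t = Ffb \<alpha> N \<gamma> (\<lambda>x. u x t)) \<and>
     (\<exists>ut ux uxx.
        continuous_on ({0..1} \<times> {0<..}) (\<lambda>(x,t). ut x t) \<and>
        continuous_on ({0..1} \<times> {0<..}) (\<lambda>(x,t). ux x t) \<and>
        continuous_on ({0..1} \<times> {0<..}) (\<lambda>(x,t). uxx x t) \<and>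
        (\<forall>x\<in>{0..1}. \<forall>t>0.
           ((\<lambda>s. u x s) has_real_derivative ut x t) (at t) \<and>
           ((\<lambda>y. u y t) has_real_derivative ux x t) (at x within {0..1}) \<and>
           ((\<lambda>y. ux y t) has_real_derivative uxx x t) (at x within {0..1})) \<and>
        (\<forall>x\<in>{0<..<1}. \<forall>t>0.
           ut x t - uxx x t - \<alpha> * u x t + b t * (u x t)^2 = 0))"

lemma closed_loop_solution_iff: "closed_loop_solution \<alpha> \<beta> N \<gamma> u0 u = gen_sol \<alpha> N \<gamma> (\<lambda>_. \<beta>) u0 u"
  unfolding closed_loop_solution_def gen_sol_def by (rule refl)

lemma continuous_on_slice:
  fixes f :: "real \<Rightarrow> real \<Rightarrow> real"
  assumes "continuous_on (A \<times> B) (\<lambda>(x,t). f x t)" "t \<in> B"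
  shows "continuous_on A (\<lambda>x. f x t)"
proof -
  have "continuous_on A (\<lambda>x. (x, t))" by (intro continuous_intros)
  from continuous_on_compose2[OF assms(1) this] show ?thesis using assms(2) by auto
qed

lemma abs_inner_phi_le:
  assumes "continuous_on {0..1} v" shows "\<bar>L2_inner v (phi k)\<bar> \<le> L2_norm v"
  using L2_Cauchy_Schwarz[OF L2_fun_cont[OF assms] L2_fun_phi[of k]] L2_norm_phi_le[of k]
    mult_left_mono[of "L2_norm (phi k)" 1 "L2_norm v"] by simp

text \<open>The product v w is controlled only in L^1, but |phi| <= 1 makes the bound uniform in
  k.\<close>

lemma abs_inner_sq_le:
  assumes v: "continuous_on {0..1} v" and w: "continuous_on {0..1} w"
  shows "\<bar>L2_inner (\<lambda>x. v x * w x) (phi k)\<bar> \<le> L2_norm v * L2_norm w"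
proof -
  have "L2_inner (\<lambda>x. v x * w x) (phi k) = L2_inner v (\<lambda>x. w x * phi k x)"
    by (simp add: L2_inner_def mult.assoc)
  also have "\<bar>\<dots>\<bar> \<le> L2_norm v * L2_norm (\<lambda>x. w x * phi k x)"
    by (intro L2_Cauchy_Schwarz L2_fun_cont v continuous_intros w)
  also have "L2_norm (\<lambda>x. w x * phi k x) \<le> L2_norm w"
    unfolding L2_norm_def
  proof (intro real_sqrt_le_mono integral_le)
    show "(\<lambda>x. (w x * phi k x)\<^sup>2) integrable_on {0..1}" "(\<lambda>x. (w x)\<^sup>2) integrable_on {0..1}"
      by (intro integrable_continuous_real continuous_intros w)+
    show "(w x * phi k x)\<^sup>2 \<le> (w x)\<^sup>2" for x
      using mult_left_mono[of "(phi k x)\<^sup>2" 1 "(w x)\<^sup>2"] abs_phi_le[of k x]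
      by (simp add: power_mult_distrib abs_square_le_1)
  qed
  finally show ?thesis by (simp add: mult_left_mono)
qed

lemma L2_norm_x_le: "L2_norm (\<lambda>x. x) \<le> 1"
  by (rule L2_norm_le_sup) (auto intro: continuous_on_id)

section \<open>Time evolution of the sine coefficients of a given solution\<close>

context
  fixes \<alpha> N \<gamma> b u0 u
  assumes sol: "gen_sol \<alpha> N \<gamma> b u0 u"
begin

lemma sol_H1: "t \<ge> 0 \<Longrightarrow> \<exists>g. is_weak_deriv (\<lambda>x. u x t) g"
  using sol by (auto simp: gen_sol_def H1_def)

lemma sol_cont: "t \<ge> 0 \<Longrightarrow> continuous_on {0..1} (\<lambda>x. u x t)"
  using sol_H1 weak_deriv_cont by blast

lemma sol_L2_diff_tendsto:
  assumes "t0 \<ge> 0"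
  shows "((\<lambda>t. L2_norm (\<lambda>x. u x t - u x t0)) \<longlongrightarrow> 0) (at t0 within {0..})"
proof (rule Lim_null_comparison)
  show "((\<lambda>t. H1_norm (\<lambda>x. u x t - u x t0)) \<longlongrightarrow> 0) (at t0 within {0..})"
    using sol assms by (auto simp: gen_sol_def)
  have "norm (L2_norm (\<lambda>x. u x t - u x t0)) \<le> H1_norm (\<lambda>x. u x t - u x t0)" if "t \<ge> 0" for t
    using sol_H1[OF that] sol_H1[OF assms] is_weak_deriv_diff H1_norm_bounds(1) by fastforce
  then show "\<forall>\<^sub>F t in at t0 within {0..}. norm (L2_norm (\<lambda>x. u x t - u x t0)) \<le> H1_norm (\<lambda>x. u x t - u x t0)"
    by (auto simp: eventually_at_filter intro!: always_eventually)
qed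

text \<open>Continuity in time is postulated in H^1; it passes to L^2 and from there to every
  quantity that is 1-Lipschitz in L^2.\<close>

lemma sol_functional_cont:
  assumes "\<And>t t0. t \<ge> 0 \<Longrightarrow> t0 \<ge> 0 \<Longrightarrow> \<bar>f t - f t0\<bar> \<le> L2_norm (\<lambda>x. u x t - u x t0)"
  shows "continuous_on {0..} (f :: real \<Rightarrow> real)"
  unfolding continuous_on_def
proof
  fix t0 :: real assume t0: "t0 \<in> {0..}"
  have "((\<lambda>t. f t - f t0) \<longlongrightarrow> 0) (at t0 within {0..})"
    by (rule Lim_null_comparison[OF _ sol_L2_diff_tendsto])
      (use assms t0 in \<open>auto simp: eventually_at_filter intro!: always_eventually\<close>)
  then show "(f \<longlongrightarrow> f t0) (at t0 within {0..})" by (rule LIM_zero_cancel)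
qed

lemma sol_norm_cont: "continuous_on {0..} (\<lambda>t. L2_norm (\<lambda>x. u x t))"
  by (rule sol_functional_cont) (intro L2_norm_triangle_diff L2_fun_cont sol_cont)

lemma sol_coeff_cont: "continuous_on {0..} (\<lambda>t. L2_inner (\<lambda>x. u x t) (phi k))"
proof (rule sol_functional_cont)
  fix t t0 :: real assume t: "t \<ge> 0" "t0 \<ge> 0"
  have "L2_inner (\<lambda>x. u x t) (phi k) - L2_inner (\<lambda>x. u x t0) (phi k) = L2_inner (\<lambda>x. u x t - u x t0) (phi k)"
    using t by (simp add: L2_inner_diff_left L2_fun_cont sol_cont)
  also have "\<bar>\<dots>\<bar> \<le> L2_norm (\<lambda>x. u x t - u x t0)"
    using t by (intro abs_inner_phi_le continuous_intros sol_cont)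
  finally show "\<bar>L2_inner (\<lambda>x. u x t) (phi k) - L2_inner (\<lambda>x. u x t0) (phi k)\<bar> \<le> L2_norm (\<lambda>x. u x t - u x t0)" .
qed

lemma sol_coeff_deriv:
  assumes t: "t > 0"
  shows "((\<lambda>t. L2_inner (\<lambda>x. u x t) (phi k)) has_real_derivative
     (- lam \<alpha> k * L2_inner (\<lambda>x. u x t) (phi k) - dphi1 k * u 1 t - b t * L2_inner (\<lambda>x. u x t * u x t) (phi k))) (at t)"
proof -
  from sol obtain ut ux uxx where
    ut: "continuous_on ({0..1} \<times> {0<..}) (\<lambda>(x,t). ut x t)"
    and uxx: "continuous_on ({0..1} \<times> {0<..}) (\<lambda>(x,t). uxx x t)"
    and d: "\<And>x t. x \<in> {0..1} \<Longrightarrow> t > 0 \<Longrightarrow> ((\<lambda>s. u x s) has_real_derivative ut x t) (at t)"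
      "\<And>x t. x \<in> {0..1} \<Longrightarrow> t > 0 \<Longrightarrow> ((\<lambda>y. u y t) has_real_derivative ux x t) (at x within {0..1})"
      "\<And>x t. x \<in> {0..1} \<Longrightarrow> t > 0 \<Longrightarrow> ((\<lambda>y. ux y t) has_real_derivative uxx x t) (at x within {0..1})"
    and pde: "\<And>x t. x \<in> {0<..<1} \<Longrightarrow> t > 0 \<Longrightarrow> ut x t - uxx x t - \<alpha> * u x t + b t * (u x t)^2 = 0"
    unfolding gen_sol_def by blast
  have u0t: "u 0 t = 0" using sol t by (auto simp: gen_sol_def)
  have uc: "continuous_on {0..1} (\<lambda>x. u x t)" using t by (intro sol_cont) auto
  have uxxc: "continuous_on {0..1} (\<lambda>x. uxx x t)" using continuous_on_slice[OF uxx] t by auto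
  have "((\<lambda>t. integral (cbox 0 1) (\<lambda>x. u x t * phi k x)) has_field_derivative
      integral (cbox 0 1) (\<lambda>x. ut x t * phi k x)) (at t within {0<..})"
  proof (rule leibniz_rule_field_derivative)
    show "((\<lambda>s. u x s * phi k x) has_field_derivative ut x s * phi k x) (at s within {0<..})"
      if "s \<in> {0<..}" "x \<in> cbox 0 1" for s x
      by (rule DERIV_cmult_right, rule has_field_derivative_at_within, rule d) (use that in auto)
    show "(\<lambda>x. u x s * phi k x) integrable_on cbox 0 1" if "s \<in> {0<..}" for s
      using that by (intro integrable_continuous continuous_intros) (simp add: sol_cont)
    have sw: "continuous_on ({0<..} \<times> {0..1}) (\<lambda>z. ut (snd z) (fst z))"
    proof -
      have "continuous_on ({0<..} \<times> {0..1}) (\<lambda>z::real \<times> real. (snd z, fst z))" by (intro continuous_intros)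
      moreover have "(\<lambda>z::real \<times> real. (snd z, fst z)) ` ({0<..} \<times> {0..1}) \<subseteq> {0..1} \<times> {0<..}" by auto
      ultimately show ?thesis using continuous_on_compose2[OF ut] by fastforce
    qed
    have "continuous_on ({0<..} \<times> {0..1}) (\<lambda>z. ut (snd z) (fst z) * phi k (snd z))"
      by (intro continuous_intros sw continuous_on_compose2[OF phi_cont[of UNIV k]]) auto
    then show "continuous_on ({0<..} \<times> cbox 0 1) (\<lambda>(s, x). ut x s * phi k x)"
      by (simp add: case_prod_unfold)
  qed (use t in auto)
  then have "((\<lambda>t. L2_inner (\<lambda>x. u x t) (phi k)) has_real_derivative L2_inner (\<lambda>x. ut x t) (phi k)) (at t)"
    using t at_within_open[of t "{0<..}"] by (simp add: L2_inner_def)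
  moreover have "L2_inner (\<lambda>x. ut x t) (phi k) = L2_inner (\<lambda>x. (uxx x t + \<alpha> * u x t) - b t * (u x t * u x t)) (phi k)"
    unfolding L2_inner_def
  \<comment> \<open>The equation is required only for 0 < x < 1; the end points are negligible for
    the integral.\<close>
  proof (rule integral_spike[of "{0,1}"])
    show "(uxx x t + \<alpha> * u x t - b t * (u x t * u x t)) * phi k x = ut x t * phi k x" if "x \<in> {0..1} - {0,1}" for x
    proof -
      have "x \<in> {0<..<1}" using that by auto
      then have "uxx x t + \<alpha> * u x t - b t * (u x t * u x t) = ut x t"
        using pde[of x t] t by (simp add: power2_eq_square)
      then show ?thesis by simp
    qed
  qed auto
  also have "\<dots> = L2_inner (\<lambda>x. uxx x t) (phi k) + \<alpha> * L2_inner (\<lambda>x. u x t) (phi k) - b t * L2_inner (\<lambda>x. u x t * u x t) (phi k)"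
    by (subst L2_inner_diff_left, (intro L2_fun_cont continuous_intros uc uxxc)+,
        subst L2_inner_add_left, (intro L2_fun_cont continuous_intros uc uxxc)+)
      (simp add: L2_inner_cmult_left)
  also have "L2_inner (\<lambda>x. uxx x t) (phi k) = - dphi1 k * u 1 t - (pi * real k)\<^sup>2 * L2_inner (\<lambda>x. u x t) (phi k)"
    using sine_coeff_second_deriv[of "\<lambda>x. u x t" "\<lambda>x. ux x t" "\<lambda>x. uxx x t" k] d(2,3) t u0t uxxc by simp
  ultimately show ?thesis by (simp add: lam_def algebra_simps)
qed

end

section \<open>Decay estimates\<close>


text \<open>The term k = 0 is 1 / 0 = 0, so the value is zeta(2) / pi^2 = 1/6.\<close>

definition pi_zeta :: real where "pi_zeta = (\<Sum>k. 1 / (pi * real k)\<^sup>2)"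

lemma pi_zeta_sums: "(\<lambda>k. 1 / (pi * real k)\<^sup>2) sums pi_zeta"
  unfolding pi_zeta_def by (rule summable_sums[OF summable_inverse_pi_squares])

lemma pi_zeta_nonneg: "0 \<le> pi_zeta"
  unfolding pi_zeta_def by (rule suminf_nonneg[OF summable_inverse_pi_squares]) simp

lemma square_sum_le: "(a + b)\<^sup>2 \<le> 2 * a\<^sup>2 + 2 * (b::real)\<^sup>2"
  using sum_squares_bound[of a b] by (simp add: power2_sum)

lemma le_sqrt_sum:
  assumes "n\<^sup>2 \<le> a\<^sup>2 + b\<^sup>2" "0 \<le> a" "0 \<le> b" shows "n \<le> a + (b::real)"
proof (rule power2_le_imp_le)
  have "0 \<le> 2 * a * b" using assms by simp
  then show "n\<^sup>2 \<le> (a + b)\<^sup>2" using assms(1) by (simp add: power2_sum)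
qed (use assms in simp)

lemma pi_sq_ge_4: "4 \<le> pi\<^sup>2"
  using power_mono[of 2 pi 2] pi_ge_two by simp

text \<open>The gains c enter abstractly, as the two-sided inverse of the Cauchy matrix on the block
  1..N; \<open>feedback_gains\<close> supplies them.\<close>

locale fisher =
  fixes \<alpha> \<beta> \<rho> :: real and N :: nat and \<gamma> :: "nat \<Rightarrow> real" and c :: "nat \<Rightarrow> nat \<Rightarrow> real"
  assumes pos: "\<alpha> > 0" "\<beta> > 0" "\<rho> > 0"
    and low: "\<And>j. j \<in> {1..N} \<Longrightarrow> lam \<alpha> j < \<rho>"
    and high: "\<And>j. N < j \<Longrightarrow> \<rho> \<le> lam \<alpha> j"
    and gam: "\<And>k. k \<in> {1..N} \<Longrightarrow> \<rho> < \<gamma> k"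
    and F: "\<And>k u. Fk \<alpha> N \<gamma> k u = (\<Sum>j\<in>{1..N}. c k j * L2_inner u (phi j))"
    and cV: "is_one_on {1..N} (mmul {1..N} c (\<lambda>i k. dphi1 i / (\<gamma> k - lam \<alpha> i)))"
    and Vc: "is_one_on {1..N} (mmul {1..N} (\<lambda>i k. dphi1 i / (\<gamma> k - lam \<alpha> i)) c)"
begin

definition V :: "nat \<Rightarrow> nat \<Rightarrow> real" where "V i k = dphi1 i / (\<gamma> k - lam \<alpha> i)"
definition Cc :: real where "Cc = (\<Sum>k\<in>{1..N}. \<Sum>j\<in>{1..N}. \<bar>c k j\<bar>)"
definition Vm :: real where "Vm = (\<Sum>k\<in>{1..N}. \<Sum>j\<in>{1..N}. \<bar>V k j\<bar>)"
text \<open>\<rho> / 2 leaves a gap of at least \<rho> / 2 to every rate \<open>\<gamma> k\<close>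
  and every stable eigenvalue; the cap 1 keeps \<mu> below (pi k)^2 / 2, as required for the heat
  modes in \<open>H1_decay\<close>.\<close>

definition \<mu> :: real where "\<mu> = min (\<rho> / 2) 1"

lemma mu: "0 < \<mu>" "\<mu> \<le> \<rho> / 2" "\<mu> \<le> 1"
  using pos by (auto simp: \<mu>_def)

lemma Cc_nonneg: "0 \<le> Cc" unfolding Cc_def by (intro sum_nonneg) auto
lemma Vm_nonneg: "0 \<le> Vm" unfolding Vm_def by (intro sum_nonneg) auto

lemma row_le: "k \<in> {1..N} \<Longrightarrow> (\<Sum>j\<in>{1..N}. \<bar>c k j\<bar>) \<le> Cc"
  unfolding Cc_def by (rule member_le_sum[where f = "\<lambda>k. \<Sum>j\<in>{1..N}. \<bar>c k j\<bar>"]) (auto intro: sum_nonneg)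

lemma V_row_le: "k \<in> {1..N} \<Longrightarrow> (\<Sum>j\<in>{1..N}. \<bar>V k j\<bar>) \<le> Vm"
  unfolding Vm_def by (rule member_le_sum[where f = "\<lambda>k. \<Sum>j\<in>{1..N}. \<bar>V k j\<bar>"]) (auto intro: sum_nonneg)

lemma combination_le:
  assumes k: "k \<in> {1..N}" and z: "\<And>j. j \<in> {1..N} \<Longrightarrow> \<bar>z j\<bar> \<le> Z"
  shows "\<bar>\<Sum>j\<in>{1..N}. c k j * z j\<bar> \<le> Cc * Z" "\<bar>\<Sum>j\<in>{1..N}. V k j * z j\<bar> \<le> Vm * Z"
proof -
  have Z: "0 \<le> Z" using z[OF k] by simp
  have gen: "\<bar>\<Sum>j\<in>{1..N}. d j * z j\<bar> \<le> (\<Sum>j\<in>{1..N}. \<bar>d j\<bar>) * Z" for d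
  proof -
    have "\<bar>\<Sum>j\<in>{1..N}. d j * z j\<bar> \<le> (\<Sum>j\<in>{1..N}. \<bar>d j\<bar> * \<bar>z j\<bar>)"
      unfolding abs_mult[symmetric] by (rule sum_abs)
    also have "\<dots> \<le> (\<Sum>j\<in>{1..N}. \<bar>d j\<bar> * Z)" by (intro sum_mono mult_left_mono z) auto
    finally show ?thesis by (simp add: sum_distrib_right)
  qed
  show "\<bar>\<Sum>j\<in>{1..N}. c k j * z j\<bar> \<le> Cc * Z" "\<bar>\<Sum>j\<in>{1..N}. V k j * z j\<bar> \<le> Vm * Z"
    using gen[of "c k"] gen[of "V k"] mult_right_mono[OF row_le[OF k] Z] mult_right_mono[OF V_row_le[OF k] Z]
    by linarith+
qed

lemma Ffb_eq: "Ffb \<alpha> N \<gamma> v = (\<Sum>k\<in>{1..N}. \<Sum>j\<in>{1..N}. c k j * L2_inner v (phi j))"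
  by (simp add: Ffb_def F)

lemma low_modes_eq:
  assumes "i \<in> {1..N}"
  shows "y i = (\<Sum>m\<in>{1..N}. V i m * (\<Sum>j\<in>{1..N}. c m j * y j))"
proof -
  have "(\<Sum>m\<in>{1..N}. V i m * (\<Sum>j\<in>{1..N}. c m j * y j)) = (\<Sum>m\<in>{1..N}. \<Sum>j\<in>{1..N}. V i m * c m j * y j)"
    by (simp add: sum_distrib_left mult.assoc)
  also have "\<dots> = (\<Sum>j\<in>{1..N}. \<Sum>m\<in>{1..N}. V i m * c m j * y j)" by (rule sum.swap)
  \<comment> \<open>The vector y is passed as a matrix all of whose columns are y; the column index
    0 is a dummy.\<close>
  also have "\<dots> = mmul {1..N} (mmul {1..N} V c) (\<lambda>j _. y j) i 0"
    by (simp add: mmul_def sum_distrib_right)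
  also have "\<dots> = y i" by (rule mmul_one_left) (use Vc assms in \<open>auto simp: V_def[abs_def]\<close>)
  finally show ?thesis by simp
qed

text \<open>In the coordinates given by the values of the single feedbacks the unstable block is diagonal,
  since \<open>\<lambda>\<^sub>i V\<^sub>i\<^sub>k + \<phi>\<^sub>i'(1) = \<gamma>\<^sub>k V\<^sub>i\<^sub>k\<close>.\<close>

lemma feedback_dynamics:
  assumes k: "k \<in> {1..N}" and U: "U = (\<Sum>m\<in>{1..N}. \<Sum>j\<in>{1..N}. c m j * y j)"
  shows "(\<Sum>i\<in>{1..N}. c k i * (- lam \<alpha> i * y i - dphi1 i * U - r i))
    = - \<gamma> k * (\<Sum>j\<in>{1..N}. c k j * y j) - (\<Sum>i\<in>{1..N}. c k i * r i)"
proof -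
  define s where "s m = (\<Sum>j\<in>{1..N}. c m j * y j)" for m
  have y: "y i = (\<Sum>m\<in>{1..N}. V i m * s m)" if "i \<in> {1..N}" for i
    unfolding s_def by (rule low_modes_eq[OF that])
  have e: "- lam \<alpha> i * y i - dphi1 i * U = - (\<Sum>m\<in>{1..N}. \<gamma> m * (V i m * s m))" if i: "i \<in> {1..N}" for i
  proof -
    have "lam \<alpha> i * y i + dphi1 i * U = (\<Sum>m\<in>{1..N}. (lam \<alpha> i * V i m + dphi1 i) * s m)"
    proof -
      have "U = (\<Sum>m\<in>{1..N}. s m)" by (simp add: U s_def)
      then show ?thesis by (simp add: y[OF i] sum_distrib_left sum.distrib distrib_right mult.assoc)
    qed
    also have "\<dots> = (\<Sum>m\<in>{1..N}. \<gamma> m * (V i m * s m))"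
    proof (rule sum.cong)
      fix m assume m: "m \<in> {1..N}"
      have "\<gamma> m - lam \<alpha> i \<noteq> 0" using gam[OF m] low[OF i] by simp
      then have "(\<gamma> m - lam \<alpha> i) * V i m = dphi1 i" by (simp add: V_def)
      then have "lam \<alpha> i * V i m + dphi1 i = \<gamma> m * V i m" by (simp add: algebra_simps)
      then show "(lam \<alpha> i * V i m + dphi1 i) * s m = \<gamma> m * (V i m * s m)" by (simp add: mult.assoc)
    qed simp
    finally show ?thesis by simp
  qed
  have "(\<Sum>i\<in>{1..N}. c k i * (- lam \<alpha> i * y i - dphi1 i * U - r i))
      = (\<Sum>i\<in>{1..N}. - (\<Sum>m\<in>{1..N}. c k i * (\<gamma> m * (V i m * s m))) - c k i * r i)"
  proof (rule sum.cong)
    fix i assume i: "i \<in> {1..N}"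
    show "c k i * (- lam \<alpha> i * y i - dphi1 i * U - r i) = - (\<Sum>m\<in>{1..N}. c k i * (\<gamma> m * (V i m * s m))) - c k i * r i"
      unfolding e[OF i] by (simp add: right_diff_distrib sum_distrib_left)
  qed simp
  also have "\<dots> = - (\<Sum>i\<in>{1..N}. \<Sum>m\<in>{1..N}. c k i * V i m * (\<gamma> m * s m)) - (\<Sum>i\<in>{1..N}. c k i * r i)"
    by (simp add: sum_subtractf sum_negf mult_ac)
  also have "(\<Sum>i\<in>{1..N}. \<Sum>m\<in>{1..N}. c k i * V i m * (\<gamma> m * s m)) = (\<Sum>m\<in>{1..N}. \<Sum>i\<in>{1..N}. c k i * V i m * (\<gamma> m * s m))"
    by (rule sum.swap)
  also have "\<dots> = mmul {1..N} (mmul {1..N} c V) (\<lambda>m _. \<gamma> m * s m) k 0"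
    by (simp add: mmul_def sum_distrib_right)
  also have "\<dots> = \<gamma> k * s k" by (rule mmul_one_left) (use cV k in \<open>auto simp: V_def[abs_def]\<close>)
  finally show ?thesis by (simp add: s_def)
qed

definition D :: real where "D = 2 * (\<rho> + \<alpha>) / \<rho>"

lemma D_nonneg: "0 \<le> D" using pos by (simp add: D_def)

text \<open>On the tail (pi i)^2 = lam + \<alpha> <= lam (1 + \<alpha> / \<rho>), and lam - \<mu> >=
  lam / 2; the two factors combine to \<open>D\<close>.\<close>

lemma tail_rate:
  assumes "N < i"
  shows "\<mu> < lam \<alpha> i" "1 / (lam \<alpha> i - \<mu>) \<le> D / (pi * real i)\<^sup>2"
proof -
  have l: "\<rho> \<le> lam \<alpha> i" using high assms by simp
  then show m: "\<mu> < lam \<alpha> i" using mu pos by simp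
  have h: "lam \<alpha> i / 2 \<le> lam \<alpha> i - \<mu>" using l mu by simp
  have i: "(pi * real i)\<^sup>2 > 0" using assms by simp
  have "\<alpha> * \<rho> \<le> \<alpha> * lam \<alpha> i" using l pos by (intro mult_left_mono) auto
  then have "(pi * real i)\<^sup>2 * \<rho> \<le> lam \<alpha> i * (\<rho> + \<alpha>)" by (simp add: lam_def algebra_simps)
  also have "\<dots> \<le> (2 * (lam \<alpha> i - \<mu>)) * (\<rho> + \<alpha>)" using h pos by (intro mult_right_mono) auto
  finally have *: "(pi * real i)\<^sup>2 * \<rho> \<le> 2 * (lam \<alpha> i - \<mu>) * (\<rho> + \<alpha>)" .
  have "1 / (lam \<alpha> i - \<mu>) * ((pi * real i)\<^sup>2 * \<rho>) \<le> 1 / (lam \<alpha> i - \<mu>) * (2 * (lam \<alpha> i - \<mu>) * (\<rho> + \<alpha>))"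
    using m by (intro mult_left_mono *) auto
  also have "\<dots> = D * \<rho>"
  proof -
    have *: "1 / d * (2 * d * r) = 2 * r" if "d \<noteq> 0" for d r :: real using that by simp
    have "D * \<rho> = 2 * (\<rho> + \<alpha>)" using pos by (simp add: D_def)
    moreover have "lam \<alpha> i - \<mu> \<noteq> 0" using m by simp
    ultimately show ?thesis by (metis *)
  qed
  finally have "1 / (lam \<alpha> i - \<mu>) * (pi * real i)\<^sup>2 * \<rho> \<le> D * \<rho>" by (simp only: mult.assoc)
  then have "1 / (lam \<alpha> i - \<mu>) * (pi * real i)\<^sup>2 \<le> D" using pos by (simp only: mult_le_cancel_right_pos)
  then show "1 / (lam \<alpha> i - \<mu>) \<le> D / (pi * real i)\<^sup>2" using i by (simp only: pos_le_divide_eq)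
qed

text \<open>Constant of \<open>U'_le\<close>: the first summand collects the linear decay terms of
  the N feedback coordinates, the second their quadratic forcing.\<close>

definition G :: real where "G = Cc * (\<Sum>k\<in>{1..N}. \<bar>\<gamma> k\<bar>) + real N * (\<beta> * Cc)"

lemma G_nonneg: "0 \<le> G"
  unfolding G_def using pos Cc_nonneg by (intro add_nonneg_nonneg mult_nonneg_nonneg sum_nonneg) auto

text \<open>Bounds the forced part of mode i by a multiple of 1 / (pi i). For the tail, D N stems
  from the boundary input and D from the quadratic term; for the low modes, the factor pi N turns
  the constant \<open>Vm\<close> into a multiple of 1 / (pi i).\<close>

definition E :: real where "E = D * real N + D + Vm * pi * real N"
definition Q :: real where "Q = 2 * sqrt pi_zeta * (E + real N) + real N"
definition C1 :: real where "C1 = 2 + Q * Cc"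
text \<open>The added 1 makes C2 >= 1, so that 1 / (4 C2) is a smallness threshold below 1.\<close>

definition C2 :: real where "C2 = Q * (2 * \<beta> * Cc / \<rho> + \<beta>) + 1"
text \<open>Bounds the forcing of the coefficients \<open>a\<close>: the outer 2 is their
  normalisation, and 2 G comes from n + n^2 <= 2 K exp (- \<mu> r) in
  \<open>H1_decay\<close>.\<close>

definition H :: real where "H = 2 * (\<alpha> + \<beta> + 2 * G)"

lemma E_nonneg: "0 \<le> E" unfolding E_def using D_nonneg Vm_nonneg by auto
lemma Q_nonneg: "0 \<le> Q" unfolding Q_def using E_nonneg pi_zeta_nonneg by auto
lemma C1_ge: "2 \<le> C1" unfolding C1_def using Q_nonneg Cc_nonneg by auto
lemma C2_ge: "1 \<le> C2" unfolding C2_def using Q_nonneg Cc_nonneg pos by auto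
lemma H_nonneg: "0 \<le> H" using pos G_nonneg by (simp add: H_def)

end

locale fisher_solution = fisher +
  fixes b u0 u
  assumes sol: "gen_sol \<alpha> N \<gamma> b u0 u" and u0: "u0 \<in> IC \<alpha> N \<gamma>"
    and b: "\<And>t. t > 0 \<Longrightarrow> 0 \<le> b t \<and> b t \<le> \<beta>"
begin

definition y where "y k t = L2_inner (\<lambda>x. u x t) (phi k)"
definition q where "q k t = L2_inner (\<lambda>x. u x t * u x t) (phi k)"
definition s where "s k t = (\<Sum>j\<in>{1..N}. c k j * y j t)"
definition n where "n t = L2_norm (\<lambda>x. u x t)"
definition w where "w t x = u x t - u 1 t * x"
text \<open>Coefficients in the sine series of \<open>w\<close>; the factor 2 is the reciprocal of
  the squared norm of a sine.\<close>

definition a where "a k t = 2 * L2_inner (w t) (phi k)"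
definition U' where "U' t = (\<Sum>k\<in>{1..N}. - \<gamma> k * s k t + (- b t * (\<Sum>i\<in>{1..N}. c k i * q i t)))"

lemma n_nonneg: "0 \<le> n t" by (simp add: n_def)

lemma u_at_0: "t \<ge> 0 \<Longrightarrow> u 0 t = 0"
  using sol u0 by (cases "t = 0") (auto simp: gen_sol_def IC_def)

lemma u_init: "x \<in> {0..1} \<Longrightarrow> u x 0 = u0 x"
  using sol by (auto simp: gen_sol_def)

lemma n_0: "n 0 = L2_norm u0"
  unfolding n_def by (rule L2_norm_cong) (rule u_init)

text \<open>At t = 0 the relation comes from u0 in \<open>IC\<close>, since a solution imposes it
  only for t > 0. Continuity of the coefficients \<open>a\<close> up to t = 0 relies on this
  case.\<close>

lemma U_eq: assumes "t \<ge> 0" shows "u 1 t = (\<Sum>k\<in>{1..N}. s k t)"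
proof (cases "t = 0")
  case True
  have "L2_inner (\<lambda>x. u x 0) (phi k) = L2_inner u0 (phi k)" for k
    by (rule L2_inner_cong) (auto simp: u_init)
  moreover have "u 1 0 = Ffb \<alpha> N \<gamma> u0" using u_init[of 1] u0 by (simp add: IC_def)
  ultimately show ?thesis using True by (simp add: Ffb_eq s_def y_def)
next
  case False
  then have "u 1 t = Ffb \<alpha> N \<gamma> (\<lambda>x. u x t)" using sol assms by (auto simp: gen_sol_def)
  then show ?thesis by (simp add: Ffb_eq s_def y_def)
qed

lemma y_cont: "continuous_on {0..} (y k)"
  unfolding y_def by (rule sol_coeff_cont[OF sol])

lemma s_cont: "continuous_on {0..} (s k)"
  unfolding s_def by (intro continuous_intros y_cont)

lemma y_deriv: "t > 0 \<Longrightarrow> (y k has_real_derivative (- lam \<alpha> k * y k t + (- dphi1 k * u 1 t - b t * q k t))) (at t)"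
  unfolding y_def[abs_def] q_def[abs_def] by (rule DERIV_cong[OF sol_coeff_deriv[OF sol]]) simp_all

lemma s_deriv:
  assumes k: "k \<in> {1..N}" and t: "t > 0"
  shows "(s k has_real_derivative (- \<gamma> k * s k t + (- b t * (\<Sum>i\<in>{1..N}. c k i * q i t)))) (at t)"
proof -
  have "((\<lambda>t. \<Sum>i\<in>{1..N}. c k i * y i t) has_real_derivative
     (\<Sum>i\<in>{1..N}. c k i * (- lam \<alpha> i * y i t + (- dphi1 i * u 1 t - b t * q i t)))) (at t)"
    by (intro DERIV_sum DERIV_cmult y_deriv t)
  also have "(\<Sum>i\<in>{1..N}. c k i * (- lam \<alpha> i * y i t + (- dphi1 i * u 1 t - b t * q i t)))
     = (\<Sum>i\<in>{1..N}. c k i * (- lam \<alpha> i * y i t - dphi1 i * u 1 t - b t * q i t))"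
    by (intro sum.cong) (auto simp: algebra_simps)
  also have "\<dots> = - \<gamma> k * (\<Sum>j\<in>{1..N}. c k j * y j t) - (\<Sum>i\<in>{1..N}. c k i * (b t * q i t))"
    by (rule feedback_dynamics[OF k]) (use U_eq[of t] t in \<open>simp add: s_def\<close>)
  finally have d: "((\<lambda>t. \<Sum>i\<in>{1..N}. c k i * y i t) has_real_derivative
      - \<gamma> k * (\<Sum>j\<in>{1..N}. c k j * y j t) - (\<Sum>i\<in>{1..N}. c k i * (b t * q i t))) (at t)" .
  have "(\<Sum>i\<in>{1..N}. c k i * (b t * q i t)) = b t * (\<Sum>i\<in>{1..N}. c k i * q i t)"
    by (simp add: sum_distrib_left mult_ac)
  then show ?thesis unfolding s_def[abs_def] by (intro DERIV_cong[OF d]) simp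
qed

lemma sol_cont': "t \<ge> 0 \<Longrightarrow> continuous_on {0..1} (\<lambda>x. u x t)"
  by (rule sol_cont[OF sol])

lemma y_le: "t \<ge> 0 \<Longrightarrow> \<bar>y k t\<bar> \<le> n t"
  unfolding y_def n_def by (intro abs_inner_phi_le sol_cont')

lemma q_le: "t \<ge> 0 \<Longrightarrow> \<bar>q k t\<bar> \<le> (n t)\<^sup>2"
  unfolding q_def n_def power2_eq_square by (intro abs_inner_sq_le sol_cont')

lemma s_le: "k \<in> {1..N} \<Longrightarrow> t \<ge> 0 \<Longrightarrow> \<bar>s k t\<bar> \<le> Cc * n t"
  unfolding s_def by (intro combination_le y_le)

lemma forcing_le:
  assumes "k \<in> {1..N}" "t > 0"
  shows "\<bar>- b t * (\<Sum>i\<in>{1..N}. c k i * q i t)\<bar> \<le> \<beta> * (Cc * (n t)\<^sup>2)"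
proof -
  have "\<bar>b t\<bar> * \<bar>\<Sum>i\<in>{1..N}. c k i * q i t\<bar> \<le> \<beta> * (Cc * (n t)\<^sup>2)"
    using assms b[of t] pos by (intro mult_mono combination_le q_le) auto
  then show ?thesis by (simp add: abs_mult)
qed

lemma U_deriv:
  assumes t: "t > 0"
  shows "(u 1 has_real_derivative U' t) (at t)"
proof -
  have d: "((\<lambda>t. \<Sum>k\<in>{1..N}. s k t) has_real_derivative U' t) (at t)"
    unfolding U'_def by (intro DERIV_sum s_deriv t)
  show ?thesis
    by (rule has_field_derivative_transform_within_open[OF d open_greaterThan, of 0]) (use t in \<open>auto simp: U_eq\<close>)
qed

lemma w_weak_deriv:
  assumes g: "is_weak_deriv (\<lambda>x. u x t) g"
  shows "is_weak_deriv (w t) (\<lambda>x. g x - u 1 t)"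
proof -
  have "is_weak_deriv (\<lambda>x. u 1 t * x) (\<lambda>x. u 1 t)"
    by (rule is_weak_derivI) (auto intro!: derivative_eq_intros)
  from is_weak_deriv_diff[OF g this] show ?thesis by (simp add: w_def[abs_def])
qed

lemma w_ends: "t \<ge> 0 \<Longrightarrow> w t 0 = 0" "w t 1 = 0"
  using u_at_0 by (auto simp: w_def)

lemma a_eq: assumes t: "t \<ge> 0" shows "a k t = 2 * (y k t - u 1 t * xc k)"
proof -
  have "L2_fun (\<lambda>x. u 1 t * x)" by (intro L2_fun_cont continuous_intros)
  then have "L2_inner (w t) (phi k) = y k t - L2_inner (\<lambda>x. u 1 t * x) (phi k)"
    unfolding w_def[abs_def] y_def by (intro L2_inner_diff_left[OF L2_fun_cont[OF sol_cont'[OF t]] _ L2_fun_phi])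
  then show ?thesis by (simp add: a_def L2_inner_cmult_left xc_def)
qed

lemma w_norm: assumes t: "t \<ge> 0" shows "(\<lambda>k. if k = 0 then 0 else (a k t)\<^sup>2 / 2) sums (L2_norm (w t))\<^sup>2"
proof -
  obtain g where g: "is_weak_deriv (\<lambda>x. u x t) g" using sol_H1[OF sol t] by blast
  note ex = sine_expansion(2,3)[OF w_weak_deriv[OF g] w_ends(1)[OF t] w_ends(2), folded a_def]
  have "L2_norm (w t) = L2_norm (\<lambda>x. \<Sum>k. a k t * phi k x)" by (rule L2_norm_cong) (rule ex(2))
  then show ?thesis using sine_series_norm[OF ex(1)] by simp
qed

lemma n_le_w: assumes t: "t \<ge> 0" shows "n t \<le> L2_norm (w t) + \<bar>u 1 t\<bar>"
proof -
  have wc: "L2_fun (w t)" "L2_fun (\<lambda>x. u 1 t * x)"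
    unfolding w_def[abs_def] by (intro L2_fun_cont continuous_intros sol_cont' t)+
  have "n t = L2_norm (\<lambda>x. w t x + u 1 t * x)" by (simp add: n_def w_def)
  also have "\<dots> \<le> L2_norm (w t) + \<bar>u 1 t\<bar> * L2_norm (\<lambda>x. x)"
    using L2_norm_add_le[OF wc] by (simp add: L2_norm_cmult)
  also have "\<dots> \<le> L2_norm (w t) + \<bar>u 1 t\<bar>"
    using mult_left_mono[OF L2_norm_x_le, of "\<bar>u 1 t\<bar>"] by simp
  finally show ?thesis .
qed

text \<open>Under a provisional decay bound the quantities are estimated in the order of their
  dependence: the decoupled coordinates s, their sum U, the low modes through V, the tail modes
  driven by U, and w by its sine series. The square of the provisional bound is at most K^2 exp (-
  \<mu> t), so the nonlinearity costs only a multiple of K^2 at the same rate.\<close>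

lemma L2_improve:
  assumes T: "T \<ge> 0" and K: "0 \<le> K" and le: "\<And>t. t \<in> {0..T} \<Longrightarrow> n t \<le> K * exp (- \<mu> * t)"
  shows "n T \<le> (C1 * L2_norm u0 + C2 * K\<^sup>2) * exp (- \<mu> * T)"
proof -
  define S where "S = Cc * L2_norm u0 + 2 * \<beta> * Cc / \<rho> * K\<^sup>2"
  define e where "e = exp (- \<mu> * T)"
  have e: "0 \<le> e" by (simp add: e_def)
  have n2: "(n t)\<^sup>2 \<le> K\<^sup>2 * exp (- \<mu> * t)" if t: "t \<in> {0..T}" for t
  proof -
    have "(n t)\<^sup>2 \<le> (K * exp (- \<mu> * t))\<^sup>2" by (intro power_mono le t n_nonneg)
    also have "\<dots> = K\<^sup>2 * (exp (- \<mu> * t) * exp (- \<mu> * t))" by (simp add: power2_eq_square)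
    also have "\<dots> \<le> K\<^sup>2 * (exp (- \<mu> * t) * 1)"
      using mu t by (intro mult_left_mono) auto
    finally show ?thesis by simp
  qed
  have S0: "0 \<le> S" unfolding S_def using Cc_nonneg pos by auto
  have sb: "\<bar>s k t\<bar> \<le> S * exp (- \<mu> * t)" if k: "k \<in> {1..N}" and t: "t \<in> {0..T}" for k t
  proof -
    have gk: "\<rho> / 2 \<le> \<gamma> k - \<mu>" "\<mu> < \<gamma> k" using gam[OF k] mu pos by auto
    have "\<bar>s k t\<bar> \<le> exp (- \<gamma> k * t) * \<bar>s k 0\<bar> + (\<beta> * (Cc * K\<^sup>2)) / (\<gamma> k - \<mu>) * exp (- \<mu> * t)"
    proof (rule duhamel_bound[OF continuous_on_subset[OF s_cont] t])
      fix r assume r: "0 < r" "r < T"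
      show "(s k has_real_derivative - \<gamma> k * s k r + - b r * (\<Sum>i\<in>{1..N}. c k i * q i r)) (at r)"
        by (rule s_deriv[OF k r(1)])
      have "\<bar>- b r * (\<Sum>i\<in>{1..N}. c k i * q i r)\<bar> \<le> \<beta> * (Cc * (n r)\<^sup>2)" by (rule forcing_le[OF k r(1)])
      also have "\<dots> \<le> \<beta> * (Cc * (K\<^sup>2 * exp (- \<mu> * r)))"
        using r pos Cc_nonneg by (intro mult_left_mono n2) auto
      finally show "\<bar>- b r * (\<Sum>i\<in>{1..N}. c k i * q i r)\<bar> \<le> (\<beta> * (Cc * K\<^sup>2)) * exp (- \<mu> * r)"
        by (simp add: mult.assoc)
    qed (use gk pos Cc_nonneg in auto)
    also have "\<dots> \<le> exp (- \<mu> * t) * (Cc * L2_norm u0) + (\<beta> * (Cc * K\<^sup>2)) / (\<rho> / 2) * exp (- \<mu> * t)"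
    proof (intro add_mono mult_mono mult_right_mono divide_left_mono)
      show "exp (- \<gamma> k * t) \<le> exp (- \<mu> * t)" using gk t by (auto intro: mult_right_mono)
      show "\<bar>s k 0\<bar> \<le> Cc * L2_norm u0" using s_le[OF k, of 0] by (simp add: n_0)
    qed (use gk pos Cc_nonneg in auto)
    also have "\<dots> = S * exp (- \<mu> * t)" using pos by (simp add: S_def field_simps)
    finally show ?thesis .
  qed
  have Ub: "\<bar>u 1 t\<bar> \<le> real N * S * exp (- \<mu> * t)" if t: "t \<in> {0..T}" for t
  proof -
    have "\<bar>u 1 t\<bar> \<le> (\<Sum>k\<in>{1..N}. \<bar>s k t\<bar>)" using U_eq[of t] t by (simp add: sum_abs)
    also have "\<dots> \<le> (\<Sum>k\<in>{1..N}. S * exp (- \<mu> * t))" by (intro sum_mono sb t)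
    finally show ?thesis by simp
  qed
  \<comment> \<open>One size for both kinds of forcing: S for the boundary input and \<beta> K^2 for
    the quadratic term.\<close>
  define P where "P = S + \<beta> * K\<^sup>2"
  have P: "0 \<le> P" "S \<le> P" using S0 pos by (auto simp: P_def)
  have TT: "T \<in> {0..T}" using T by simp
  have yb: "\<bar>y i T\<bar> \<le> e * (\<bar>y i 0\<bar> + E * P / (pi * real i))" if i: "1 \<le> i" for i
  proof (cases "i \<le> N")
    case True
    then have iN: "i \<in> {1..N}" using i by simp
    have yi: "y i T = (\<Sum>m\<in>{1..N}. V i m * s m T)"
      unfolding s_def by (rule low_modes_eq[OF iN])
    have "\<bar>y i T\<bar> \<le> Vm * (S * e)" unfolding yi e_def by (intro combination_le(2) iN sb TT)
    also have "\<dots> \<le> Vm * (P * e)" using P Vm_nonneg e by (intro mult_left_mono mult_right_mono)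
    also have "\<dots> = e * (Vm * P)" by (simp add: mult_ac)
    also have "Vm * P \<le> E * P / (pi * real i)"
    proof -
      have "Vm * (pi * real i) \<le> Vm * (pi * real N)" using True Vm_nonneg by (intro mult_left_mono) auto
      also have "\<dots> \<le> E" unfolding E_def using D_nonneg by auto
      finally have "Vm * (pi * real i) * P \<le> E * P" using P by (intro mult_right_mono) auto
      then show ?thesis using i by (simp add: field_simps)
    qed
    finally have "\<bar>y i T\<bar> \<le> e * (E * P / (pi * real i))" using e by (simp add: mult_left_mono)
    also have "\<dots> \<le> e * (\<bar>y i 0\<bar> + E * P / (pi * real i))" using e by (intro mult_left_mono) auto
    finally show ?thesis .
  next
    case False
    then have iN: "N < i" by simp
    note rate = tail_rate[OF iN]
    \<comment> \<open>The quadratic forcing lacks the factor pi i of the boundary input; this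
      inequality absorbs it into a multiple of pi i.\<close>
    have pi1: "1 \<le> pi * real i" using i pi_ge_two mult_mono[of 1 pi 1 "real i"] by simp
    have "\<bar>y i T\<bar> \<le> exp (- lam \<alpha> i * T) * \<bar>y i 0\<bar> + (pi * real i * (real N * S) + \<beta> * K\<^sup>2) / (lam \<alpha> i - \<mu>) * exp (- \<mu> * T)"
    proof (rule duhamel_bound[OF continuous_on_subset[OF y_cont] TT y_deriv])
      fix r assume r: "0 < r" "r < T"
      have rT: "r \<in> {0..T}" using r by simp
      have "\<bar>- dphi1 i * u 1 r - b r * q i r\<bar> \<le> \<bar>dphi1 i * u 1 r\<bar> + \<bar>b r * q i r\<bar>" by linarith
      also have "\<dots> \<le> (pi * real i) * (real N * S * exp (- \<mu> * r)) + \<beta> * (K\<^sup>2 * exp (- \<mu> * r))"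
        unfolding abs_mult using b[OF r(1)] pos order_trans[OF q_le n2[OF rT], of i] rT
        by (intro add_mono mult_mono abs_dphi1_le Ub) auto
      finally show "\<bar>- dphi1 i * u 1 r - b r * q i r\<bar> \<le> (pi * real i * (real N * S) + \<beta> * K\<^sup>2) * exp (- \<mu> * r)"
        by (simp add: algebra_simps)
    qed (use rate S0 pos in auto)
    also have "\<dots> \<le> e * \<bar>y i 0\<bar> + E * P / (pi * real i) * e"
    proof (rule add_mono)
      show "exp (- lam \<alpha> i * T) * \<bar>y i 0\<bar> \<le> e * \<bar>y i 0\<bar>"
        unfolding e_def using rate T by (intro mult_right_mono) (auto intro: mult_right_mono)
      have "pi * real i * (real N * S) + \<beta> * K\<^sup>2 \<le> pi * real i * (real N * P) + pi * real i * P"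
      proof (rule add_mono)
        show "pi * real i * (real N * S) \<le> pi * real i * (real N * P)"
          using P by (intro mult_left_mono) auto
        have "\<beta> * K\<^sup>2 \<le> P" using S0 by (simp add: P_def)
        also have "\<dots> \<le> pi * real i * P" using pi1 P mult_right_mono[of 1 "pi * real i" P] by simp
        finally show "\<beta> * K\<^sup>2 \<le> pi * real i * P" .
      qed
      \<comment> \<open>Forcing of size pi i against a rate of order (pi i)^2 leaves 1 / (pi i),
        which is square summable.\<close>
      then have "(pi * real i * (real N * S) + \<beta> * K\<^sup>2) * (1 / (lam \<alpha> i - \<mu>))
         \<le> (pi * real i * ((real N + 1) * P)) * (D / (pi * real i)\<^sup>2)"
        using rate P S0 pos by (intro mult_mono) (auto simp: algebra_simps)
      also have "\<dots> = (D * real N + D) * P / (pi * real i)"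
        using i by (simp add: power2_eq_square field_simps)
      also have "\<dots> \<le> E * P / (pi * real i)"
        using P Vm_nonneg by (intro divide_right_mono mult_right_mono) (auto simp: E_def)
      finally show "(pi * real i * (real N * S) + \<beta> * K\<^sup>2) / (lam \<alpha> i - \<mu>) * exp (- \<mu> * T) \<le> E * P / (pi * real i) * e"
        unfolding e_def by (intro mult_right_mono) auto
    qed
    finally show ?thesis by (simp add: algebra_simps)
  qed
  have ab: "(a k T)\<^sup>2 / 2 \<le> 4 * e\<^sup>2 * ((y k 0)\<^sup>2 + ((E + real N) * P)\<^sup>2 * (1 / (pi * real k)\<^sup>2))" if k: "1 \<le> k" for k
  proof -
    have "\<bar>u 1 T * xc k\<bar> \<le> (real N * P * e) * (1 / (pi * real k))"
    proof -
      have "\<bar>u 1 T\<bar> \<le> real N * P * e"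
        using Ub[OF TT] mult_left_mono[OF P(2), of "real N * e"] e by (simp add: e_def mult_ac)
      then show ?thesis unfolding abs_mult using abs_xc_le[of k] by (intro mult_mono) auto
    qed
    then have "2 * (\<bar>y k T\<bar> + \<bar>u 1 T * xc k\<bar>) \<le> 2 * (e * (\<bar>y k 0\<bar> + E * P / (pi * real k)) + (real N * P * e) * (1 / (pi * real k)))"
      by (intro mult_left_mono add_mono yb[OF k]) auto
    moreover have "\<bar>a k T\<bar> \<le> 2 * (\<bar>y k T\<bar> + \<bar>u 1 T * xc k\<bar>)"
      unfolding a_eq[OF T] abs_mult[of 2] by (intro mult_mono abs_triangle_ineq4) auto
    ultimately have "\<bar>a k T\<bar> \<le> 2 * (e * (\<bar>y k 0\<bar> + E * P / (pi * real k)) + (real N * P * e) * (1 / (pi * real k)))"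
      by (rule order_trans[rotated])
    also have "\<dots> = 2 * e * (\<bar>y k 0\<bar> + (E + real N) * P / (pi * real k))"
      by (simp add: algebra_simps add_divide_distrib)
    finally have "\<bar>a k T\<bar>\<^sup>2 \<le> (2 * e * (\<bar>y k 0\<bar> + (E + real N) * P / (pi * real k)))\<^sup>2"
      by (intro power_mono) auto
    also have "\<dots> \<le> (2 * e)\<^sup>2 * (2 * \<bar>y k 0\<bar>\<^sup>2 + 2 * ((E + real N) * P / (pi * real k))\<^sup>2)"
      unfolding power_mult_distrib[of "2 * e"] by (intro mult_left_mono square_sum_le) auto
    also have "\<dots> = 2 * (4 * e\<^sup>2 * ((y k 0)\<^sup>2 + ((E + real N) * P)\<^sup>2 * (1 / (pi * real k)\<^sup>2)))"
      by (simp add: power_divide power_mult_distrib[of 2 e])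
    finally show ?thesis by simp
  qed
  have u0L: "L2_fun u0" using u0 weak_deriv_cont L2_fun_cont by (auto simp: IC_def H1_def)
  have y0: "y k 0 = L2_inner u0 (phi k)" for k
    unfolding y_def by (rule L2_inner_cong) (auto simp: u_init)
  have sy: "summable (\<lambda>k. (y k 0)\<^sup>2)" "2 * (\<Sum>k. (y k 0)\<^sup>2) \<le> (L2_norm u0)\<^sup>2"
    using sine_Bessel[OF u0L] by (auto simp: y0 L2_norm_sq)
  have "(L2_norm (w T))\<^sup>2 \<le> 4 * e\<^sup>2 * ((\<Sum>k. (y k 0)\<^sup>2) + ((E + real N) * P)\<^sup>2 * pi_zeta)"
  proof (rule sums_le[OF _ w_norm[OF T]])
    show "(\<lambda>k. 4 * e\<^sup>2 * ((y k 0)\<^sup>2 + ((E + real N) * P)\<^sup>2 * (1 / (pi * real k)\<^sup>2))) sums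
       (4 * e\<^sup>2 * ((\<Sum>k. (y k 0)\<^sup>2) + ((E + real N) * P)\<^sup>2 * pi_zeta))"
      by (intro sums_mult sums_add summable_sums sy(1) pi_zeta_sums)
    show "(if k = 0 then 0 else (a k T)\<^sup>2 / 2) \<le> 4 * e\<^sup>2 * ((y k 0)\<^sup>2 + ((E + real N) * P)\<^sup>2 * (1 / (pi * real k)\<^sup>2))" for k
      using ab[of k] by (cases "k = 0") auto
  qed
  also have "\<dots> \<le> 4 * e\<^sup>2 * ((L2_norm u0)\<^sup>2 + ((E + real N) * P)\<^sup>2 * pi_zeta)"
    using sy suminf_nonneg[OF sy(1)] by (intro mult_left_mono add_right_mono) auto
  also have "\<dots> = (2 * e * L2_norm u0)\<^sup>2 + (2 * e * ((E + real N) * P * sqrt pi_zeta))\<^sup>2"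
    using pi_zeta_nonneg by (simp add: power_mult_distrib distrib_left mult.assoc)
  finally have "L2_norm (w T) \<le> 2 * e * L2_norm u0 + 2 * e * ((E + real N) * P * sqrt pi_zeta)"
    by (rule le_sqrt_sum) (use P E_nonneg pi_zeta_nonneg e in auto)
  moreover have "\<bar>u 1 T\<bar> \<le> real N * P * e"
    using Ub[OF TT] mult_left_mono[OF P(2), of "real N * e"] e by (simp add: e_def mult_ac)
  ultimately have "n T \<le> e * (2 * L2_norm u0 + Q * P)"
    using n_le_w[OF T] by (simp add: Q_def algebra_simps)
  also have "\<dots> \<le> e * (C1 * L2_norm u0 + C2 * K\<^sup>2)"
  proof (intro mult_left_mono)
    have "Q * P = Q * Cc * L2_norm u0 + Q * (2 * \<beta> * Cc / \<rho> + \<beta>) * K\<^sup>2"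
      by (simp add: P_def S_def algebra_simps)
    then show "2 * L2_norm u0 + Q * P \<le> C1 * L2_norm u0 + C2 * K\<^sup>2"
      by (simp add: C1_def C2_def distrib_right)
  qed (rule e)
  finally show ?thesis by (simp add: e_def mult.commute)
qed

text \<open>The bound on u0 makes the linear term of \<open>L2_improve\<close> at most K / 2, and K
  <= 1 / (4 C2) makes the quadratic one at most K / 4. The provisional constant K thus improves to 3
  K / 4, and the continuity method applies to exp (\<mu> t) n(t).\<close>

lemma L2_decay:
  assumes K: "0 < K" "K \<le> 1 / (4 * C2)" "2 * C1 * L2_norm u0 \<le> K" and t: "t \<ge> 0"
  shows "n t \<le> K * exp (- \<mu> * t)"
proof -
  have "exp (\<mu> * t) * n t < K"
  proof (rule continuity_method[of "\<lambda>t. exp (\<mu> * t) * n t", OF _ _ _ t])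
    show "continuous_on {0..} (\<lambda>t. exp (\<mu> * t) * n t)"
      unfolding n_def by (intro continuous_intros sol_norm_cont[OF sol])
    \<comment> \<open>C1 >= 2 places the initial value strictly below K.\<close>
    have "4 * L2_norm u0 \<le> 2 * C1 * L2_norm u0" using C1_ge by (intro mult_right_mono) auto
    then have "4 * L2_norm u0 \<le> K" using K by linarith
    then show "exp (\<mu> * 0) * n 0 < K" using K L2_norm_nonneg[of u0] by (simp add: n_0)
    fix T :: real assume T: "T \<ge> 0" and le: "\<And>t. t \<in> {0..T} \<Longrightarrow> exp (\<mu> * t) * n t \<le> K"
    have "n t \<le> K * exp (- \<mu> * t)" if "t \<in> {0..T}" for t
      using le[OF that] by (simp add: exp_minus field_simps)
    from L2_improve[OF T _ this] have "n T \<le> (C1 * L2_norm u0 + C2 * K\<^sup>2) * exp (- \<mu> * T)" using K by simp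
    then have "exp (\<mu> * T) * n T \<le> C1 * L2_norm u0 + C2 * K\<^sup>2" by (simp add: exp_minus field_simps)
    also have "C2 * K\<^sup>2 \<le> K / 4"
    proof -
      have "C2 * K \<le> 1 / 4" using K C2_ge by (simp add: field_simps)
      then have "C2 * K * K \<le> 1 / 4 * K" using K by (intro mult_right_mono) auto
      then show ?thesis by (simp add: power2_eq_square mult.assoc)
    qed
    finally show "exp (\<mu> * T) * n T < K" using K by simp
  qed
  then show ?thesis by (simp add: exp_minus field_simps)
qed

lemma U'_le:
  assumes t: "t > 0"
  shows "\<bar>U' t\<bar> \<le> G * (n t + (n t)\<^sup>2)"
proof -
  have "\<bar>U' t\<bar> \<le> (\<Sum>k\<in>{1..N}. \<bar>\<gamma> k\<bar> * (Cc * n t) + \<beta> * (Cc * (n t)\<^sup>2))"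
    unfolding U'_def
  proof (rule order_trans[OF sum_abs sum_mono])
    fix k assume k: "k \<in> {1..N}"
    have "\<bar>- \<gamma> k * s k t\<bar> \<le> \<bar>\<gamma> k\<bar> * (Cc * n t)"
      unfolding abs_mult using s_le[OF k] t by (simp add: mult_left_mono)
    then show "\<bar>- \<gamma> k * s k t + (- b t * (\<Sum>i\<in>{1..N}. c k i * q i t))\<bar> \<le> \<bar>\<gamma> k\<bar> * (Cc * n t) + \<beta> * (Cc * (n t)\<^sup>2)"
      using forcing_le[OF k t] by linarith
  qed
  also have "\<dots> = Cc * (\<Sum>k\<in>{1..N}. \<bar>\<gamma> k\<bar>) * n t + real N * (\<beta> * Cc) * (n t)\<^sup>2"
    by (simp add: sum.distrib sum_distrib_left sum_distrib_right mult_ac)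
  also have "\<dots> \<le> G * n t + G * (n t)\<^sup>2"
    unfolding G_def using pos Cc_nonneg n_nonneg[of t]
    by (intro add_mono mult_right_mono) (auto intro!: sum_nonneg mult_nonneg_nonneg)
  finally show ?thesis by (simp add: distrib_left)
qed

lemma a_cont: "continuous_on {0..} (a k)"
proof -
  have "continuous_on {0..} (\<lambda>t. 2 * (y k t - (\<Sum>k\<in>{1..N}. s k t) * xc k))"
    by (intro continuous_intros y_cont s_cont)
  then show ?thesis by (rule continuous_on_eq) (simp add: a_eq U_eq)
qed

text \<open>By \<open>xc_eq\<close> the lift cancels the boundary input, whose size grows like pi k.
  What replaces it is U' times \<open>xc k\<close>, so the whole forcing is bounded uniformly in
  k.\<close>

lemma a_deriv:
  assumes t: "t > 0"
  shows "(a k has_real_derivative (- (pi * real k)\<^sup>2 * a k t + 2 * (\<alpha> * y k t - b t * q k t - U' t * xc k))) (at t)"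
proof -
  have "((\<lambda>t. 2 * (y k t - u 1 t * xc k)) has_real_derivative
      2 * (- lam \<alpha> k * y k t + (- dphi1 k * u 1 t - b t * q k t) - U' t * xc k)) (at t)"
    by (intro DERIV_cmult DERIV_diff DERIV_cmult_right y_deriv U_deriv t)
  moreover have "2 * (- lam \<alpha> k * y k t + (- dphi1 k * u 1 t - b t * q k t) - U' t * xc k)
    = - (pi * real k)\<^sup>2 * a k t + 2 * (\<alpha> * y k t - b t * q k t - U' t * xc k)"
  proof -
    have "dphi1 k = - ((pi * real k)\<^sup>2 * xc k)" using xc_eq[of k] by simp
    then show ?thesis using t by (simp add: a_eq lam_def algebra_simps)
  qed
  ultimately have d: "((\<lambda>t. 2 * (y k t - u 1 t * xc k)) has_real_derivative
     - (pi * real k)\<^sup>2 * a k t + 2 * (\<alpha> * y k t - b t * q k t - U' t * xc k)) (at t)" by (rule DERIV_cong)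
  show ?thesis
    by (rule has_field_derivative_transform_within_open[OF d open_greaterThan, of 0]) (use t in \<open>auto simp: a_eq\<close>)
qed

text \<open>The forcing of each mode is at most H K exp (- \<mu> r), so Duhamel leaves 2 H K / (pi
  k)^2; with the weight (pi k)^2 of the H^1 norm the squares still sum, to a multiple of
  \<open>pi_zeta\<close>. The rate is (pi k)^2 and not the eigenvalue: \<alpha> u counts as forcing,
  its decay being known already.\<close>

lemma H1_decay:
  assumes K: "0 < K" "K \<le> 1" and le: "\<And>t. t \<ge> 0 \<Longrightarrow> n t \<le> K * exp (- \<mu> * t)" and t: "t \<ge> 0"
  shows "H1_norm (\<lambda>x. u x t) \<le> exp (- \<mu> * t) * (4 * H1_norm u0 + (1 + 2 * H * sqrt pi_zeta + real N * Cc) * K)"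
proof -
  define e where "e = exp (- \<mu> * t)"
  have e: "0 \<le> e" by (simp add: e_def)
  have n2: "n r + (n r)\<^sup>2 \<le> 2 * K * exp (- \<mu> * r)" "(n r)\<^sup>2 \<le> K * exp (- \<mu> * r)" if r: "r \<ge> 0" for r
  proof -
    \<comment> \<open>K <= 1 enters here: it turns the quadratic terms into linear ones.\<close>
    have "n r \<le> 1" using le[OF r] K mult_mono[of K 1 "exp (- \<mu> * r)" 1] mu r by simp
    then have "(n r)\<^sup>2 \<le> n r" using n_nonneg[of r] mult_left_mono[of "n r" 1 "n r"] by (simp add: power2_eq_square)
    then show "n r + (n r)\<^sup>2 \<le> 2 * K * exp (- \<mu> * r)" "(n r)\<^sup>2 \<le> K * exp (- \<mu> * r)" using le[OF r] by simp_all
  qed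
  obtain g where g: "is_weak_deriv (\<lambda>x. u x t) g" using sol_H1[OF sol t] by blast
  obtain g0 where g0: "is_weak_deriv (\<lambda>x. u x 0) g0" using sol_H1[OF sol, of 0] by blast
  have g0': "is_weak_deriv u0 g0"
    unfolding is_weak_deriv_def
  proof (intro conjI ballI)
    show "L2_fun g0" using is_weak_derivD(1)[OF g0] .
    show "u0 x = u0 0 + integral {0..x} g0" if x: "x \<in> {0..1}" for x
      using is_weak_derivD(2)[OF g0 x] u_init[OF x] u_init[of 0] by simp
  qed
  note S = sine_expansion(1)[OF w_weak_deriv[OF g] w_ends(1)[OF t] w_ends(2), folded a_def]
  note S0 = sine_expansion(1)[OF w_weak_deriv[OF g0] w_ends(1)[OF order_refl] w_ends(2), folded a_def]
  have ab: "(pi * real k)\<^sup>2 * (a k t)\<^sup>2 / 2 \<le> e\<^sup>2 * (2 * ((pi * real k)\<^sup>2 * (a k 0)\<^sup>2 / 2) + 4 * H\<^sup>2 * K\<^sup>2 * (1 / (pi * real k)\<^sup>2))" for k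
  proof (cases "k = 0")
    case False
    define l where "l = (pi * real k)\<^sup>2"
    have l4: "4 \<le> l"
    proof -
      have "4 * 1 \<le> pi\<^sup>2 * (real k)\<^sup>2" using pi_sq_ge_4 False by (intro mult_mono) auto
      then show ?thesis by (simp add: l_def power_mult_distrib)
    qed
    then have l: "\<mu> < l" "l / 2 \<le> l - \<mu>" using mu by auto
    have "\<bar>a k t\<bar> \<le> exp (- l * t) * \<bar>a k 0\<bar> + (H * K) / (l - \<mu>) * exp (- \<mu> * t)"
    proof (rule duhamel_bound[of t "a k" t l, OF continuous_on_subset[OF a_cont]])
      fix r assume r: "0 < r" "r < t"
      show "(a k has_real_derivative - l * a k r + 2 * (\<alpha> * y k r - b r * q k r - U' r * xc k)) (at r)"
        unfolding l_def by (rule a_deriv[OF r(1)])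
      have "1 \<le> pi * real k" using False pi_ge_two mult_mono[of 1 pi 1 "real k"] by simp
      then have "1 / (pi * real k) \<le> 1" by simp
      then have x1: "\<bar>xc k\<bar> \<le> 1" using abs_xc_le[of k] by linarith
      have "\<bar>\<alpha> * y k r - b r * q k r - U' r * xc k\<bar> \<le> \<bar>\<alpha> * y k r\<bar> + \<bar>b r * q k r\<bar> + \<bar>U' r * xc k\<bar>" by linarith
      also have "\<dots> \<le> \<alpha> * (K * exp (- \<mu> * r)) + \<beta> * (K * exp (- \<mu> * r)) + G * (2 * K * exp (- \<mu> * r)) * 1"
        unfolding abs_mult
      proof (intro add_mono mult_mono)
        show "\<bar>y k r\<bar> \<le> K * exp (- \<mu> * r)" using y_le[of r k] le[of r] r by simp
        show "\<bar>q k r\<bar> \<le> K * exp (- \<mu> * r)" using q_le[of r k] n2(2)[of r] r by simp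
        show "\<bar>U' r\<bar> \<le> G * (2 * K * exp (- \<mu> * r))"
          using order_trans[OF U'_le[OF r(1)] mult_left_mono[OF n2(1) G_nonneg]] r by simp
      qed (use x1 b[OF r(1)] pos K G_nonneg in auto)
      finally show "\<bar>2 * (\<alpha> * y k r - b r * q k r - U' r * xc k)\<bar> \<le> (H * K) * exp (- \<mu> * r)"
        by (simp add: H_def abs_mult algebra_simps)
    qed (use t l H_nonneg K in auto)
    also have "\<dots> \<le> e * \<bar>a k 0\<bar> + (H * K) / (l / 2) * e"
      unfolding e_def using l l4 t H_nonneg K
      by (intro add_mono mult_right_mono divide_left_mono) (auto intro!: mult_right_mono)
    finally have "\<bar>a k t\<bar> \<le> e * (\<bar>a k 0\<bar> + 2 * H * K / l)" by (simp add: algebra_simps)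
    then have "\<bar>a k t\<bar>\<^sup>2 \<le> (e * (\<bar>a k 0\<bar> + 2 * H * K / l))\<^sup>2" by (intro power_mono) auto
    also have "\<dots> \<le> e\<^sup>2 * (2 * \<bar>a k 0\<bar>\<^sup>2 + 2 * (2 * H * K / l)\<^sup>2)"
      unfolding power_mult_distrib[of e] by (intro mult_left_mono square_sum_le) auto
    finally have "l * (a k t)\<^sup>2 \<le> l * (e\<^sup>2 * (2 * \<bar>a k 0\<bar>\<^sup>2 + 2 * (2 * H * K / l)\<^sup>2))"
      using l4 by (intro mult_left_mono) auto
    also have "\<dots> = 2 * (e\<^sup>2 * (2 * (l * (a k 0)\<^sup>2 / 2) + 4 * H\<^sup>2 * K\<^sup>2 * (1 / l)))"
      using l4 by (simp add: power_mult_distrib power_divide power2_eq_square[of l] field_simps)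
    finally show ?thesis unfolding l_def[symmetric] by linarith
  qed simp
  let ?h = "L2_norm (\<lambda>x. g x - u 1 t)" and ?hz = "L2_norm (\<lambda>x. g0 x - u 1 0)"
  have "?h\<^sup>2 \<le> e\<^sup>2 * (2 * ?hz\<^sup>2 + 4 * H\<^sup>2 * K\<^sup>2 * pi_zeta)"
    by (rule sums_le[OF ab S]) (intro sums_mult sums_add S0 pi_zeta_sums)
  also have "\<dots> \<le> (e * (2 * ?hz))\<^sup>2 + (e * (2 * H * K * sqrt pi_zeta))\<^sup>2"
    using pi_zeta_nonneg by (simp add: power_mult_distrib algebra_simps)
  finally have h: "?h \<le> e * (2 * ?hz) + e * (2 * H * K * sqrt pi_zeta)"
    by (rule le_sqrt_sum) (use e H_nonneg K pi_zeta_nonneg in auto)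
  have const: "L2_norm (\<lambda>x. d) = \<bar>d\<bar>" for d :: real by (simp add: L2_norm_def)
  have cL: "L2_fun (\<lambda>x. d)" for d :: real by (rule L2_fun_cont) simp
  have gL: "L2_fun g" "L2_fun g0" using is_weak_derivD(1) g g0 by auto
  have "u 1 0 = integral {0..1} g0" using is_weak_derivD(2)[OF g0, of 1] u_at_0[of 0] by simp
  then have "\<bar>u 1 0\<bar> \<le> L2_norm g0" using integral_abs_le_L2_norm[OF gL(2), of 1] by simp
  then have "?hz \<le> 2 * L2_norm g0"
    using L2_norm_add_le[OF gL(2) cL[of "- u 1 0"]] const[of "- u 1 0"] by simp
  also have "\<dots> \<le> 2 * H1_norm u0" using H1_norm_bounds(2)[OF g0'] by simp
  finally have h0: "e * (2 * ?hz) \<le> e * (4 * H1_norm u0)" using e by (intro mult_left_mono) auto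
  have "\<bar>u 1 t\<bar> \<le> (\<Sum>k\<in>{1..N}. \<bar>s k t\<bar>)" using U_eq[OF t] by (simp add: sum_abs)
  also have "\<dots> \<le> (\<Sum>k\<in>{1..N}. Cc * (K * e))"
    unfolding e_def by (intro sum_mono order_trans[OF s_le] mult_left_mono le t Cc_nonneg)
  finally have U: "\<bar>u 1 t\<bar> \<le> real N * Cc * K * e" by simp
  have "L2_norm g \<le> ?h + \<bar>u 1 t\<bar>"
    using L2_norm_add_le[OF L2_fun_diff[OF gL(1) cL[of "u 1 t"]] cL[of "u 1 t"]] const[of "u 1 t"] by simp
  moreover have "H1_norm (\<lambda>x. u x t) \<le> n t + L2_norm g" using H1_norm_bounds(3)[OF g] by (simp add: n_def)
  ultimately have "H1_norm (\<lambda>x. u x t) \<le> K * e + (e * (4 * H1_norm u0) + e * (2 * H * K * sqrt pi_zeta) + real N * Cc * K * e)"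
    using le[OF t, folded e_def] h h0 U by linarith
  then show ?thesis by (simp add: e_def algebra_simps)
qed

end

section \<open>Mild solutions\<close>


lemma continuous_on_atLeastI:
  fixes f :: "real \<Rightarrow> 'a::topological_space"
  assumes "\<And>T. continuous_on {0..T} f"
  shows "continuous_on {0..} f"
  unfolding continuous_on_def
proof
  fix t :: real assume t: "t \<in> {0..}"
  have "at t within {0..} = at t within {0..t+1}"
    by (rule at_within_nhd[where S = "{t-1<..<t+1}"]) auto
  then show "(f \<longlongrightarrow> f t) (at t within {0..})"
    using assms[of "t+1"] t by (auto simp: continuous_on_def)
qed

text \<open>The solution of y' = - l y + h with y(0) = 0. Keeping exp (- l t) outside the integral
  lets the derivative come from the product rule, with no parameter under the integral.\<close>

definition duh :: "real \<Rightarrow> (real \<Rightarrow> real) \<Rightarrow> real \<Rightarrow> real" where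
  "duh l h t = exp (- l * t) * integral {0..t} (\<lambda>s. exp (l * s) * h s)"

lemma duh_0 [simp]: "duh l h 0 = 0"
  by (simp add: duh_def)

lemma duh_zero: "duh l (\<lambda>s. 0) t = 0"
  by (simp add: duh_def)

lemma duh_deriv_within:
  assumes h: "continuous_on {0..} h" and t: "t \<in> {0..T}"
  shows "(duh l h has_real_derivative - l * duh l h t + h t) (at t within {0..T})"
proof -
  have "continuous_on {0..T} (\<lambda>s. exp (l * s) * h s)"
    by (intro continuous_intros continuous_on_subset[OF h]) auto
  from integral_has_real_derivative[OF this t]
  have d: "((\<lambda>t. integral {0..t} (\<lambda>s. exp (l * s) * h s)) has_real_derivative exp (l * t) * h t) (at t within {0..T})" .
  show ?thesis unfolding duh_def[abs_def]
    by (rule derivative_eq_intros d refl)+ (simp add: algebra_simps exp_minus)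
qed

lemma duh_cont: "continuous_on {0..} h \<Longrightarrow> continuous_on {0..} (duh l h)"
  by (rule continuous_on_atLeastI, rule DERIV_continuous_on, rule duh_deriv_within)

lemma duh_deriv:
  assumes h: "continuous_on {0..} h" and t: "0 < t"
  shows "(duh l h has_real_derivative - l * duh l h t + h t) (at t)"
  using duh_deriv_within[OF h, of t "t+1" l] t at_within_Icc_at[of 0 t "t+1"] by auto

text \<open>\<open>duhamel_bound\<close> with the negative decay rate - M: forcing that grows like
  exp (M s) is damped by 1 / (l + M), the source of the contraction.\<close>

lemma duh_bound:
  assumes h: "continuous_on {0..} h" and t: "0 \<le> t" and K: "0 \<le> K"
    and le: "\<And>s. 0 \<le> s \<Longrightarrow> s \<le> t \<Longrightarrow> \<bar>h s\<bar> \<le> K * exp (M * s)" and l: "l + M > 0"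
  shows "\<bar>duh l h t\<bar> \<le> K / (l + M) * exp (M * t)"
proof -
  have "\<bar>duh l h t\<bar> \<le> exp (- l * t) * \<bar>duh l h 0\<bar> + K / (l - (- M)) * exp (- (- M) * t)"
  proof (rule duhamel_bound[of t])
    show "continuous_on {0..t} (duh l h)" by (rule continuous_on_subset[OF duh_cont[OF h]]) auto
    show "(duh l h has_real_derivative - l * duh l h s + h s) (at s)" if "0 < s" for s
      by (rule duh_deriv[OF h that])
  qed (use t K le l in auto)
  then show ?thesis by simp
qed

lemma duh_diff:
  assumes h: "continuous_on {0..} h" and h': "continuous_on {0..} h'" and t: "0 \<le> t"
  shows "duh l h t - duh l h' t = duh l (\<lambda>s. h s - h' s) t"
proof -
  have "integral {0..t} (\<lambda>s. exp (l * s) * h s - exp (l * s) * h' s)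
     = integral {0..t} (\<lambda>s. exp (l * s) * h s) - integral {0..t} (\<lambda>s. exp (l * s) * h' s)"
    by (intro integral_diff integrable_continuous_real continuous_intros
        continuous_on_subset[OF h] continuous_on_subset[OF h']) auto
  then show ?thesis by (simp add: duh_def right_diff_distrib)
qed

text \<open>Uniform continuity on a compact strip makes u(.,t) continuous in t for the sup norm, in
  which P is Lipschitz.\<close>

lemma functional_cont:
  fixes u :: "real \<Rightarrow> real \<Rightarrow> real" and P :: "(real \<Rightarrow> real) \<Rightarrow> real"
  assumes u: "continuous_on ({0..1} \<times> {0..}) (\<lambda>(x,t). u x t)" and L: "0 < L"
    and lip: "\<And>v z e. continuous_on {0..1} v \<Longrightarrow> continuous_on {0..1} z \<Longrightarrow>
        (\<And>x. x \<in> {0..1} \<Longrightarrow> \<bar>v x - z x\<bar> \<le> e) \<Longrightarrow> \<bar>P v - P z\<bar> \<le> L * e"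
  shows "continuous_on {0..} (\<lambda>t. P (\<lambda>x. u x t))"
  unfolding continuous_on_iff
proof (intro ballI allI impI)
  fix t0 e :: real assume t0: "t0 \<in> {0..}" and e: "0 < e"
  have "uniformly_continuous_on ({0..1} \<times> {0..t0+1}) (\<lambda>(x,t). u x t)"
    by (intro compact_uniformly_continuous compact_Times compact_Icc continuous_on_subset[OF u]) auto
  then obtain d where d: "0 < d" and dd: "\<And>p p'. p \<in> {0..1} \<times> {0..t0+1} \<Longrightarrow> p' \<in> {0..1} \<times> {0..t0+1} \<Longrightarrow>
      dist p' p < d \<Longrightarrow> dist ((\<lambda>(x,t). u x t) p') ((\<lambda>(x,t). u x t) p) < e / (2 * L)"
    unfolding uniformly_continuous_on_def using e L by (metis divide_pos_pos mult_pos_pos zero_less_numeral)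
  have sl: "continuous_on {0..1} (\<lambda>x. u x t)" if "t \<ge> 0" for t
    using continuous_on_slice[OF u] that by auto
  show "\<exists>d>0. \<forall>t\<in>{0..}. dist t t0 < d \<longrightarrow> dist (P (\<lambda>x. u x t)) (P (\<lambda>x. u x t0)) < e"
  proof (intro exI[of _ "min d 1"] conjI ballI impI)
    fix t assume t: "t \<in> {0..}" "dist t t0 < min d 1"
    have "\<bar>P (\<lambda>x. u x t) - P (\<lambda>x. u x t0)\<bar> \<le> L * (e / (2 * L))"
    proof (rule lip)
      fix x :: real assume "x \<in> {0..1}"
      moreover have "t \<le> t0 + 1" using t by (auto simp: dist_real_def)
      ultimately show "\<bar>u x t - u x t0\<bar> \<le> e / (2 * L)"
        using dd[of "(x, t0)" "(x, t)"] t t0 by (auto simp: dist_real_def dist_Pair_Pair)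
    qed (use sl t t0 in auto)
    also have "\<dots> < e" using L e by simp
    finally show "dist (P (\<lambda>x. u x t)) (P (\<lambda>x. u x t0)) < e" by (simp add: dist_real_def)
  qed (use d in simp)
qed

text \<open>A tail of the series of 1 / (pi k)^2 is small independently of M, and the other n terms
  are at most n / M. The extra 1 / M is the share of U, whose rate is 0.\<close>

lemma resolvent_sum_small:
  assumes "0 < (\<eta>::real)"
  obtains M where "1 \<le> M" "summable (\<lambda>k. 1 / ((pi * real k)\<^sup>2 + M))" "(\<Sum>k. 1 / ((pi * real k)\<^sup>2 + M)) + 1 / M \<le> \<eta>"
proof -
  obtain n where n: "norm (\<Sum>i. 1 / (pi * real (i + n))\<^sup>2) < \<eta> / 2" and n1: "1 \<le> n"
    using suminf_exist_split[OF _ summable_inverse_pi_squares, of "\<eta> / 2"] assms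
    by (metis half_gt_zero linear)
  define M where "M = max 1 (real (n + 1) / (\<eta> / 2))"
  have M1: "1 \<le> M" by (simp add: M_def)
  have "real (n + 1) / (\<eta> / 2) \<le> M" by (simp add: M_def)
  then have Mn: "real (n + 1) / M \<le> \<eta> / 2" using assms M1 by (simp add: field_simps)
  have le1: "1 / ((pi * real k)\<^sup>2 + M) \<le> 1 / (pi * real k)\<^sup>2" if "k \<ge> 1" for k
    using that M1 by (intro divide_left_mono mult_pos_pos add_pos_pos) auto
  have le2: "1 / ((pi * real k)\<^sup>2 + M) \<le> 1 / M" for k
    using M1 by (intro divide_left_mono mult_pos_pos add_nonneg_pos) auto
  have s: "summable (\<lambda>k. 1 / ((pi * real k)\<^sup>2 + M))"
    by (rule summable_comparison_test_ev[OF _ summable_inverse_pi_squares])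
      (use le1 M1 in \<open>auto intro!: eventually_sequentiallyI[of 1]\<close>)
  have "(\<Sum>k. 1 / ((pi * real k)\<^sup>2 + M)) = (\<Sum>k. 1 / ((pi * real (k + n))\<^sup>2 + M)) + (\<Sum>k<n. 1 / ((pi * real k)\<^sup>2 + M))"
    by (rule suminf_split_initial_segment[OF s])
  also have "(\<Sum>k. 1 / ((pi * real (k + n))\<^sup>2 + M)) \<le> (\<Sum>k. 1 / (pi * real (k + n))\<^sup>2)"
    by (rule suminf_le[OF le1 summable_ignore_initial_segment[OF s] summable_ignore_initial_segment[OF summable_inverse_pi_squares]])
      (use n1 in simp)
  also have "\<dots> \<le> \<eta> / 2" using n by simp
  also have "(\<Sum>k<n. 1 / ((pi * real k)\<^sup>2 + M)) \<le> (\<Sum>k<n. 1 / M)" by (intro sum_mono le2)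
  also have "\<eta> / 2 + (\<Sum>k<n. 1 / M) = \<eta> / 2 + (real (n + 1) / M - 1 / M)"
    by (simp add: add_divide_distrib)
  finally have "(\<Sum>k. 1 / ((pi * real k)\<^sup>2 + M)) + 1 / M \<le> \<eta>" using Mn by linarith
  then show ?thesis using that M1 s by blast
qed

text \<open>P and g stand for the forcing of U and of the modes of w. Absolute summability of the
  initial coefficients makes the sine series converge uniformly down to t = 0.\<close>

locale mild_data =
  fixes P :: "(real \<Rightarrow> real) \<Rightarrow> real" and g :: "nat \<Rightarrow> (real \<Rightarrow> real) \<Rightarrow> real"
    and L :: real and a0 :: "nat \<Rightarrow> real" and U0 :: real
  assumes L: "0 < L"
    and lipP: "\<And>v z e. continuous_on {0..1} v \<Longrightarrow> continuous_on {0..1} z \<Longrightarrow>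
        (\<And>x. x \<in> {0..1} \<Longrightarrow> \<bar>v x - z x\<bar> \<le> e) \<Longrightarrow> \<bar>P v - P z\<bar> \<le> L * e"
    and lipg: "\<And>k v z e. continuous_on {0..1} v \<Longrightarrow> continuous_on {0..1} z \<Longrightarrow>
        (\<And>x. x \<in> {0..1} \<Longrightarrow> \<bar>v x - z x\<bar> \<le> e) \<Longrightarrow> \<bar>g k v - g k z\<bar> \<le> L * e"
    and P0: "P (\<lambda>x. 0) = 0" and g0: "\<And>k. g k (\<lambda>x. 0) = 0"
    and a0: "summable (\<lambda>k. \<bar>a0 k\<bar>)"
begin

definition A :: "(real \<Rightarrow> real \<Rightarrow> real) \<Rightarrow> nat \<Rightarrow> real \<Rightarrow> real" where
  "A u k t = exp (- (pi * real k)\<^sup>2 * t) * a0 k + duh ((pi * real k)\<^sup>2) (\<lambda>s. g k (\<lambda>x. u x s)) t"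

definition U :: "(real \<Rightarrow> real \<Rightarrow> real) \<Rightarrow> real \<Rightarrow> real" where
  "U u t = U0 + duh 0 (\<lambda>s. P (\<lambda>x. u x s)) t"

text \<open>Contraction in the norm sup exp (- M t) |u(x,t)|: the modes contribute L times the sum
  of 1 / ((pi k)^2 + M) and U contributes L / M, and M is chosen to make the total at most 1/2. The
  Lipschitz bounds being global, existence is global in time.\<close>

lemma mild_exists:
  obtains u where "continuous_on ({0..1} \<times> {0..}) (\<lambda>(x,t). u x t)"
    "\<And>x t. x \<in> {0..1} \<Longrightarrow> t \<ge> 0 \<Longrightarrow> u x t = (\<Sum>k. A u k t * phi k x) + x * U u t"
proof -
  obtain M where M1: "1 \<le> M" and Ms: "summable (\<lambda>k. 1 / ((pi * real k)\<^sup>2 + M))"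
    and Mle: "(\<Sum>k. 1 / ((pi * real k)\<^sup>2 + M)) + 1 / M \<le> 1 / (2 * L)"
    using resolvent_sum_small[of "1 / (2 * L)"] L by auto
  \<comment> \<open>Clamping x to [0,1] and t to nonnegative values extends the functions to the
    whole plane, so that the complete space of bounded continuous functions on a type can be
    used.\<close>
  define X where "X p = max 0 (min 1 (fst p))" for p :: "real \<times> real"
  define T where "T p = max 0 (snd p)" for p :: "real \<times> real"
  have Xc: "continuous_on S X" and Tc: "continuous_on S T" for S
    unfolding X_def T_def by (intro continuous_intros)+
  have X01: "X p \<in> {0..1}" and T0: "T p \<ge> 0" for p by (auto simp: X_def T_def)
  define w where "w v x t = exp (M * t) * apply_bcontfun v (x, t)" for v :: "(real \<times> real) \<Rightarrow>\<^sub>C real" and x t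
  have wc: "continuous_on S (\<lambda>(x,t). w v x t)" for v S
    unfolding w_def case_prod_unfold prod.collapse by (intro continuous_intros continuous_on_apply_bcontfun)
  have wsl: "continuous_on {0..1} (\<lambda>x. w v x t)" for v t
    using continuous_on_slice[OF wc[of "{0..1} \<times> UNIV" v], of t] by simp
  have wdist: "\<bar>w v x t - w v' x t\<bar> \<le> exp (M * t) * dist v v'" for v v' x t
  proof -
    have "\<bar>w v x t - w v' x t\<bar> = exp (M * t) * dist (apply_bcontfun v (x,t)) (apply_bcontfun v' (x,t))"
      by (simp add: w_def dist_real_def abs_mult right_diff_distrib[symmetric])
    then show ?thesis using dist_bounded[of v "(x,t)" v'] by simp
  qed
  have w0: "w 0 x t = 0" for x t by (simp add: w_def)
  define h where "h v k s = g k (\<lambda>x. w v x s)" for v k s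
  define p where "p v s = P (\<lambda>x. w v x s)" for v s
  have hc: "continuous_on {0..} (h v k)" for v k
    unfolding h_def by (rule functional_cont[OF wc L lipg])
  have pc: "continuous_on {0..} (p v)" for v
    unfolding p_def by (rule functional_cont[OF wc L lipP])
  have hd: "\<bar>h v k s - h v' k s\<bar> \<le> (L * dist v v') * exp (M * s)" for v v' k s
    unfolding h_def using lipg[OF wsl wsl wdist, of k v s v'] by (simp add: mult_ac)
  have pd: "\<bar>p v s - p v' s\<bar> \<le> (L * dist v v') * exp (M * s)" for v v' s
    unfolding p_def using lipP[OF wsl wsl wdist, of v s v'] by (simp add: mult_ac)
  have h0: "h 0 k s = 0" "p 0 s = 0" for k s by (simp_all add: h_def p_def w0 g0 P0)
  have lM: "(pi * real k)\<^sup>2 + M > 0" for k using M1 by (simp add: add_nonneg_pos)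
  have dh: "\<bar>duh ((pi * real k)\<^sup>2) (h v k) t - duh ((pi * real k)\<^sup>2) (h v' k) t\<bar> \<le> (L * dist v v') / ((pi * real k)\<^sup>2 + M) * exp (M * t)"
    if "t \<ge> 0" for v v' k t
    unfolding duh_diff[OF hc hc that]
    by (rule duh_bound[OF _ that _ hd lM]) (use L in \<open>auto intro!: continuous_intros hc\<close>)
  have dp: "\<bar>duh 0 (p v) t - duh 0 (p v') t\<bar> \<le> (L * dist v v') / M * exp (M * t)" if "t \<ge> 0" for v v' t
  proof -
    have "\<bar>duh 0 (\<lambda>s. p v s - p v' s) t\<bar> \<le> (L * dist v v') / (0 + M) * exp (M * t)"
      by (rule duh_bound[OF _ that _ pd]) (use L M1 in \<open>auto intro!: continuous_intros pc\<close>)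
    then show ?thesis by (simp add: duh_diff[OF pc pc that])
  qed
  define B where "B v k t = exp (- (pi * real k)\<^sup>2 * t) * a0 k + duh ((pi * real k)\<^sup>2) (h v k) t" for v k t
  define f where "f v k q = exp (- M * T q) * (B v k (T q) * phi k (X q))" for v k q
  define r where "r v q = exp (- M * T q) * (X q * (U0 + duh 0 (p v) (T q)))" for v q
  have eM: "exp (- M * t) * exp (M * t) = 1" for t by (simp add: exp_minus)
  have Bc: "continuous_on {0..} (B v k)" for v k
    unfolding B_def by (intro continuous_intros duh_cont hc)
  have fc: "continuous_on UNIV (f v k)" for v k
    unfolding f_def
    by (intro continuous_intros Tc continuous_on_compose2[OF Bc Tc] continuous_on_compose2[OF phi_cont[of UNIV] Xc])
      (auto simp: T0)
  have rc: "continuous_on UNIV (r v)" for v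
    unfolding r_def
    by (intro continuous_intros Tc Xc continuous_on_compose2[OF duh_cont[OF pc] Tc]) (auto simp: T0)
  have Bb: "exp (- M * t) * \<bar>B v k t\<bar> \<le> \<bar>a0 k\<bar> + (L * norm v) * (1 / ((pi * real k)\<^sup>2 + M))" if "t \<ge> 0" for v k t
  proof -
    have "\<bar>B v k t\<bar> \<le> 1 * \<bar>a0 k\<bar> + (L * norm v) / ((pi * real k)\<^sup>2 + M) * exp (M * t)"
      unfolding B_def
    proof (rule order_trans[OF abs_triangle_ineq add_mono])
      show "\<bar>exp (- (pi * real k)\<^sup>2 * t) * a0 k\<bar> \<le> 1 * \<bar>a0 k\<bar>"
        unfolding abs_mult using that by (intro mult_right_mono) auto
      show "\<bar>duh ((pi * real k)\<^sup>2) (h v k) t\<bar> \<le> (L * norm v) / ((pi * real k)\<^sup>2 + M) * exp (M * t)"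
        using dh[OF that, of k v 0] by (simp add: h0(1)[abs_def] duh_zero)
    qed
    then have "exp (- M * t) * \<bar>B v k t\<bar> \<le> exp (- M * t) * (1 * \<bar>a0 k\<bar> + (L * norm v) / ((pi * real k)\<^sup>2 + M) * exp (M * t))"
      by (intro mult_left_mono) auto
    also have "\<dots> = exp (- M * t) * \<bar>a0 k\<bar> + (L * norm v) / ((pi * real k)\<^sup>2 + M) * (exp (- M * t) * exp (M * t))"
      by (simp only: distrib_left mult_1_left mult.left_commute)
    also have "\<dots> \<le> 1 * \<bar>a0 k\<bar> + (L * norm v) / ((pi * real k)\<^sup>2 + M) * 1"
      unfolding eM using that M1 by (intro add_mono mult_right_mono) auto
    finally show ?thesis by simp
  qed
  have fb: "norm (f v k q) \<le> \<bar>a0 k\<bar> + (L * norm v) * (1 / ((pi * real k)\<^sup>2 + M))" for v k q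
  proof -
    have "norm (f v k q) = exp (- M * T q) * \<bar>B v k (T q)\<bar> * \<bar>phi k (X q)\<bar>" by (simp add: f_def abs_mult)
    also have "\<dots> \<le> exp (- M * T q) * \<bar>B v k (T q)\<bar> * 1" by (intro mult_left_mono) auto
    finally show ?thesis using Bb[OF T0[of q], of v k] by simp
  qed
  have bs: "summable (\<lambda>k. \<bar>a0 k\<bar> + (L * norm v) * (1 / ((pi * real k)\<^sup>2 + M)))" for v :: "(real \<times> real) \<Rightarrow>\<^sub>C real"
    by (intro summable_add a0 summable_mult Ms)
  have fs2: "summable (\<lambda>k. norm (f v k q))" for v q
    by (rule summable_comparison_test'[OF bs]) (use fb[of v _ q] in simp)
  note fs = summable_norm_cancel[OF fs2] fs2
  define \<Theta> where "\<Theta> v q = (\<Sum>k. f v k q) + r v q" for v q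
  have \<Theta>: "\<Theta> v \<in> bcontfun" for v
    unfolding bcontfun_def
  proof (intro CollectI conjI)
    have "continuous_on UNIV (\<lambda>q. \<Sum>k. f v k q)"
    proof (rule uniform_limit_theorem)
      show "uniform_limit UNIV (\<lambda>n q. \<Sum>k<n. f v k q) (\<lambda>q. \<Sum>k. f v k q) sequentially"
        by (rule Weierstrass_m_test[OF fb bs])
    qed (auto intro!: always_eventually continuous_intros fc)
    then show "continuous_on UNIV (\<Theta> v)" unfolding \<Theta>_def by (intro continuous_intros rc)
    have rb: "\<bar>r v q\<bar> \<le> \<bar>U0\<bar> + L * norm v / M" for q
    proof -
      have t: "T q \<ge> 0" by (rule T0)
      have "\<bar>duh 0 (p v) (T q)\<bar> \<le> L * norm v / M * exp (M * T q)"
        using dp[OF t, of v 0] by (simp add: h0(2)[abs_def] duh_zero)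
      then have "\<bar>U0 + duh 0 (p v) (T q)\<bar> \<le> \<bar>U0\<bar> + L * norm v / M * exp (M * T q)" by linarith
      then have "\<bar>X q\<bar> * \<bar>U0 + duh 0 (p v) (T q)\<bar> \<le> 1 * (\<bar>U0\<bar> + L * norm v / M * exp (M * T q))"
        using X01[of q] by (intro mult_mono) auto
      then have "exp (- M * T q) * (\<bar>X q\<bar> * \<bar>U0 + duh 0 (p v) (T q)\<bar>) \<le> exp (- M * T q) * (1 * (\<bar>U0\<bar> + L * norm v / M * exp (M * T q)))"
        by (intro mult_left_mono) auto
      also have "\<dots> = exp (- M * T q) * \<bar>U0\<bar> + L * norm v / M * (exp (- M * T q) * exp (M * T q))"
        by (simp only: distrib_left mult_1_left mult.left_commute)
      also have "\<dots> \<le> 1 * \<bar>U0\<bar> + L * norm v / M * 1"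
        unfolding eM using t M1 by (intro add_mono mult_right_mono) auto
      finally show ?thesis by (simp add: r_def abs_mult)
    qed
    show "bounded (range (\<Theta> v))"
      unfolding bounded_iff
    proof (intro exI ballI)
      fix z assume "z \<in> range (\<Theta> v)"
      then obtain q where z: "z = \<Theta> v q" by auto
      have "norm (\<Sum>k. f v k q) \<le> (\<Sum>k. \<bar>a0 k\<bar> + (L * norm v) * (1 / ((pi * real k)\<^sup>2 + M)))"
        by (rule order_trans[OF summable_norm[OF fs(2)] suminf_le[OF fb fs(2) bs]])
      then show "norm z \<le> (\<Sum>k. \<bar>a0 k\<bar> + (L * norm v) * (1 / ((pi * real k)\<^sup>2 + M))) + (\<bar>U0\<bar> + L * norm v / M)"
        unfolding z \<Theta>_def using norm_triangle_ineq[of "\<Sum>k. f v k q" "r v q"] rb[of q] by simp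
    qed
  qed
  define \<Psi> where "\<Psi> v = Bcontfun (\<Theta> v)" for v
  have \<Psi>: "apply_bcontfun (\<Psi> v) q = \<Theta> v q" for v q
    unfolding \<Psi>_def by (simp add: Bcontfun_inverse[OF \<Theta>])
  have "\<exists>!v. \<Psi> v = v"
  proof (rule banach_fix_type[where c = "1/2"])
    show "\<forall>v v'. dist (\<Psi> v) (\<Psi> v') \<le> 1 / 2 * dist v v'"
    proof (intro allI dist_bound)
      fix v v' :: "(real \<times> real) \<Rightarrow>\<^sub>C real" and q
      let ?d = "L * dist v v'"
      have t: "T q \<ge> 0" by (rule T0)
      have 1: "norm (f v k q - f v' k q) \<le> ?d * (1 / ((pi * real k)\<^sup>2 + M))" for k
      proof -
        have "f v k q - f v' k q = exp (- M * T q) * (duh ((pi * real k)\<^sup>2) (h v k) (T q) - duh ((pi * real k)\<^sup>2) (h v' k) (T q)) * phi k (X q)"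
          by (simp add: f_def B_def algebra_simps)
        then have "norm (f v k q - f v' k q) = exp (- M * T q) * \<bar>duh ((pi * real k)\<^sup>2) (h v k) (T q) - duh ((pi * real k)\<^sup>2) (h v' k) (T q)\<bar> * \<bar>phi k (X q)\<bar>"
          by (simp add: abs_mult)
        also have "\<dots> \<le> exp (- M * T q) * (?d / ((pi * real k)\<^sup>2 + M) * exp (M * T q)) * 1"
          using dh[OF t, of k v v'] L lM[of k] by (intro mult_mono) auto
        also have "\<dots> = ?d * (1 / ((pi * real k)\<^sup>2 + M)) * (exp (- M * T q) * exp (M * T q))" by simp
        finally show ?thesis unfolding eM by simp
      qed
      have s1: "summable (\<lambda>k. ?d * (1 / ((pi * real k)\<^sup>2 + M)))" by (intro summable_mult Ms)
      have s2: "summable (\<lambda>k. norm (f v k q - f v' k q))"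
        by (rule summable_comparison_test'[OF s1]) (use 1 in simp)
      have "norm ((\<Sum>k. f v k q) - (\<Sum>k. f v' k q)) = norm (\<Sum>k. f v k q - f v' k q)"
        by (simp add: suminf_diff fs(1))
      also have "\<dots> \<le> (\<Sum>k. ?d * (1 / ((pi * real k)\<^sup>2 + M)))"
        by (rule order_trans[OF summable_norm[OF s2] suminf_le[OF 1 s2 s1]])
      also have "\<dots> = ?d * (\<Sum>k. 1 / ((pi * real k)\<^sup>2 + M))" by (rule suminf_mult[OF Ms])
      finally have 2: "norm ((\<Sum>k. f v k q) - (\<Sum>k. f v' k q)) \<le> ?d * (\<Sum>k. 1 / ((pi * real k)\<^sup>2 + M))" .
      have 3: "norm (r v q - r v' q) \<le> ?d * (1 / M)"
      proof -
        have "r v q - r v' q = exp (- M * T q) * (X q * (duh 0 (p v) (T q) - duh 0 (p v') (T q)))"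
          by (simp add: r_def algebra_simps)
        then have "norm (r v q - r v' q) = exp (- M * T q) * (\<bar>X q\<bar> * \<bar>duh 0 (p v) (T q) - duh 0 (p v') (T q)\<bar>)"
          by (simp add: abs_mult)
        also have "\<dots> \<le> exp (- M * T q) * (1 * (?d / M * exp (M * T q)))"
          using dp[OF t, of v v'] X01[of q] by (intro mult_left_mono mult_mono) auto
        also have "\<dots> = ?d * (1 / M) * (exp (- M * T q) * exp (M * T q))" by simp
        finally show ?thesis unfolding eM by simp
      qed
      have "dist (apply_bcontfun (\<Psi> v) q) (apply_bcontfun (\<Psi> v') q)
          = norm (((\<Sum>k. f v k q) - (\<Sum>k. f v' k q)) + (r v q - r v' q))"
        unfolding \<Psi> \<Theta>_def dist_norm by (simp add: algebra_simps)
      also have "\<dots> \<le> ?d * (\<Sum>k. 1 / ((pi * real k)\<^sup>2 + M)) + ?d * (1 / M)"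
        by (rule order_trans[OF norm_triangle_ineq add_mono[OF 2 3]])
      also have "\<dots> = ?d * ((\<Sum>k. 1 / ((pi * real k)\<^sup>2 + M)) + 1 / M)" by (simp only: distrib_left)
      also have "\<dots> \<le> ?d * (1 / (2 * L))" using L by (intro mult_left_mono Mle) auto
      also have "\<dots> = 1 / 2 * dist v v'" using L by simp
      finally show "dist (apply_bcontfun (\<Psi> v) q) (apply_bcontfun (\<Psi> v') q) \<le> 1 / 2 * dist v v'" .
    qed
  qed auto
  then obtain v where v: "\<Psi> v = v" by blast
  show ?thesis
  proof (rule that[of "w v"])
    show "continuous_on ({0..1} \<times> {0..}) (\<lambda>(x,t). w v x t)" by (rule wc)
    fix x t :: real assume x: "x \<in> {0..1}" and t: "t \<ge> 0"
    have XT: "X (x,t) = x" "T (x,t) = t" using x t by (auto simp: X_def T_def)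
    have AB: "A (w v) k t = B v k t" for k
      by (simp add: A_def B_def h_def[abs_def])
    have UB: "U (w v) t = U0 + duh 0 (p v) t" by (simp add: U_def p_def[abs_def])
    have eM': "exp (M * t) * (exp (- M * t) * z) = z" for z by (simp add: exp_minus)
    have fB: "exp (M * t) * f v k (x,t) = A (w v) k t * phi k x" for k
      unfolding f_def XT AB by (rule eM')
    have "w v x t = exp (M * t) * \<Theta> v (x,t)" using v \<Psi>[of v "(x,t)"] by (simp add: w_def)
    also have "\<dots> = (\<Sum>k. exp (M * t) * f v k (x,t)) + exp (M * t) * r v (x,t)"
      unfolding \<Theta>_def distrib_left by (simp add: suminf_mult[OF fs(1)])
    also have "exp (M * t) * r v (x,t) = x * U (w v) t" unfolding r_def XT UB by (rule eM')
    finally show "w v x t = (\<Sum>k. A (w v) k t * phi k x) + x * U (w v) t" by (simp only: fB)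
  qed
qed

end

section \<open>The truncated nonlinearity\<close>


lemma abs_xc_le_1: "\<bar>xc k\<bar> \<le> 1"
proof (cases "k = 0")
  case False
  have "1 \<le> pi * real k" using False pi_ge_two mult_mono[of 1 pi 1 "real k"] by simp
  then have "1 / (pi * real k) \<le> 1" by simp
  then show ?thesis using abs_xc_le[of k] by linarith
qed (simp add: xc_def)

lemma clip_lipschitz: "\<bar>max 0 (min 1 (2 - p)) - max 0 (min 1 (2 - q))\<bar> \<le> \<bar>p - (q::real)\<bar>"
  by (auto simp: max_def min_def)

definition sq :: "nat \<Rightarrow> (real \<Rightarrow> real) \<Rightarrow> real" where "sq k v = L2_inner (\<lambda>x. v x * v x) (phi k)"

lemma sq_diff_le:
  assumes v: "continuous_on {0..1} v" and z: "continuous_on {0..1} z"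
  shows "\<bar>sq k v - sq k z\<bar> \<le> L2_norm (\<lambda>x. v x - z x) * (L2_norm v + L2_norm z)"
proof -
  have "sq k v - sq k z = L2_inner (\<lambda>x. v x * v x - z x * z x) (phi k)"
    unfolding sq_def by (rule L2_inner_diff_left[symmetric]) (auto intro!: L2_fun_cont continuous_intros v z)
  also have "\<dots> = L2_inner (\<lambda>x. (v x - z x) * (v x + z x)) (phi k)"
    by (simp add: algebra_simps)
  also have "\<bar>\<dots>\<bar> \<le> L2_norm (\<lambda>x. v x - z x) * L2_norm (\<lambda>x. v x + z x)"
    by (intro abs_inner_sq_le continuous_intros v z)
  also have "\<dots> \<le> L2_norm (\<lambda>x. v x - z x) * (L2_norm v + L2_norm z)"
    by (intro mult_left_mono L2_norm_add_le L2_fun_cont v z) simp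
  finally show ?thesis .
qed

context fisher
begin

text \<open>Truncating the nonlinearity outside the unit ball of \<open>L\<^sup>2\<close> makes it globally Lipschitz from \<open>L\<^sup>2\<close>
  to \<open>L\<^sup>1\<close>; the decay estimate shows afterwards that small solutions never see the truncation.\<close>

definition bc :: "(real \<Rightarrow> real) \<Rightarrow> real" where "bc v = \<beta> * max 0 (min 1 (2 - L2_norm v))"

lemma bc_range: "0 \<le> bc v" "bc v \<le> \<beta>"
proof -
  have "\<beta> * max 0 (min 1 (2 - L2_norm v)) \<le> \<beta> * 1" using pos by (intro mult_left_mono) auto
  then show "bc v \<le> \<beta>" by (simp add: bc_def)
  show "0 \<le> bc v" unfolding bc_def using pos by (intro mult_nonneg_nonneg) auto
qed

lemma bc_one: "L2_norm v \<le> 1 \<Longrightarrow> bc v = \<beta>" by (simp add: bc_def)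

lemma bc_zero: "L2_norm v \<ge> 2 \<Longrightarrow> bc v = 0" by (simp add: bc_def)

lemma bc_lip:
  assumes v: "continuous_on {0..1} v" and z: "continuous_on {0..1} z"
  shows "\<bar>bc v - bc z\<bar> \<le> \<beta> * L2_norm (\<lambda>x. v x - z x)"
proof -
  have "\<bar>bc v - bc z\<bar> = \<beta> * \<bar>max 0 (min 1 (2 - L2_norm v)) - max 0 (min 1 (2 - L2_norm z))\<bar>"
    using pos by (simp add: bc_def right_diff_distrib[symmetric] abs_mult del: max_def min_def)
  also have "\<dots> \<le> \<beta> * \<bar>L2_norm v - L2_norm z\<bar>"
    using pos by (intro mult_left_mono clip_lipschitz) auto
  also have "\<dots> \<le> \<beta> * L2_norm (\<lambda>x. v x - z x)"
    using pos by (intro mult_left_mono L2_norm_triangle_diff L2_fun_cont v z) auto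
  finally show ?thesis .
qed

text \<open>The ordering ensures that \<open>sq k\<close> is estimated only where it is bounded: if
  the smaller norm exceeds 2 both terms vanish, otherwise |sq k v| <= 4; and \<open>bc z\<close> is
  nonzero only if z has norm below 2 as well. The two contributions 4 + 4 give the constant
  8.\<close>

lemma bc_sq_lip_ordered:
  assumes v: "continuous_on {0..1} v" and z: "continuous_on {0..1} z" and le: "L2_norm v \<le> L2_norm z"
  shows "\<bar>bc v * sq k v - bc z * sq k z\<bar> \<le> 8 * \<beta> * L2_norm (\<lambda>x. v x - z x)"
proof (cases "L2_norm v \<le> 2")
  case False
  then have "bc v = 0" "bc z = 0" using le by (auto intro: bc_zero)
  then show ?thesis using pos by simp
next
  case True
  define d where "d = L2_norm (\<lambda>x. v x - z x)"
  have d: "0 \<le> d" by (simp add: d_def)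
  have "\<bar>sq k v\<bar> \<le> L2_norm v * L2_norm v" unfolding sq_def by (rule abs_inner_sq_le[OF v v])
  also have "\<dots> \<le> 2 * 2" by (intro mult_mono True) auto
  finally have 1: "\<bar>bc v - bc z\<bar> * \<bar>sq k v\<bar> \<le> (\<beta> * d) * 4"
    using bc_lip[OF v z] pos d by (intro mult_mono) (auto simp: d_def)
  have 2: "\<bar>bc z\<bar> * \<bar>sq k v - sq k z\<bar> \<le> \<beta> * (d * 4)"
  proof (cases "L2_norm z \<le> 2")
    case z2: True
    have "\<bar>sq k v - sq k z\<bar> \<le> d * (L2_norm v + L2_norm z)" unfolding d_def by (rule sq_diff_le[OF v z])
    also have "\<dots> \<le> d * 4" using True z2 d by (intro mult_left_mono) auto
    finally show ?thesis using bc_range[of z] pos by (intro mult_mono) auto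
  next
    case False
    then have "bc z = 0" by (intro bc_zero) auto
    then show ?thesis using pos d by simp
  qed
  have eq: "bc v * sq k v - bc z * sq k z = (bc v - bc z) * sq k v + bc z * (sq k v - sq k z)"
    by (simp add: algebra_simps)
  have "\<bar>(bc v - bc z) * sq k v + bc z * (sq k v - sq k z)\<bar> \<le> \<bar>bc v - bc z\<bar> * \<bar>sq k v\<bar> + \<bar>bc z\<bar> * \<bar>sq k v - sq k z\<bar>"
    unfolding abs_mult[symmetric] by (rule abs_triangle_ineq)
  also have "\<dots> \<le> \<beta> * d * 4 + \<beta> * (d * 4)" by (rule add_mono[OF 1 2])
  also have "\<dots> = 8 * \<beta> * d" by simp
  finally show ?thesis unfolding eq d_def .
qed

lemma bc_sq_lip:
  assumes v: "continuous_on {0..1} v" and z: "continuous_on {0..1} z"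
  shows "\<bar>bc v * sq k v - bc z * sq k z\<bar> \<le> 8 * \<beta> * L2_norm (\<lambda>x. v x - z x)"
proof (cases "L2_norm v \<le> L2_norm z")
  case True
  then show ?thesis by (rule bc_sq_lip_ordered[OF v z])
next
  case False
  then have "\<bar>bc z * sq k z - bc v * sq k v\<bar> \<le> 8 * \<beta> * L2_norm (\<lambda>x. z x - v x)"
    by (intro bc_sq_lip_ordered z v) auto
  then show ?thesis by (simp add: abs_minus_commute L2_norm_diff_commute[of v z])
qed

definition cj :: "nat \<Rightarrow> real" where "cj j = (\<Sum>k\<in>{1..N}. c k j)"

lemma Ffb_cj: "Ffb \<alpha> N \<gamma> v = (\<Sum>j\<in>{1..N}. cj j * L2_inner v (phi j))"
  unfolding Ffb_eq cj_def sum_distrib_right by (rule sum.swap)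

text \<open>The time derivative of F(u) that the truncated equation prescribes in the state v, with
  \<open>v 1\<close> as boundary value. Its time integral defines U.\<close>

definition Phi :: "(real \<Rightarrow> real) \<Rightarrow> real" where
  "Phi v = (\<Sum>j\<in>{1..N}. cj j * (- lam \<alpha> j * L2_inner v (phi j) - dphi1 j * v 1 - bc v * sq j v))"

text \<open>Forcing of the sine coefficients of u - x U, as in \<open>a_deriv\<close> with U'
  replaced by \<open>Phi\<close>; the remaining rate is (pi k)^2.\<close>

definition gk :: "nat \<Rightarrow> (real \<Rightarrow> real) \<Rightarrow> real" where
  "gk k v = 2 * (\<alpha> * L2_inner v (phi k) - bc v * sq k v - Phi v * xc k)"

definition LP :: real where "LP = (\<Sum>j\<in>{1..N}. \<bar>cj j\<bar> * (\<bar>lam \<alpha> j\<bar> + \<bar>dphi1 j\<bar> + 8 * \<beta>))"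
definition Lc :: real where "Lc = 2 * (\<alpha> + 8 * \<beta> + LP)"

lemma LP_nonneg: "0 \<le> LP" unfolding LP_def using pos by (intro sum_nonneg mult_nonneg_nonneg) auto
lemma Lc: "0 < Lc" "LP \<le> Lc" using LP_nonneg pos by (auto simp: Lc_def)

text \<open>Only the L^2 distance and the distance at x = 1 enter, not the sup norm: these are the
  two quantities for which \<open>h_holder\<close> has Hoelder bounds in time.\<close>

context
  fixes v z :: "real \<Rightarrow> real" and e :: real
  assumes v: "continuous_on {0..1} v" and z: "continuous_on {0..1} z"
    and le: "L2_norm (\<lambda>x. v x - z x) \<le> e" and le1: "\<bar>v 1 - z 1\<bar> \<le> e"
begin

lemma coeff_lip: "\<bar>L2_inner v (phi k) - L2_inner z (phi k)\<bar> \<le> e"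
proof -
  have "L2_inner v (phi k) - L2_inner z (phi k) = L2_inner (\<lambda>x. v x - z x) (phi k)"
    by (rule L2_inner_diff_left[symmetric]) (auto intro!: L2_fun_cont v z)
  also have "\<bar>\<dots>\<bar> \<le> L2_norm (\<lambda>x. v x - z x)" by (intro abs_inner_phi_le continuous_intros v z)
  finally show ?thesis using le by simp
qed

lemma bc_sq_lip': "\<bar>bc v * sq k v - bc z * sq k z\<bar> \<le> 8 * \<beta> * e"
  by (rule order_trans[OF bc_sq_lip[OF v z] mult_left_mono[OF le]]) (use pos in simp)

lemma Phi_lip: "\<bar>Phi v - Phi z\<bar> \<le> LP * e"
proof -
  have eq: "Phi v - Phi z = (\<Sum>j\<in>{1..N}. cj j * (- lam \<alpha> j * (L2_inner v (phi j) - L2_inner z (phi j))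
      - dphi1 j * (v 1 - z 1) - (bc v * sq j v - bc z * sq j z)))"
    unfolding Phi_def sum_subtractf[symmetric] by (intro sum.cong) (auto simp: algebra_simps)
  have "\<bar>Phi v - Phi z\<bar> \<le> (\<Sum>j\<in>{1..N}. \<bar>cj j\<bar> * (\<bar>lam \<alpha> j\<bar> + \<bar>dphi1 j\<bar> + 8 * \<beta>) * e)"
    unfolding eq
  proof (rule order_trans[OF sum_abs sum_mono])
    fix j
    have "\<bar>- lam \<alpha> j * (L2_inner v (phi j) - L2_inner z (phi j)) - dphi1 j * (v 1 - z 1) - (bc v * sq j v - bc z * sq j z)\<bar>
       \<le> \<bar>lam \<alpha> j * (L2_inner v (phi j) - L2_inner z (phi j))\<bar> + \<bar>dphi1 j * (v 1 - z 1)\<bar> + \<bar>bc v * sq j v - bc z * sq j z\<bar>"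
      by linarith
    also have "\<dots> \<le> \<bar>lam \<alpha> j\<bar> * e + \<bar>dphi1 j\<bar> * e + 8 * \<beta> * e"
      unfolding abs_mult[of "lam \<alpha> j"] abs_mult[of "dphi1 j"]
      by (intro add_mono mult_left_mono coeff_lip le1 bc_sq_lip') auto
    finally show "\<bar>cj j * (- lam \<alpha> j * (L2_inner v (phi j) - L2_inner z (phi j)) - dphi1 j * (v 1 - z 1) - (bc v * sq j v - bc z * sq j z))\<bar>
       \<le> \<bar>cj j\<bar> * (\<bar>lam \<alpha> j\<bar> + \<bar>dphi1 j\<bar> + 8 * \<beta>) * e"
      unfolding abs_mult[of "cj j"] mult.assoc by (intro mult_left_mono) (auto simp: algebra_simps)
  qed
  then show ?thesis unfolding LP_def sum_distrib_right .
qed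

lemma gk_lip: "\<bar>gk k v - gk k z\<bar> \<le> Lc * e"
proof -
  have e: "0 \<le> e" using le1 by simp
  have eq: "gk k v - gk k z = 2 * (\<alpha> * (L2_inner v (phi k) - L2_inner z (phi k)) - (bc v * sq k v - bc z * sq k z) - (Phi v - Phi z) * xc k)"
    by (simp add: gk_def algebra_simps)
  have "\<bar>2 * (\<alpha> * (L2_inner v (phi k) - L2_inner z (phi k)) - (bc v * sq k v - bc z * sq k z) - (Phi v - Phi z) * xc k)\<bar>
     \<le> 2 * (\<bar>\<alpha> * (L2_inner v (phi k) - L2_inner z (phi k))\<bar> + \<bar>bc v * sq k v - bc z * sq k z\<bar> + \<bar>(Phi v - Phi z) * xc k\<bar>)"
  proof -
    have tri: "\<bar>2 * (p - q - r)\<bar> \<le> 2 * (\<bar>p\<bar> + \<bar>q\<bar> + \<bar>r\<bar>)" for p q r :: real by (auto simp: abs_if)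
    show ?thesis by (rule tri)
  qed
  also have "\<dots> \<le> 2 * (\<alpha> * e + 8 * \<beta> * e + LP * e * 1)"
  proof -
    have 1: "\<bar>\<alpha> * (L2_inner v (phi k) - L2_inner z (phi k))\<bar> \<le> \<alpha> * e"
      unfolding abs_mult by (rule mult_mono[OF _ coeff_lip]) (use pos in auto)
    have 2: "\<bar>(Phi v - Phi z) * xc k\<bar> \<le> LP * e * 1"
      unfolding abs_mult by (rule mult_mono[OF Phi_lip abs_xc_le_1]) (use LP_nonneg e in auto)
    show ?thesis
      by (rule mult_left_mono[OF add_mono[OF add_mono[OF 1 bc_sq_lip'] 2]]) simp
  qed
  also have "\<dots> = Lc * e" by (simp add: Lc_def algebra_simps)
  finally show ?thesis unfolding eq .
qed

lemma Phi_lip_Lc: "\<bar>Phi v - Phi z\<bar> \<le> Lc * e"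
proof -
  have "0 \<le> e" using le1 by simp
  then show ?thesis using Phi_lip mult_right_mono[OF Lc(2), of e] by linarith
qed

end

lemma Phi_0: "Phi (\<lambda>x. 0) = 0"
  unfolding Phi_def by (intro sum.neutral) (simp add: sq_def L2_inner_def)

lemma gk_0: "gk k (\<lambda>x. 0) = 0"
  unfolding gk_def Phi_0 by (simp add: sq_def L2_inner_def)

lemma gk_index_0: "gk 0 v = 0"
  by (simp add: gk_def sq_def xc_def)

lemma sup_to_L2:
  assumes "continuous_on {0..1} v" "continuous_on {0..1} z" "\<And>x. x \<in> {0..1} \<Longrightarrow> \<bar>v x - z x\<bar> \<le> e"
  shows "L2_norm (\<lambda>x. v x - z x) \<le> e" "\<bar>v 1 - z 1\<bar> \<le> e"
proof -
  show "L2_norm (\<lambda>x. v x - z x) \<le> e"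
    by (rule L2_norm_le_sup[OF continuous_on_diff[OF assms(1,2)] assms(3)])
  show "\<bar>v 1 - z 1\<bar> \<le> e" by (rule assms(3)) simp
qed

end

section \<open>Elementary inequalities behind the time regularity\<close>

lemma summable_inverse_pi_powr:
  assumes "1 / 2 < p"
  shows "summable (\<lambda>k. (1 / (pi * real k)\<^sup>2) powr p)"
proof -
  have "summable (\<lambda>k. pi powr (- 2 * p) * (real k powr (- 2 * p)))"
    using assms by (intro summable_mult) (simp add: summable_real_powr_iff)
  moreover have "pi powr (- 2 * p) * (real k powr (- 2 * p)) = (1 / (pi * real k)\<^sup>2) powr p" for k
  proof (cases "k = 0")
    case False
    have "1 / (pi * real k)\<^sup>2 = (pi * real k) powr (- 2)"
      using False by (simp add: powr_minus powr_numeral divide_inverse)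
    then have "(1 / (pi * real k)\<^sup>2) powr p = (pi * real k) powr (- 2 * p)" by (simp add: powr_powr)
    then show ?thesis by (simp add: powr_mult)
  qed simp
  ultimately show ?thesis by (simp only:)
qed

text \<open>Interpolation between two bounds for one quantity: in \<open>h_holder\<close> these are
  a time increment and the inverse eigenvalue 1 / (pi k)^2.\<close>

lemma geo_mean_le:
  assumes "0 \<le> x" "x \<le> a" "x \<le> (b::real)"
  shows "x \<le> a powr (5/8) * b powr (3/8)"
proof (cases "x = 0")
  case False
  then have x: "0 < x" using assms by simp
  have "x = x powr (5/8 + 3/8)" using x by simp
  also have "\<dots> = x powr (5/8) * x powr (3/8)" by (rule powr_add)
  also have "\<dots> \<le> a powr (5/8) * b powr (3/8)"
    using x assms by (intro mult_mono powr_mono2) auto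
  finally show ?thesis .
qed simp

text \<open>Turns a Hoelder bound into an exponential one, the form of forcing that
  \<open>duhamel_bound\<close> accepts, at the cost of half the decay rate.\<close>

lemma powr_le_exp_half:
  assumes "0 \<le> (x::real)" shows "x powr (5/8) \<le> 2 * exp (x / 2)"
proof -
  have "x powr (5/8) \<le> 1 + x"
  proof (cases "x \<le> 1")
    case True
    then have "x powr (5/8) \<le> 1 powr (5/8)" using assms by (intro powr_mono2) auto
    then show ?thesis using assms by simp
  next
    case False
    then have "x powr (5/8) \<le> x powr 1" by (intro powr_mono) auto
    then show ?thesis using False by simp
  qed
  also have "\<dots> \<le> 2 * (1 + x / 2)" using assms by simp
  also have "\<dots> \<le> 2 * exp (x / 2)" by (intro mult_left_mono exp_ge_add_one_self) auto
  finally show ?thesis .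
qed

lemma mult_exp_minus_le:
  assumes "0 \<le> l" "0 < (t::real)" shows "l * exp (- l * t) \<le> 1 / t"
proof -
  have "l * t \<le> exp (l * t)" using exp_ge_add_one_self[of "l * t"] by linarith
  then have "l * t * exp (- (l * t)) \<le> exp (l * t) * exp (- (l * t))" by (intro mult_right_mono) auto
  also have "\<dots> = 1" by (simp add: exp_minus)
  finally show ?thesis using assms by (simp add: field_simps)
qed

text \<open>The constant is uniform in l and in s down to 0. For s <= \<tau> / 2 the increment t - s
  is at least \<tau> / 2 and the trivial bound 1 suffices; for larger s the smoothing bound l exp (-
  l s) <= 1 / s gives a Lipschitz estimate.\<close>

lemma exp_decay_diff_le:
  fixes l s t \<tau> :: real
  assumes l: "0 \<le> l" and t: "0 < \<tau>" "\<tau> \<le> t" and s: "0 \<le> s" "s \<le> t"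
  shows "\<bar>exp (- l * t) - exp (- l * s)\<bar> \<le> 2 / \<tau> * (t - s)"
proof -
  have ts: "exp (- l * t) = exp (- l * s) * exp (- l * (t - s))" by (simp add: exp_add[symmetric] algebra_simps)
  have e: "1 - exp (- l * (t - s)) \<le> l * (t - s)" using exp_ge_add_one_self[of "- l * (t - s)"] by simp
  have nn: "0 \<le> 1 - exp (- l * (t - s))" using l s by simp
  have eq: "\<bar>exp (- l * t) - exp (- l * s)\<bar> = exp (- l * s) * (1 - exp (- l * (t - s)))"
  proof -
    have "exp (- l * t) - exp (- l * s) = - (exp (- l * s) * (1 - exp (- l * (t - s))))"
      unfolding ts by (simp add: algebra_simps)
    then show ?thesis using nn by simp
  qed
  show ?thesis
  proof (cases "s \<le> \<tau> / 2")
    case True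
    have "exp (- l * s) * (1 - exp (- l * (t - s))) \<le> 1 * 1" using l s nn by (intro mult_mono) auto
    also have "1 * 1 \<le> 2 / \<tau> * (t - s)" using True t by (simp add: field_simps)
    finally show ?thesis unfolding eq .
  next
    case False
    then have s0: "0 < s" using t by simp
    have "exp (- l * s) * (1 - exp (- l * (t - s))) \<le> exp (- l * s) * (l * (t - s))"
      by (intro mult_left_mono e) auto
    also have "\<dots> = (l * exp (- l * s)) * (t - s)" by (simp add: mult_ac)
    also have "\<dots> \<le> 1 / s * (t - s)" using mult_exp_minus_le[OF l s0] s by (intro mult_right_mono) auto
    also have "\<dots> \<le> 2 / \<tau> * (t - s)"
      using False t s s0 by (intro mult_right_mono) (auto simp: field_simps)
    finally show ?thesis unfolding eq .
  qed
qed

section \<open>Regularity of mild solutions\<close>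


text \<open>The estimates degenerate as t tends to 0 and hold on strips away from it; continuity
  being local, the strips suffice.\<close>

lemma continuous_on_open_timeI:
  fixes f :: "real \<times> real \<Rightarrow> real"
  assumes "\<And>\<tau> T :: real. 0 < \<tau> \<Longrightarrow> \<tau> < T \<Longrightarrow> continuous_on (S \<times> {\<tau>..T}) f"
  shows "continuous_on (S \<times> {0<..}) f"
  unfolding continuous_on_def
proof
  fix p :: "real \<times> real" assume p: "p \<in> S \<times> {0<..}"
  define t where "t = snd p"
  have t: "0 < t" using p by (auto simp: t_def)
  have "open (UNIV \<times> {t/2<..<2*t} :: (real \<times> real) set)" by (intro open_Times) auto
  then have "at p within S \<times> {0<..} = at p within S \<times> {t/2..2*t}"
    by (rule at_within_nhd[rotated]) (use p t in \<open>auto simp: t_def\<close>)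
  then show "(f \<longlongrightarrow> f p) (at p within S \<times> {0<..})"
    using assms[of "t/2" "2*t"] p t by (auto simp: continuous_on_def t_def)
qed

text \<open>The substitution y = x s moves the variable end point into the integrand, so that
  continuity of integrals over the fixed interval [0,1] applies.\<close>

lemma continuous_on_times_fst:
  fixes f :: "real \<Rightarrow> real \<Rightarrow> real"
  assumes "continuous_on ({0..1} \<times> B) (\<lambda>(x,t). f x t)"
  shows "continuous_on ({0..1} \<times> B) (\<lambda>(x,t). integral {0..x} (\<lambda>y. f y t))"
proof -
  have eq: "integral {0..x} (\<lambda>y. f y t) = x * integral {0..1} (\<lambda>s. f (x * s) t)" if x: "x \<in> {0..1}" and t: "t \<in> B" for x t
  proof (cases "x = 0")
    case False
    then have x0: "0 < x" using x by simp
    have c: "continuous_on {0..1} (\<lambda>y. f y t)" by (rule continuous_on_slice[OF assms t])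
    have "(\<lambda>y. f y t) integrable_on {0..x}"
      by (rule integrable_continuous_real, rule continuous_on_subset[OF c]) (use x in auto)
    then have "((\<lambda>y. f y t) has_integral integral {0..x} (\<lambda>y. f y t)) (cbox 0 x)"
      using integrable_integral by auto
    from has_integral_affinity[OF this, of x 0] False
    have "((\<lambda>s. f (x * s) t) has_integral (1 / \<bar>x\<bar>) *\<^sub>R integral {0..x} (\<lambda>y. f y t)) ((\<lambda>s. (1 / x) *\<^sub>R s + - ((1 / x) *\<^sub>R 0)) ` cbox 0 x)"
      by simp
    moreover have "(\<lambda>s. (1 / x) *\<^sub>R s + - ((1 / x) *\<^sub>R 0)) ` cbox 0 x = {0..1}"
      using x0 image_mult_atLeastAtMost[of "1/x" 0 x] by simp
    ultimately have "((\<lambda>s. f (x * s) t) has_integral (1 / x) * integral {0..x} (\<lambda>y. f y t)) {0..1}"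
      using x0 by simp
    then show ?thesis using x0 by (simp add: integral_unique)
  qed simp
  have "continuous_on ({0..1} \<times> B) (\<lambda>p. integral (cbox 0 1) (\<lambda>s. f (fst p * s) (snd p)))"
  proof (rule integral_continuous_on_param)
    have "continuous_on (({0..1} \<times> B) \<times> cbox 0 1) (\<lambda>z. (\<lambda>(x,t). f x t) (fst (fst z) * snd z, snd (fst z)))"
    proof (rule continuous_on_compose2[OF assms])
      show "continuous_on (({0..1} \<times> B) \<times> cbox 0 1) (\<lambda>z::(real \<times> real) \<times> real. (fst (fst z) * snd z, snd (fst z)))"
        by (intro continuous_intros)
    qed (auto simp: mult_le_one)
    then show "continuous_on (({0..1} \<times> B) \<times> cbox 0 1) (\<lambda>(p, s). f (fst p * s) (snd p))"
      by (simp add: case_prod_unfold)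
  qed
  then have "continuous_on ({0..1} \<times> B) (\<lambda>p. fst p * integral {0..1} (\<lambda>s. f (fst p * s) (snd p)))"
    by (intro continuous_intros) simp
  then show ?thesis
    by (rule continuous_on_eq) (auto simp: eq)
qed

locale fisher_mild = fisher +
  fixes u0 g0 :: "real \<Rightarrow> real" and u :: "real \<Rightarrow> real \<Rightarrow> real" and a0 :: "nat \<Rightarrow> real"
  assumes u0: "u0 \<in> IC \<alpha> N \<gamma>" and g0: "is_weak_deriv u0 g0"
    and a0_def: "\<And>k. a0 k = 2 * L2_inner (\<lambda>x. u0 x - u0 1 * x) (phi k)"
    and uc: "continuous_on ({0..1} \<times> {0..}) (\<lambda>(x,t). u x t)"
    and mild: "\<And>x t. x \<in> {0..1} \<Longrightarrow> t \<ge> 0 \<Longrightarrow> u x t =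
       (\<Sum>k. (exp (- (pi * real k)\<^sup>2 * t) * a0 k + duh ((pi * real k)\<^sup>2) (\<lambda>s. gk k (\<lambda>x. u x s)) t) * phi k x)
       + x * (u0 1 + duh 0 (\<lambda>s. Phi (\<lambda>x. u x s)) t)"
begin

definition l :: "nat \<Rightarrow> real" where "l k = (pi * real k)\<^sup>2"
definition h where "h k s = gk k (\<lambda>x. u x s)"
definition P where "P s = Phi (\<lambda>x. u x s)"
definition A where "A k t = exp (- l k * t) * a0 k + duh (l k) (h k) t"
definition A' where "A' k t = - l k * A k t + h k t"
definition U where "U t = u0 1 + duh 0 P t"
definition w where "w t x = (\<Sum>k. A k t * phi k x)"
definition b where "b t = bc (\<lambda>x. u x t)"

lemma u_eq: "x \<in> {0..1} \<Longrightarrow> t \<ge> 0 \<Longrightarrow> u x t = w t x + x * U t"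
  using mild[of x t] by (simp add: w_def A_def U_def l_def h_def[abs_def] P_def[abs_def])

lemma l_nonneg: "0 \<le> l k" by (simp add: l_def)
lemma l_pos: "1 \<le> k \<Longrightarrow> 0 < l k" by (simp add: l_def)
lemma l_0: "l 0 = 0" by (simp add: l_def)

lemma usl: "t \<ge> 0 \<Longrightarrow> continuous_on {0..1} (\<lambda>x. u x t)"
  using continuous_on_slice[OF uc] by auto

lemma h_cont: "continuous_on {0..} (h k)"
  unfolding h_def by (rule functional_cont[OF uc Lc(1)]) (rule gk_lip, auto intro: sup_to_L2)

lemma P_cont: "continuous_on {0..} P"
  unfolding P_def by (rule functional_cont[OF uc Lc(1)]) (rule Phi_lip_Lc, auto intro: sup_to_L2)

lemma b_cont: "continuous_on {0..} b"
  unfolding b_def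
proof (rule functional_cont[OF uc pos(2)])
  fix v z :: "real \<Rightarrow> real" and e
  assume *: "continuous_on {0..1} v" "continuous_on {0..1} z" "\<And>x. x \<in> {0..1} \<Longrightarrow> \<bar>v x - z x\<bar> \<le> e"
  show "\<bar>bc v - bc z\<bar> \<le> \<beta> * e"
    by (rule order_trans[OF bc_lip[OF *(1,2)] mult_left_mono[OF sup_to_L2(1)[OF *]]]) (use pos in auto)
qed

lemma h_index_0: "h 0 s = 0" by (simp add: h_def gk_index_0)

lemma a0_0: "a0 0 = 0" by (simp add: a0_def)

lemma A_0: "A 0 t = 0" "A' 0 t = 0"
proof -
  have "h 0 = (\<lambda>s. 0)" by (auto simp: h_index_0)
  then show "A 0 t = 0" by (simp add: A_def a0_0 duh_zero)
  then show "A' 0 t = 0" by (simp add: A'_def h_index_0 l_0)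
qed

lemma A_init: "A k 0 = a0 k" by (simp add: A_def)

lemma A_cont: "continuous_on {0..} (A k)"
  unfolding A_def by (intro continuous_intros duh_cont h_cont)

lemma A'_cont: "continuous_on {0..} (A' k)"
  unfolding A'_def by (intro continuous_intros A_cont h_cont)

lemma A_deriv: "t > 0 \<Longrightarrow> (A k has_real_derivative A' k t) (at t)"
  unfolding A_def[abs_def] A'_def
  by (rule derivative_eq_intros duh_deriv[OF h_cont] refl | assumption)+ (simp add: algebra_simps)

lemma U_cont: "continuous_on {0..} U"
  unfolding U_def by (intro continuous_intros duh_cont P_cont)

lemma U_deriv: "t > 0 \<Longrightarrow> (U has_real_derivative P t) (at t)"
  unfolding U_def[abs_def] by (rule derivative_eq_intros duh_deriv[OF P_cont] refl | assumption)+ simp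

lemma w0_weak_deriv: "is_weak_deriv (\<lambda>x. u0 x - u0 1 * x) (\<lambda>x. g0 x - u0 1)"
proof -
  have "is_weak_deriv (\<lambda>x. u0 1 * x) (\<lambda>x. u0 1)"
    by (rule is_weak_derivI) (auto intro!: derivative_eq_intros)
  from is_weak_deriv_diff[OF g0 this] show ?thesis .
qed

lemma w0_ends: "u0 0 - u0 1 * 0 = 0" "u0 1 - u0 1 * 1 = 0"
  using u0 by (auto simp: IC_def)

lemmas w0_expansion = sine_expansion[OF w0_weak_deriv w0_ends, folded a0_def]

lemma a0_summable: "summable (\<lambda>k. \<bar>a0 k\<bar>)" by (rule w0_expansion(2))

lemma a0_sq_summable: "summable (\<lambda>k. (l k) * (a0 k)\<^sup>2)"
proof -
  have "summable (\<lambda>k. 2 * ((pi * real k)\<^sup>2 * (a0 k)\<^sup>2 / 2))"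
    by (intro summable_mult sums_summable[OF w0_expansion(1)])
  then show ?thesis by (simp add: l_def)
qed

lemma a0_sq_summable': "summable (\<lambda>k. (a0 k)\<^sup>2)"
proof (rule summable_comparison_test'[OF a0_sq_summable, of 1])
  fix k :: nat assume k: "1 \<le> k"
  have "4 * 1 \<le> pi\<^sup>2 * (real k)\<^sup>2" using pi_sq_ge_4 k by (intro mult_mono) auto
  then have "1 \<le> l k" by (simp add: l_def power_mult_distrib)
  then show "norm ((a0 k)\<^sup>2) \<le> l k * (a0 k)\<^sup>2" using mult_right_mono[of 1 "l k" "(a0 k)\<^sup>2"] by simp
qed

text \<open>Comparison with the zero function, where \<open>gk\<close> and \<open>Phi\<close>
  vanish, turns the Lipschitz bounds into size bounds. B >= 1 permits division by B.\<close>

lemma bounds: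
  obtains B where "1 \<le> B" "\<And>k s. 0 \<le> s \<Longrightarrow> s \<le> T \<Longrightarrow> \<bar>h k s\<bar> \<le> B" "\<And>s. 0 \<le> s \<Longrightarrow> s \<le> T \<Longrightarrow> \<bar>P s\<bar> \<le> B"
proof -
  have "compact ((\<lambda>(x,t). u x t) ` ({0..1} \<times> {0..T}))"
    by (intro compact_continuous_image compact_Times compact_Icc continuous_on_subset[OF uc]) auto
  then have "bounded ((\<lambda>(x,t). u x t) ` ({0..1} \<times> {0..T}))" by (rule compact_imp_bounded)
  then obtain C where "\<forall>z\<in>(\<lambda>(x,t). u x t) ` ({0..1} \<times> {0..T}). norm z \<le> C"
    unfolding bounded_iff by metis
  then have C: "\<bar>u x s\<bar> \<le> C" if "x \<in> {0..1}" "0 \<le> s" "s \<le> T" for x s using that by force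
  have c0: "continuous_on {0..1} (\<lambda>x::real. 0::real)" by simp
  have L2: "L2_norm (\<lambda>x. u x s - 0) \<le> C" "\<bar>u 1 s - 0\<bar> \<le> C" if "0 \<le> s" "s \<le> T" for s
    using sup_to_L2[OF usl[OF that(1)] c0, of C] C that by auto
  show ?thesis
  proof (rule that[of "max 1 (Lc * C)"])
    show "\<bar>h k s\<bar> \<le> max 1 (Lc * C)" if "0 \<le> s" "s \<le> T" for k s
      using gk_lip[OF usl[OF that(1)] c0 L2[OF that], of k] by (simp add: h_def gk_0)
    show "\<bar>P s\<bar> \<le> max 1 (Lc * C)" if "0 \<le> s" "s \<le> T" for s
      using Phi_lip_Lc[OF usl[OF that(1)] c0 L2[OF that]] by (simp add: P_def Phi_0)
  qed simp
qed

lemma duh_le: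
  assumes B: "\<And>k s. 0 \<le> s \<Longrightarrow> s \<le> T \<Longrightarrow> \<bar>h k s\<bar> \<le> B" and t: "0 \<le> t" "t \<le> T"
  shows "\<bar>duh (l k) (h k) t\<bar> \<le> B * (1 / l k)"
proof (cases "k = 0")
  case True
  \<comment> \<open>At k = 0 the claimed bound is B / 0 = 0, and the forcing of this mode vanishes
    as well.\<close>
  have "h 0 = (\<lambda>s. 0)" by (auto simp: h_index_0)
  then show ?thesis using True by (simp add: duh_zero l_0)
next
  case False
  have "\<bar>duh (l k) (h k) t\<bar> \<le> B / (l k + 0) * exp (0 * t)"
  proof (rule duh_bound[OF h_cont t(1)])
    have "\<bar>h k 0\<bar> \<le> B" using B t by auto
    then show "0 \<le> B" by simp
  qed (use B t l_pos[of k] False in auto)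
  then show ?thesis by simp
qed

lemma A_le:
  assumes B: "\<And>k s. 0 \<le> s \<Longrightarrow> s \<le> T \<Longrightarrow> \<bar>h k s\<bar> \<le> B" and t: "0 \<le> t" "t \<le> T"
  shows "\<bar>A k t\<bar> \<le> \<bar>a0 k\<bar> + B * (1 / l k)"
proof -
  have "\<bar>exp (- l k * t) * a0 k\<bar> \<le> 1 * \<bar>a0 k\<bar>"
    unfolding abs_mult using l_nonneg[of k] t by (intro mult_right_mono) auto
  then show ?thesis unfolding A_def using duh_le[where k = k, OF B t] by linarith
qed

lemma bound_summable: "summable (\<lambda>k. \<bar>a0 k\<bar> + B * (1 / l k))"
  unfolding l_def by (intro summable_add a0_summable summable_mult summable_inverse_pi_squares)

lemma A_summable: assumes t: "t \<ge> 0" shows "summable (\<lambda>k. \<bar>A k t\<bar>)"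
proof -
  obtain B where "1 \<le> B" and B: "\<And>k s. 0 \<le> s \<Longrightarrow> s \<le> t \<Longrightarrow> \<bar>h k s\<bar> \<le> B" using bounds[of t] by metis
  show ?thesis
    by (rule summable_comparison_test'[OF bound_summable[of B]]) (use A_le[OF B t order_refl] in simp)
qed

lemma w_cont: "t \<ge> 0 \<Longrightarrow> continuous_on S (w t)"
  unfolding w_def by (rule sine_series_cont[OF A_summable])

lemma w_coeff: "t \<ge> 0 \<Longrightarrow> L2_inner (w t) (phi k) = A k t / 2"
  unfolding w_def using sine_series_coeff[OF A_summable, of t k] A_0 by (cases "k = 0") auto

lemma u_ends: assumes "t \<ge> 0" shows "u 0 t = 0" "u 1 t = U t"
  using u_eq[of 0 t] u_eq[of 1 t] assms by (auto simp: w_def)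

lemma u_coeff: assumes t: "t \<ge> 0" shows "L2_inner (\<lambda>x. u x t) (phi k) = A k t / 2 + U t * xc k"
proof -
  have "L2_inner (\<lambda>x. u x t) (phi k) = L2_inner (\<lambda>x. w t x + U t * x) (phi k)"
    by (rule L2_inner_cong) (auto simp: u_eq t)
  also have "\<dots> = L2_inner (w t) (phi k) + L2_inner (\<lambda>x. U t * x) (phi k)"
    by (rule L2_inner_add_left) (auto intro!: L2_fun_cont continuous_intros w_cont t)
  finally show ?thesis by (simp add: w_coeff[OF t] L2_inner_cmult_left xc_def)
qed

lemma u_init: assumes x: "x \<in> {0..1}" shows "u x 0 = u0 x"
proof -
  have "w 0 x = u0 x - u0 1 * x" unfolding w_def A_init using w0_expansion(3)[OF x] by simp
  then show ?thesis using u_eq[OF x, of 0] by (simp add: U_def)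
qed

text \<open>Adding the lift back undoes the shift: by \<open>xc_eq\<close> the coefficients of u
  satisfy the projected truncated equation with input \<open>u 1 t\<close>, before its relation to F
  is known.\<close>

lemma u_coeff_deriv:
  assumes t: "t > 0"
  shows "((\<lambda>t. L2_inner (\<lambda>x. u x t) (phi k)) has_real_derivative
    (- lam \<alpha> k * L2_inner (\<lambda>x. u x t) (phi k) - dphi1 k * u 1 t - b t * sq k (\<lambda>x. u x t))) (at t)"
proof -
  have "((\<lambda>t. A k t / 2 + U t * xc k) has_real_derivative (A' k t / 2 + P t * xc k)) (at t)"
    by (intro DERIV_add DERIV_cdivide DERIV_cmult_right A_deriv U_deriv t)
  then have d: "((\<lambda>t. L2_inner (\<lambda>x. u x t) (phi k)) has_real_derivative (A' k t / 2 + P t * xc k)) (at t)"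
    by (rule has_field_derivative_transform_within_open[OF _ open_greaterThan, of _ _ _ 0]) (use t in \<open>auto simp: u_coeff\<close>)
  define y where "y = L2_inner (\<lambda>x. u x t) (phi k)"
  have yA: "A k t = 2 * (y - U t * xc k)" using u_coeff[of t k] t by (simp add: y_def)
  have hh: "h k t = 2 * (\<alpha> * y - b t * sq k (\<lambda>x. u x t) - P t * xc k)"
    by (simp add: h_def gk_def y_def b_def P_def)
  have dph: "dphi1 k = - (l k * xc k)" using xc_eq[of k] by (simp add: l_def)
  have "A' k t / 2 + P t * xc k = - l k * (y - U t * xc k) + \<alpha> * y - b t * sq k (\<lambda>x. u x t)"
    unfolding A'_def hh yA by (simp add: field_simps)
  also have "\<dots> = - lam \<alpha> k * y - dphi1 k * u 1 t - b t * sq k (\<lambda>x. u x t)"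
    using u_ends(2)[of t] t unfolding dph lam_def l_def[symmetric] by (simp add: algebra_simps)
  finally show ?thesis using d unfolding y_def by simp
qed

text \<open>F(u) and U have the same time derivative, \<open>Phi\<close> being built from the
  projected equations, and they agree at t = 0 because u0 is in \<open>IC\<close>.\<close>

lemma feedback: assumes t: "t \<ge> 0" shows "u 1 t = Ffb \<alpha> N \<gamma> (\<lambda>x. u x t)"
proof -
  define f where "f t = (\<Sum>j\<in>{1..N}. cj j * L2_inner (\<lambda>x. u x t) (phi j)) - U t" for t
  have "continuous_on {0..} (\<lambda>t. (\<Sum>j\<in>{1..N}. cj j * (A j t / 2 + U t * xc j)) - U t)"
    by (intro continuous_intros A_cont U_cont) auto
  then have fc: "continuous_on {0..} f"
    by (rule continuous_on_eq) (simp add: f_def u_coeff)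
  have fd: "(f has_real_derivative 0) (at s)" if s: "s > 0" for s
  proof -
    have "(f has_real_derivative (\<Sum>j\<in>{1..N}. cj j * (- lam \<alpha> j * L2_inner (\<lambda>x. u x s) (phi j) - dphi1 j * u 1 s - b s * sq j (\<lambda>x. u x s))) - P s) (at s)"
      unfolding f_def[abs_def] by (intro DERIV_diff DERIV_sum DERIV_cmult u_coeff_deriv U_deriv s)
    then show ?thesis by (simp add: P_def Phi_def b_def)
  qed
  have f0: "f 0 = 0"
  proof -
    have "L2_inner (\<lambda>x. u x 0) (phi j) = L2_inner u0 (phi j)" for j
      by (rule L2_inner_cong) (auto simp: u_init)
    then have "f 0 = Ffb \<alpha> N \<gamma> u0 - u0 1" by (simp add: f_def U_def Ffb_cj)
    then show ?thesis using u0 by (simp add: IC_def)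
  qed
  have "f t = f 0"
  proof (cases "t = 0")
    case False
    show ?thesis
      by (rule DERIV_isconst2[of 0 t]) (use False t fd continuous_on_subset[OF fc, of "{0..t}"] in auto)
  qed simp
  then have "U t = Ffb \<alpha> N \<gamma> (\<lambda>x. u x t)" using f0 by (simp add: f_def Ffb_cj)
  then show ?thesis by (simp add: u_ends t)
qed

text \<open>A coefficient increment has a part from the data, Lipschitz in time because t >= \<tau>,
  and a Duhamel part bounded both by 2 B (t - s) and by 2 B / \<open>l k\<close>. Interpolation
  gives (t - s) powr (5/8) times (1 / l k) powr (3/8), whose squares sum over k. The point s ranges
  down to 0, as \<open>A'_bound\<close> requires.\<close>

lemma h_holder:
  assumes tau: "0 < \<tau>" "\<tau> \<le> T"
  obtains Ho where "0 \<le> Ho" "\<And>k t s. \<tau> \<le> t \<Longrightarrow> t \<le> T \<Longrightarrow> 0 \<le> s \<Longrightarrow> s \<le> t \<Longrightarrow> \<bar>h k t - h k s\<bar> \<le> Ho * (t - s) powr (5/8)"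
proof -
  obtain B where B1: "1 \<le> B" and B: "\<And>k s. 0 \<le> s \<Longrightarrow> s \<le> T \<Longrightarrow> \<bar>h k s\<bar> \<le> B"
    and BP: "\<And>s. 0 \<le> s \<Longrightarrow> s \<le> T \<Longrightarrow> \<bar>P s\<bar> \<le> B" using bounds[of T] by metis
  define c0 where "c0 = T powr (3/8)"
  have c0: "0 \<le> c0" by (simp add: c0_def)
  define e where "e k = 2 / \<tau> * c0 * \<bar>a0 k\<bar> + 2 * B * (1 / l k) powr (3/8)" for k
  have e0: "0 \<le> e k" for k using tau c0 B1 by (simp add: e_def)
  have es: "summable (\<lambda>k. (e k)\<^sup>2)"
  proof (rule summable_comparison_test')
    \<comment> \<open>The exponent 3/4 of the inverse squares exceeds 1/2.\<close>
    show "summable (\<lambda>k. 2 * ((2 / \<tau> * c0)\<^sup>2 * (a0 k)\<^sup>2) + 2 * ((2 * B)\<^sup>2 * (1 / l k) powr (3/4)))"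
      unfolding l_def by (intro summable_add summable_mult a0_sq_summable' summable_inverse_pi_powr) simp
    have pp: "((1 / l k) powr (3/8))\<^sup>2 = (1 / l k) powr (3/4)" for k
      by (simp add: power2_eq_square powr_add[symmetric])
    show "norm ((e k)\<^sup>2) \<le> 2 * ((2 / \<tau> * c0)\<^sup>2 * (a0 k)\<^sup>2) + 2 * ((2 * B)\<^sup>2 * (1 / l k) powr (3/4))" for k
    proof -
      have "(e k)\<^sup>2 \<le> 2 * (2 / \<tau> * c0 * \<bar>a0 k\<bar>)\<^sup>2 + 2 * (2 * B * (1 / l k) powr (3/8))\<^sup>2"
        unfolding e_def by (rule square_sum_le)
      also have "\<dots> = 2 * ((2 / \<tau> * c0)\<^sup>2 * (a0 k)\<^sup>2) + 2 * ((2 * B)\<^sup>2 * (1 / l k) powr (3/4))"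
        unfolding power_mult_distrib[of "2 / \<tau> * c0"] power_mult_distrib[of "2 * B"] pp by simp
      finally show ?thesis by simp
    qed
  qed
  define W where "W = sqrt (\<Sum>k. (e k)\<^sup>2) + B * c0"
  have se: "0 \<le> (\<Sum>k. (e k)\<^sup>2)" by (rule suminf_nonneg[OF es]) simp
  have W0: "0 \<le> W" unfolding W_def using se B1 c0 by simp
  show ?thesis
  proof (rule that[of "Lc * W"])
    show "0 \<le> Lc * W" using Lc(1) W0 by simp
    fix k t s assume t: "\<tau> \<le> t" "t \<le> T" and s: "0 \<le> s" "s \<le> t"
    have tp: "0 \<le> t" using t tau by simp
    define r where "r = t - s"
    define rr where "rr = r powr (5/8)"
    have r: "0 \<le> r" "r \<le> T" using t s by (auto simp: r_def)
    have rr: "0 \<le> rr" by (simp add: rr_def)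
    \<comment> \<open>On a bounded time interval a Lipschitz bound weakens to one of exponent 5/8,
      at the price of the factor \<open>c0\<close>.\<close>
    have r_le: "r \<le> c0 * rr" using geo_mean_le[OF r(1) order_refl r(2)] by (simp add: c0_def rr_def mult.commute)
    have inT: "s \<in> {0..T}" "t \<in> {0..T}" using s t tp by auto
    have dbound: "\<bar>duh (l k) (h k) t - duh (l k) (h k) s\<bar> \<le> 2 * B * r" for k
    proof -
      have "norm (duh (l k) (h k) t - duh (l k) (h k) s) \<le> (2 * B) * norm (t - s)"
      proof (rule field_differentiable_bound[where S = "{0..T}"])
        fix z assume z: "z \<in> {0..T}"
        show "(duh (l k) (h k) has_field_derivative - l k * duh (l k) (h k) z + h k z) (at z within {0..T})"
          by (rule duh_deriv_within[OF h_cont z])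
        \<comment> \<open>The factor 1 / \<open>l k\<close> of \<open>duh_le\<close> compensates
          \<open>l k\<close>, so the time derivative of the Duhamel term is bounded uniformly in
          k.\<close>
        have "\<bar>l k * duh (l k) (h k) z\<bar> \<le> l k * (B * (1 / l k))"
          unfolding abs_mult using duh_le[where T = T and t = z and k = k, OF B] z l_nonneg[of k] by (intro mult_mono) auto
        also have "\<dots> \<le> B" using B1 by simp
        finally show "norm (- l k * duh (l k) (h k) z + h k z) \<le> 2 * B"
          using B[of z k] z by simp
      qed (use inT in auto)
      then show ?thesis using s by (simp add: r_def)
    qed
    have d: "\<bar>A k t - A k s\<bar> \<le> rr * e k" for k
    proof -
      have 1: "\<bar>(exp (- l k * t) - exp (- l k * s)) * a0 k\<bar> \<le> 2 / \<tau> * (c0 * rr) * \<bar>a0 k\<bar>"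
      proof -
        have "\<bar>exp (- l k * t) - exp (- l k * s)\<bar> \<le> 2 / \<tau> * r"
          unfolding r_def by (rule exp_decay_diff_le[OF l_nonneg tau(1) t(1) s])
        also have "\<dots> \<le> 2 / \<tau> * (c0 * rr)" using tau by (intro mult_left_mono r_le) auto
        finally show ?thesis unfolding abs_mult by (intro mult_right_mono) auto
      qed
      have 2: "\<bar>duh (l k) (h k) t - duh (l k) (h k) s\<bar> \<le> 2 * B * (rr * (1 / l k) powr (3/8))"
      proof -
        let ?x = "\<bar>duh (l k) (h k) t - duh (l k) (h k) s\<bar>"
        have "?x \<le> 2 * B * (1 / l k)"
          using duh_le[where T = T and t = t and k = k, OF B] duh_le[where T = T and t = s and k = k, OF B] s t tp by force
        then have "?x / (2 * B) \<le> 1 / l k" using B1 by (simp add: divide_le_eq mult.commute)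
        moreover have "?x / (2 * B) \<le> r" using dbound[of k] B1 by (simp add: divide_le_eq mult.commute)
        moreover have "0 \<le> ?x / (2 * B)" using B1 by simp
        ultimately have "?x / (2 * B) \<le> rr * (1 / l k) powr (3/8)"
          unfolding rr_def by (intro geo_mean_le)
        then show ?thesis using B1 by (simp add: divide_le_eq mult.commute)
      qed
      have "A k t - A k s = (exp (- l k * t) - exp (- l k * s)) * a0 k + (duh (l k) (h k) t - duh (l k) (h k) s)"
        by (simp add: A_def algebra_simps)
      then have "\<bar>A k t - A k s\<bar> \<le> 2 / \<tau> * (c0 * rr) * \<bar>a0 k\<bar> + 2 * B * (rr * (1 / l k) powr (3/8))"
        using 1 2 by linarith
      then show ?thesis by (simp add: e_def algebra_simps)
    qed
    have ds: "summable (\<lambda>k. \<bar>A k t - A k s\<bar>)"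
      by (rule summable_comparison_test'[OF summable_add[OF A_summable[OF tp] A_summable[OF s(1)]]]) simp
    have weq: "w t x - w s x = (\<Sum>k. (A k t - A k s) * phi k x)" for x
      unfolding w_def left_diff_distrib
      by (rule suminf_diff[OF sine_series_summable[OF A_summable[OF tp]] sine_series_summable[OF A_summable[OF s(1)]]])
    have "(L2_norm (\<lambda>x. w t x - w s x))\<^sup>2 \<le> rr\<^sup>2 * (\<Sum>k. (e k)\<^sup>2)"
      unfolding weq
    proof (rule sums_le[OF _ sine_series_norm[OF ds]])
      show "(\<lambda>k. rr\<^sup>2 * (e k)\<^sup>2) sums (rr\<^sup>2 * (\<Sum>k. (e k)\<^sup>2))" by (intro sums_mult summable_sums es)
      show "(if k = 0 then 0 else (A k t - A k s)\<^sup>2 / 2) \<le> rr\<^sup>2 * (e k)\<^sup>2" for k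
      proof -
        have "\<bar>A k t - A k s\<bar>\<^sup>2 \<le> (rr * e k)\<^sup>2" by (rule power_mono[OF d]) simp
        then have "(A k t - A k s)\<^sup>2 \<le> rr\<^sup>2 * (e k)\<^sup>2" by (simp add: power_mult_distrib)
        moreover have "0 \<le> (A k t - A k s)\<^sup>2" by simp
        ultimately have "(A k t - A k s)\<^sup>2 / 2 \<le> rr\<^sup>2 * (e k)\<^sup>2" by linarith
        then show ?thesis by simp
      qed
    qed
    also have "\<dots> = (rr * sqrt (\<Sum>k. (e k)\<^sup>2))\<^sup>2" using se by (simp add: power_mult_distrib)
    finally have wd: "L2_norm (\<lambda>x. w t x - w s x) \<le> rr * sqrt (\<Sum>k. (e k)\<^sup>2)"
      by (rule power2_le_imp_le) (use rr se in simp)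
    have Ud: "\<bar>U t - U s\<bar> \<le> rr * (B * c0)"
    proof -
      have "norm (duh 0 P t - duh 0 P s) \<le> B * norm (t - s)"
      proof (rule field_differentiable_bound[where S = "{0..T}"])
        fix z assume z: "z \<in> {0..T}"
        show "(duh 0 P has_field_derivative - 0 * duh 0 P z + P z) (at z within {0..T})"
          by (rule duh_deriv_within[OF P_cont z])
        show "norm (- 0 * duh 0 P z + P z) \<le> B" using BP[of z] z by simp
      qed (use inT in auto)
      then have "\<bar>U t - U s\<bar> \<le> B * r" using s by (simp add: U_def r_def)
      also have "\<dots> \<le> B * (c0 * rr)" using B1 by (intro mult_left_mono r_le) auto
      finally show ?thesis by (simp add: mult_ac)
    qed
    have "L2_norm (\<lambda>x. u x t - u x s) = L2_norm (\<lambda>x. (w t x - w s x) + (U t - U s) * x)"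
      by (rule L2_norm_cong) (simp add: u_eq tp s algebra_simps)
    also have "\<dots> \<le> L2_norm (\<lambda>x. w t x - w s x) + L2_norm (\<lambda>x. (U t - U s) * x)"
      by (rule L2_norm_add_le) (intro L2_fun_cont continuous_intros w_cont tp s)+
    also have "L2_norm (\<lambda>x. (U t - U s) * x) \<le> \<bar>U t - U s\<bar>"
      unfolding L2_norm_cmult using mult_left_mono[OF L2_norm_x_le, of "\<bar>U t - U s\<bar>"] by simp
    finally have ud: "L2_norm (\<lambda>x. u x t - u x s) \<le> rr * W"
      using wd Ud by (simp add: W_def distrib_left)
    have "\<bar>U t - U s\<bar> \<le> rr * W"
    proof -
      have "rr * (B * c0) \<le> rr * W" unfolding W_def using rr se by (intro mult_left_mono) auto
      then show ?thesis using Ud by linarith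
    qed
    then have u1: "\<bar>u 1 t - u 1 s\<bar> \<le> rr * W" by (simp add: u_ends tp s)
    show "\<bar>h k t - h k s\<bar> \<le> Lc * W * (t - s) powr (5/8)"
      using gk_lip[OF usl[OF tp] usl[OF s(1)] ud u1, of k] by (simp add: h_def rr_def r_def mult_ac)
  qed
qed

text \<open>Freeze the forcing at the final time t: y = A - h(t) / l solves y' = - l y + (h - h(t)),
  and A'(t) = - l y(t). The Hoelder increment contributes (1 / l) powr (5/8), summable because 5/8 >
  1/2, and the initial value of y is smoothed by l exp (- l t) <= 1 / \<tau>.\<close>

lemma A'_bound:
  assumes tau: "0 < \<tau>" "\<tau> \<le> T"
  obtains m where "summable m" "\<And>k t. \<tau> \<le> t \<Longrightarrow> t \<le> T \<Longrightarrow> \<bar>A' k t\<bar> \<le> m k"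
proof -
  obtain B where B1: "1 \<le> B" and B: "\<And>k s. 0 \<le> s \<Longrightarrow> s \<le> T \<Longrightarrow> \<bar>h k s\<bar> \<le> B" using bounds[of T] by metis
  obtain Ho where Ho0: "0 \<le> Ho" and Ho: "\<And>k t s. \<tau> \<le> t \<Longrightarrow> t \<le> T \<Longrightarrow> 0 \<le> s \<Longrightarrow> s \<le> t \<Longrightarrow> \<bar>h k t - h k s\<bar> \<le> Ho * (t - s) powr (5/8)"
    using h_holder[OF tau] by metis
  define m where "m k = 1 / \<tau> * \<bar>a0 k\<bar> + B / \<tau> * (1 / l k) + 4 * Ho * (1 / l k) powr (5/8)" for k
  show ?thesis
  proof (rule that[of m])
    show "summable m"
      unfolding m_def l_def
      by (intro summable_add summable_mult a0_summable summable_inverse_pi_squares summable_inverse_pi_powr) simp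
    fix k t assume t: "\<tau> \<le> t" "t \<le> T"
    then have tp: "0 < t" using tau by simp
    show "\<bar>A' k t\<bar> \<le> m k"
    proof (cases "k = 0")
      case True
      then show ?thesis using tau B1 Ho0 by (simp add: A_0 m_def l_0)
    next
      case False
      define q where "q = l k"
      have q: "0 < q" using False l_pos[of k] by (simp add: q_def)
      define y where "y s = A k s - h k t / q" for s
      \<comment> \<open>\<open>duhamel_bound\<close> is used with \<mu> = q / 2: half of the decay
        absorbs the factor exp (q (t - s) / 2) that dominates the Hoelder increment.\<close>
      have "\<bar>y t\<bar> \<le> exp (- q * t) * \<bar>y 0\<bar> + (2 * Ho * (1 / q) powr (5/8) * exp (q / 2 * t)) / (q - q / 2) * exp (- (q / 2) * t)"
      proof (rule duhamel_bound[where T = t and f = "\<lambda>s. h k s - h k t"])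
        show "continuous_on {0..t} y" unfolding y_def
          by (intro continuous_intros continuous_on_subset[OF A_cont]) (use q in auto)
        show "(y has_real_derivative - q * y s + (h k s - h k t)) (at s)" if "0 < s" for s
        proof -
          have "(y has_real_derivative A' k s - 0) (at s)" unfolding y_def[abs_def]
            by (intro DERIV_diff A_deriv that DERIV_const)
          then show ?thesis by (rule DERIV_cong) (use q in \<open>simp add: y_def A'_def q_def algebra_simps\<close>)
        qed
        show "\<bar>h k s - h k t\<bar> \<le> (2 * Ho * (1 / q) powr (5/8) * exp (q / 2 * t)) * exp (- (q / 2) * s)" if s: "0 < s" "s < t" for s
        proof -
          have "(t - s) powr (5/8) = (q * (t - s)) powr (5/8) * (1 / q) powr (5/8)"
            using q s by (simp add: powr_mult[symmetric])
          also have "\<dots> \<le> 2 * exp (q * (t - s) / 2) * (1 / q) powr (5/8)"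
            using q s by (intro mult_right_mono powr_le_exp_half) auto
          finally have "Ho * (t - s) powr (5/8) \<le> Ho * (2 * exp (q * (t - s) / 2) * (1 / q) powr (5/8))"
            using Ho0 by (intro mult_left_mono)
          moreover have "exp (q * (t - s) / 2) = exp (q / 2 * t) * exp (- (q / 2) * s)"
            by (simp add: exp_add[symmetric] field_simps)
          ultimately have "Ho * (t - s) powr (5/8) \<le> (2 * Ho * (1 / q) powr (5/8) * exp (q / 2 * t)) * exp (- (q / 2) * s)"
            by (simp add: mult_ac)
          then show ?thesis using Ho[OF t, of s k] s by (simp add: abs_minus_commute)
        qed
      qed (use tp q Ho0 in auto)
      also have "(2 * Ho * (1 / q) powr (5/8) * exp (q / 2 * t)) / (q - q / 2) * exp (- (q / 2) * t)
         = 4 * Ho * (1 / q) powr (5/8) / q"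
        using q by (simp add: exp_minus field_simps)
      finally have y: "\<bar>y t\<bar> \<le> exp (- q * t) * \<bar>y 0\<bar> + 4 * Ho * (1 / q) powr (5/8) / q" .
      have "\<bar>A' k t\<bar> = q * \<bar>y t\<bar>"
      proof -
        have "A' k t = - (q * y t)" using q by (simp add: A'_def y_def q_def algebra_simps)
        then show ?thesis using q by (simp add: abs_mult)
      qed
      also have "\<dots> \<le> q * (exp (- q * t) * \<bar>y 0\<bar> + 4 * Ho * (1 / q) powr (5/8) / q)"
        using q y by (intro mult_left_mono) auto
      also have "\<dots> = q * exp (- q * t) * \<bar>y 0\<bar> + 4 * Ho * (1 / q) powr (5/8)"
        using q by (simp add: distrib_left)
      also have "q * exp (- q * t) * \<bar>y 0\<bar> \<le> 1 / \<tau> * (\<bar>a0 k\<bar> + B * (1 / q))"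
      proof (rule mult_mono)
        have "q * exp (- q * t) \<le> 1 / t" using q by (intro mult_exp_minus_le tp) auto
        also have "\<dots> \<le> 1 / \<tau>" using t tau by (intro divide_left_mono) auto
        finally show "q * exp (- q * t) \<le> 1 / \<tau>" .
        have "\<bar>h k t / q\<bar> \<le> B * (1 / q)" using B[of t k] t tp q by (simp add: divide_right_mono)
        then show "\<bar>y 0\<bar> \<le> \<bar>a0 k\<bar> + B * (1 / q)" unfolding y_def A_init by linarith
      qed (use tau in auto)
      finally show ?thesis by (simp add: m_def q_def algebra_simps)
    qed
  qed
qed

end


section \<open>Mild solutions are classical for positive times and continuous in H^1\<close>

context fisher_mild
begin

definition z where "z x t = (\<Sum>k. A' k t * phi k x)"
definition ut where "ut x t = z x t + x * P t"
text \<open>Differentiating the sine series of w twice would need the coefficients l A = h - A',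
  where h is only known to be bounded in k. Instead the second derivative is read off from the
  equation and integrated twice; \<open>\<kappa>\<close> is the slope that makes the double integral
  vanish at x = 1.\<close>

definition uxx where "uxx x t = ut x t - \<alpha> * u x t + b t * (u x t)\<^sup>2"
definition R1 where "R1 x t = integral {0..x} (\<lambda>y. uxx y t)"
definition \<kappa> where "\<kappa> t = integral {0..1} (\<lambda>y. R1 y t)"
definition ux where "ux x t = R1 x t - \<kappa> t + U t"

lemma snd_cont:
  assumes "continuous_on {0..} f" "B \<subseteq> {0..}"
  shows "continuous_on (S \<times> B) (\<lambda>(x::real,t::real). f t :: real)"
  unfolding case_prod_unfold
  by (rule continuous_on_compose2[OF assms(1)]) (use assms(2) in \<open>auto intro!: continuous_intros\<close>)

lemma z_cont: "continuous_on ({0..1} \<times> {0<..}) (\<lambda>(x,t). z x t)"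
proof (rule continuous_on_open_timeI)
  fix \<tau> T :: real assume tau: "0 < \<tau>" "\<tau> < T"
  obtain m where m: "summable m" "\<And>k t. \<tau> \<le> t \<Longrightarrow> t \<le> T \<Longrightarrow> \<bar>A' k t\<bar> \<le> m k"
    using A'_bound[of \<tau> T] tau by (metis less_imp_le)
  show "continuous_on ({0..1} \<times> {\<tau>..T}) (\<lambda>(x,t). z x t)"
  proof (rule uniform_limit_theorem)
    show "uniform_limit ({0..1} \<times> {\<tau>..T}) (\<lambda>n (x,t). \<Sum>k<n. A' k t * phi k x) (\<lambda>(x,t). z x t) sequentially"
      unfolding z_def case_prod_unfold
    proof (rule Weierstrass_m_test[OF _ m(1)])
      fix k and p :: "real \<times> real" assume p: "p \<in> {0..1} \<times> {\<tau>..T}"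
      have "\<bar>A' k (snd p)\<bar> * \<bar>phi k (fst p)\<bar> \<le> m k * 1"
        using m(2)[of "snd p" k] p by (intro mult_mono) auto
      then show "norm (A' k (snd p) * phi k (fst p)) \<le> m k" by (simp add: abs_mult)
    qed
    have "continuous_on ({0..1} \<times> {\<tau>..T}) (\<lambda>p. \<Sum>k<n. A' k (snd p) * phi k (fst p))" for n
      by (intro continuous_intros continuous_on_compose2[OF A'_cont] continuous_on_compose2[OF phi_cont[of UNIV]])
        (use tau in auto)
    then show "\<forall>\<^sub>F n in sequentially. continuous_on ({0..1} \<times> {\<tau>..T}) (\<lambda>(x,t). \<Sum>k<n. A' k t * phi k x)"
      by (auto intro!: always_eventually simp: case_prod_unfold)
  qed simp
qed

lemma A'_summable: "t > 0 \<Longrightarrow> summable (\<lambda>k. \<bar>A' k t\<bar>)"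
proof -
  assume t: "t > 0"
  obtain m where m: "summable m" "\<And>k s. t \<le> s \<Longrightarrow> s \<le> t \<Longrightarrow> \<bar>A' k s\<bar> \<le> m k"
    using A'_bound[OF t order_refl] by metis
  show ?thesis by (rule summable_comparison_test'[OF m(1)]) (use m(2) in simp)
qed

text \<open>Termwise differentiation: on (t/2, 2t) the majorant from \<open>A'_bound\<close> makes
  the differentiated series converge uniformly.\<close>

lemma w_deriv:
  assumes t: "t > 0"
  shows "((\<lambda>t. w t x) has_real_derivative z x t) (at t)"
proof -
  obtain m where m: "summable m" "\<And>k s. t/2 \<le> s \<Longrightarrow> s \<le> 2*t \<Longrightarrow> \<bar>A' k s\<bar> \<le> m k"
  proof -
    have "0 < t / 2" "t / 2 \<le> 2 * t" using t by auto
    then show ?thesis using A'_bound[of "t/2" "2*t"] that by metis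
  qed
  show ?thesis
    unfolding w_def z_def
  proof (rule has_field_derivative_series'(2)[where S = "{t/2<..<2*t}" and ?x0.0 = t])
    show "((\<lambda>t. A k t * phi k x) has_field_derivative A' k s * phi k x) (at s within {t/2<..<2*t})" if "s \<in> {t/2<..<2*t}" for k s
      by (rule DERIV_cmult_right, rule has_field_derivative_at_within, rule A_deriv) (use that t in auto)
    show "uniformly_convergent_on {t/2<..<2*t} (\<lambda>n s. \<Sum>k<n. A' k s * phi k x)"
    proof (rule Weierstrass_m_test'[OF _ m(1)])
      fix k s assume s: "s \<in> {t/2<..<2*t}"
      have "\<bar>A' k s\<bar> * \<bar>phi k x\<bar> \<le> m k * 1"
        using m(2)[of s k] s by (intro mult_mono) auto
      then show "norm (A' k s * phi k x) \<le> m k" by (simp add: abs_mult)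
    qed
    show "summable (\<lambda>k. A k t * phi k x)" using t by (intro sine_series_summable A_summable) auto
  qed (use t in \<open>auto simp: interior_open\<close>)
qed

lemma ut_cont: "continuous_on ({0..1} \<times> {0<..}) (\<lambda>(x,t). ut x t)"
proof -
  have "continuous_on ({0..1} \<times> {0<..}) (\<lambda>p. (\<lambda>(x,t). z x t) p + fst p * (\<lambda>(x,t). P t) p)"
    by (intro continuous_intros z_cont snd_cont[OF P_cont]) auto
  then show ?thesis by (simp add: ut_def case_prod_unfold)
qed

lemma uxx_cont: "continuous_on ({0..1} \<times> {0<..}) (\<lambda>(x,t). uxx x t)"
proof -
  have u': "continuous_on ({0..1} \<times> {0<..}) (\<lambda>(x,t). u x t)" by (rule continuous_on_subset[OF uc]) auto
  have "continuous_on ({0..1} \<times> {0<..}) (\<lambda>p. (\<lambda>(x,t). ut x t) p - \<alpha> * (\<lambda>(x,t). u x t) p + (\<lambda>(x,t). b t) p * ((\<lambda>(x,t). u x t) p)\<^sup>2)"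
    by (intro continuous_intros ut_cont u' snd_cont[OF b_cont]) auto
  then show ?thesis by (simp add: uxx_def case_prod_unfold)
qed

lemma R1_cont: "continuous_on ({0..1} \<times> {0<..}) (\<lambda>(x,t). R1 x t)"
  unfolding R1_def by (rule continuous_on_times_fst[OF uxx_cont])

lemma \<kappa>_cont: "continuous_on {0<..} \<kappa>"
proof -
  have "continuous_on ({0<..} \<times> {0..1}) (\<lambda>p. (\<lambda>(x,t). R1 x t) (snd p, fst p))"
    by (rule continuous_on_compose2[OF R1_cont]) (auto intro!: continuous_intros)
  then have "continuous_on ({0<..} \<times> cbox 0 1) (\<lambda>(t, x). R1 x t)" by (simp add: case_prod_unfold)
  from integral_continuous_on_param[OF this] show ?thesis by (simp add: \<kappa>_def[abs_def])
qed

lemma ux_cont: "continuous_on ({0..1} \<times> {0<..}) (\<lambda>(x,t). ux x t)"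
proof -
  have k: "continuous_on ({0..1} \<times> {0<..}) (\<lambda>p::real \<times> real. \<kappa> (snd p))"
    by (rule continuous_on_compose2[OF \<kappa>_cont]) (auto intro!: continuous_intros)
  have "continuous_on ({0..1} \<times> {0<..}) (\<lambda>p. (\<lambda>(x,t). R1 x t) p - \<kappa> (snd p) + (\<lambda>(x,t). U t) p)"
    by (intro continuous_intros R1_cont k snd_cont[OF U_cont]) auto
  then show ?thesis by (simp add: ux_def case_prod_unfold)
qed

lemma ut_deriv:
  assumes x: "x \<in> {0..1}" and t: "t > 0"
  shows "((\<lambda>s. u x s) has_real_derivative ut x t) (at t)"
proof -
  have "((\<lambda>s. w s x + x * U s) has_real_derivative (z x t + x * P t)) (at t)"
    by (intro DERIV_add DERIV_cmult w_deriv U_deriv t)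
  then show ?thesis
    unfolding ut_def
    by (rule has_field_derivative_transform_within_open[OF _ open_greaterThan, of _ _ _ 0]) (use t x in \<open>auto simp: u_eq\<close>)
qed

text \<open>By the definition of \<open>gk\<close>, the terms with \<alpha> u, b u^2 and x P
  together contribute exactly - h / 2, which cancels the forcing in A'.\<close>

lemma uxx_coeff:
  assumes t: "t > 0"
  shows "L2_inner (\<lambda>x. uxx x t) (phi k) = - l k * A k t / 2"
proof -
  have t': "t \<ge> 0" using t by simp
  have zL: "continuous_on {0..1} (\<lambda>x. z x t)" using continuous_on_slice[OF z_cont] t by auto
  have uL: "continuous_on {0..1} (\<lambda>x. u x t)" by (rule usl[OF t'])
  have zc: "L2_inner (\<lambda>x. z x t) (phi k) = A' k t / 2"
    unfolding z_def using sine_series_coeff[OF A'_summable[OF t], of k] A_0 by (cases "k = 0") auto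
  have "L2_inner (\<lambda>x. uxx x t) (phi k) = L2_inner (\<lambda>x. ((z x t + P t * x) - \<alpha> * u x t) + b t * (u x t * u x t)) (phi k)"
    by (simp add: uxx_def ut_def power2_eq_square mult.commute)
  also have "\<dots> = L2_inner (\<lambda>x. (z x t + P t * x) - \<alpha> * u x t) (phi k) + L2_inner (\<lambda>x. b t * (u x t * u x t)) (phi k)"
    by (rule L2_inner_add_left) (intro L2_fun_cont continuous_intros zL uL)+
  also have "L2_inner (\<lambda>x. (z x t + P t * x) - \<alpha> * u x t) (phi k) = L2_inner (\<lambda>x. z x t + P t * x) (phi k) - L2_inner (\<lambda>x. \<alpha> * u x t) (phi k)"
    by (rule L2_inner_diff_left) (intro L2_fun_cont continuous_intros zL uL)+
  also have "L2_inner (\<lambda>x. z x t + P t * x) (phi k) = L2_inner (\<lambda>x. z x t) (phi k) + L2_inner (\<lambda>x. P t * x) (phi k)"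
    by (rule L2_inner_add_left) (intro L2_fun_cont continuous_intros zL uL)+
  finally have "L2_inner (\<lambda>x. uxx x t) (phi k) = A' k t / 2 + P t * xc k - \<alpha> * L2_inner (\<lambda>x. u x t) (phi k) + b t * sq k (\<lambda>x. u x t)"
    unfolding zc L2_inner_cmult_left xc_def sq_def by simp
  also have "\<dots> = A' k t / 2 - h k t / 2"
  proof -
    have "h k t = 2 * (\<alpha> * L2_inner (\<lambda>x. u x t) (phi k) - b t * sq k (\<lambda>x. u x t) - P t * xc k)"
      by (simp add: h_def gk_def b_def P_def)
    then show ?thesis by (simp add: field_simps)
  qed
  finally show ?thesis by (simp add: A'_def add_divide_distrib diff_divide_distrib)
qed

text \<open>The right-hand side vanishes at both ends and has second derivative \<open>uxx\<close>,
  so by \<open>uxx_coeff\<close> its sine coefficients are A / 2, which are those of w.\<close>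

lemma w_double_integral:
  assumes t: "t > 0" and x: "x \<in> {0..1}"
  shows "w t x = integral {0..x} (\<lambda>y. R1 y t) - x * \<kappa> t"
proof -
  have t': "t \<ge> 0" using t by simp
  define v where "v x = integral {0..x} (\<lambda>y. R1 y t) - x * \<kappa> t" for x
  have Rc: "continuous_on {0..1} (\<lambda>x. R1 x t)" using continuous_on_slice[OF R1_cont] t by auto
  have uxxc: "continuous_on {0..1} (\<lambda>x. uxx x t)" using continuous_on_slice[OF uxx_cont] t by auto
  have d1: "(v has_real_derivative R1 x t - \<kappa> t) (at x within {0..1})" if "x \<in> {0..1}" for x
    unfolding v_def[abs_def] using integral_has_derivative[OF Rc that, of 0]
    by (auto intro!: derivative_eq_intros)
  have d2: "((\<lambda>x. R1 x t - \<kappa> t) has_real_derivative uxx x t) (at x within {0..1})" if "x \<in> {0..1}" for x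
    unfolding R1_def using integral_has_derivative[OF uxxc that, of "- \<kappa> t"] by simp
  have v01: "v 0 = 0" "v 1 = 0" by (simp_all add: v_def \<kappa>_def)
  have vc: "continuous_on {0..1} v" using d1 by (rule DERIV_continuous_on)
  have "L2_inner v (phi k) = A k t / 2" for k
  proof (cases "k = 0")
    case False
    have "L2_inner (\<lambda>x. uxx x t) (phi k) = pi * real k * v 0 - dphi1 k * v 1 - (pi * real k)\<^sup>2 * L2_inner v (phi k)"
      by (rule sine_coeff_second_deriv[OF d1 d2 uxxc])
    then have "l k * L2_inner v (phi k) = l k * (A k t / 2)"
      unfolding uxx_coeff[OF t] v01 l_def[symmetric] by linarith
    then show ?thesis using l_pos[of k] False by simp
  qed (simp add: A_0)
  then have "w t x - v x = 0"
    by (intro sine_unique[of "\<lambda>x. w t x - v x" x])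
      (use x vc in \<open>auto intro!: continuous_intros w_cont t' simp: L2_inner_diff_left L2_fun_cont w_cont t' w_coeff\<close>)
  then show ?thesis by (simp add: v_def)
qed

lemma ux_deriv:
  assumes x: "x \<in> {0..1}" and t: "t > 0"
  shows "((\<lambda>y. u y t) has_real_derivative ux x t) (at x within {0..1})"
    "((\<lambda>y. ux y t) has_real_derivative uxx x t) (at x within {0..1})"
proof -
  have t': "t \<ge> 0" using t by simp
  have Rc: "continuous_on {0..1} (\<lambda>x. R1 x t)" using continuous_on_slice[OF R1_cont] t by auto
  have uxxc: "continuous_on {0..1} (\<lambda>x. uxx x t)" using continuous_on_slice[OF uxx_cont] t by auto
  have d: "((\<lambda>x. integral {0..x} (\<lambda>y. R1 y t) - x * \<kappa> t + x * U t) has_real_derivative ux x t) (at x within {0..1})"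
    unfolding ux_def using integral_has_derivative[OF Rc x, of 0]
    by (auto intro!: derivative_eq_intros)
  show "((\<lambda>y. u y t) has_real_derivative ux x t) (at x within {0..1})"
    by (rule has_field_derivative_transform_within[OF d zero_less_one x])
      (simp add: u_eq[OF _ t'] w_double_integral[OF t])
  show "((\<lambda>y. ux y t) has_real_derivative uxx x t) (at x within {0..1})"
    unfolding ux_def R1_def using integral_has_derivative[OF uxxc x, of "- \<kappa> t + U t"]
    by (simp add: algebra_simps)
qed

lemma u_H1: assumes t: "t \<ge> 0" obtains g where "is_weak_deriv (\<lambda>x. u x t) g"
proof (cases "t = 0")
  case True
  have "is_weak_deriv (\<lambda>x. u x 0) g0"
    unfolding is_weak_deriv_def
  proof (intro conjI ballI)
    show "L2_fun g0" using is_weak_derivD(1)[OF g0] .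
    show "u x 0 = u 0 0 + integral {0..x} g0" if x: "x \<in> {0..1}" for x
      using is_weak_derivD(2)[OF g0 x] u_init[OF x] u_init[of 0] by simp
  qed
  then show ?thesis using that True by blast
next
  case False
  with t have t0: "t > 0" by simp
  have "continuous_on {0..1} (\<lambda>x. ux x t)" using continuous_on_slice[OF ux_cont] t0 by auto
  then have "is_weak_deriv (\<lambda>x. u x t) (\<lambda>x. ux x t)"
    by (rule is_weak_derivI) (rule ux_deriv(1)[OF _ t0])
  then show ?thesis by (rule that)
qed

text \<open>Minus its linear lift the difference vanishes at both ends, so
  \<open>sine_expansion\<close> gives the norm of its derivative exactly. The difference itself
  vanishes at 0 and is dominated by its derivative, hence the factor 2.\<close>

lemma H1_diff_le:
  assumes t: "t \<ge> 0" and t0: "t0 \<ge> 0"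
  shows "H1_norm (\<lambda>x. u x t - u x t0) \<le> 2 * (sqrt (\<Sum>k. l k * (A k t - A k t0)\<^sup>2 / 2) + \<bar>U t - U t0\<bar>)"
proof -
  obtain g where g: "is_weak_deriv (\<lambda>x. u x t) g" using u_H1[OF t] .
  obtain g' where g': "is_weak_deriv (\<lambda>x. u x t0) g'" using u_H1[OF t0] .
  define d where "d x = u x t - u x t0" for x
  define q where "q x = g x - g' x" for x
  define r where "r = U t - U t0"
  have dq: "is_weak_deriv d q" unfolding d_def[abs_def] q_def[abs_def] by (rule is_weak_deriv_diff[OF g g'])
  have qL: "L2_fun q" by (rule is_weak_derivD(1)[OF dq])
  have dc: "continuous_on {0..1} d" by (rule weak_deriv_cont[OF dq])
  have cL: "L2_fun (\<lambda>x. r)" by (rule L2_fun_cont) simp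
  have d0: "d 0 = 0" "d 1 = r" by (simp_all add: d_def r_def u_ends t t0)
  have "is_weak_deriv (\<lambda>x. r * x) (\<lambda>x. r)" by (rule is_weak_derivI) (auto intro!: derivative_eq_intros)
  from is_weak_deriv_diff[OF dq this] have dw: "is_weak_deriv (\<lambda>x. d x - r * x) (\<lambda>x. q x - r)" .
  have dcoeff: "2 * L2_inner (\<lambda>x. d x - r * x) (phi k) = A k t - A k t0" for k
  proof -
    have "L2_inner (\<lambda>x. d x - r * x) (phi k) = L2_inner (\<lambda>x. w t x - w t0 x) (phi k)"
      by (rule L2_inner_cong) (auto simp: d_def r_def u_eq t t0 algebra_simps)
    also have "\<dots> = L2_inner (w t) (phi k) - L2_inner (w t0) (phi k)"
      by (rule L2_inner_diff_left) (auto intro!: L2_fun_cont w_cont t t0)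
    finally show ?thesis by (simp add: w_coeff t t0 diff_divide_distrib[symmetric])
  qed
  have "(\<lambda>k. (pi * real k)\<^sup>2 * (2 * L2_inner (\<lambda>x. d x - r * x) (phi k))\<^sup>2 / 2) sums (L2_norm (\<lambda>x. q x - r))\<^sup>2"
    by (rule sine_expansion(1)[OF dw]) (simp_all add: d0)
  then have "(L2_norm (\<lambda>x. q x - r))\<^sup>2 = (\<Sum>k. l k * (A k t - A k t0)\<^sup>2 / 2)"
    unfolding dcoeff l_def by (rule sums_unique)
  then have "L2_norm (\<lambda>x. q x - r) = sqrt (\<Sum>k. l k * (A k t - A k t0)\<^sup>2 / 2)"
    by (metis L2_norm_nonneg real_sqrt_abs abs_of_nonneg)
  moreover have "L2_norm q \<le> L2_norm (\<lambda>x. q x - r) + \<bar>r\<bar>"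
    using L2_norm_add_le[OF L2_fun_diff[OF qL cL] cL] by (simp add: L2_norm_def)
  moreover have "L2_norm d \<le> L2_norm q"
  proof (rule L2_norm_le_sup[OF dc])
    show "\<bar>d x\<bar> \<le> L2_norm q" if "x \<in> {0..1}" for x
      using is_weak_derivD(2)[OF dq that] integral_abs_le_L2_norm[OF qL that] d0 by simp
  qed
  moreover have "H1_norm d \<le> L2_norm d + L2_norm q" by (rule H1_norm_bounds(3)[OF dq])
  ultimately show ?thesis by (simp add: d_def[abs_def] r_def)
qed

text \<open>On [0,T] the weighted squares are dominated by summable terms independent of t, because
  u0 in H^1 makes l (a0)^2 summable. Uniform convergence therefore includes t = 0.\<close>

lemma H1_continuity:
  assumes t0: "t0 \<ge> 0"
  shows "((\<lambda>t. H1_norm (\<lambda>x. u x t - u x t0)) \<longlongrightarrow> 0) (at t0 within {0..})"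
proof -
  define \<Psi> where "\<Psi> t = (\<Sum>k. l k * (A k t - A k t0)\<^sup>2 / 2)" for t
  have \<Psi>c: "continuous_on {0..} \<Psi>"
  proof (rule continuous_on_atLeastI)
    fix T0 :: real
    \<comment> \<open>The interval must also contain t0, where \<open>A_le\<close> is
      applied.\<close>
    define T where "T = max T0 t0"
    obtain B where B1: "1 \<le> B" and B: "\<And>k s. 0 \<le> s \<Longrightarrow> s \<le> T \<Longrightarrow> \<bar>h k s\<bar> \<le> B" using bounds[of T] by metis
    have "continuous_on {0..T} \<Psi>"
    proof (rule uniform_limit_theorem)
      show "uniform_limit {0..T} (\<lambda>n t. \<Sum>k<n. l k * (A k t - A k t0)\<^sup>2 / 2) \<Psi> sequentially"
        unfolding \<Psi>_def[abs_def]
      proof (rule Weierstrass_m_test)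
        have "summable (\<lambda>k. 4 * (l k * (a0 k)\<^sup>2) + 4 * B\<^sup>2 * (1 / (pi * real k)\<^sup>2))"
          by (intro summable_add summable_mult a0_sq_summable summable_inverse_pi_squares)
        then show "summable (\<lambda>k. 4 * (l k * (a0 k)\<^sup>2) + 4 * B\<^sup>2 * (1 / l k))" by (simp add: l_def)
        fix k t assume t: "t \<in> {0..T}"
        have "\<bar>A k t - A k t0\<bar> \<le> 2 * (\<bar>a0 k\<bar> + B * (1 / l k))"
          using A_le[where k = k and t = t and T = T, OF B] A_le[where k = k and t = t0 and T = T, OF B] t t0 by (force simp: T_def)
        then have "\<bar>A k t - A k t0\<bar>\<^sup>2 \<le> (2 * (\<bar>a0 k\<bar> + B * (1 / l k)))\<^sup>2" by (intro power_mono) auto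
        also have "\<dots> = 4 * (\<bar>a0 k\<bar> + B * (1 / l k))\<^sup>2" by (simp only: power_mult_distrib) simp
        also have "\<dots> \<le> 4 * (2 * \<bar>a0 k\<bar>\<^sup>2 + 2 * (B * (1 / l k))\<^sup>2)" by (intro mult_left_mono square_sum_le) auto
        finally have "l k * (A k t - A k t0)\<^sup>2 \<le> l k * (4 * (2 * (a0 k)\<^sup>2 + 2 * (B * (1 / l k))\<^sup>2))"
          using l_nonneg[of k] by (intro mult_left_mono) auto
        also have "\<dots> = 2 * (4 * (l k * (a0 k)\<^sup>2) + 4 * B\<^sup>2 * (1 / l k))"
          by (cases "l k = 0") (simp_all add: power_mult_distrib power_divide power2_eq_square field_simps)
        finally show "norm (l k * (A k t - A k t0)\<^sup>2 / 2) \<le> 4 * (l k * (a0 k)\<^sup>2) + 4 * B\<^sup>2 * (1 / l k)"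
          using l_nonneg[of k] by simp
      qed
      have "continuous_on {0..T} (\<lambda>t. \<Sum>k<n. l k * (A k t - A k t0)\<^sup>2 / 2)" for n
        by (intro continuous_intros continuous_on_subset[OF A_cont]) auto
      then show "\<forall>\<^sub>F n in sequentially. continuous_on {0..T} (\<lambda>t. \<Sum>k<n. l k * (A k t - A k t0)\<^sup>2 / 2)"
        by (intro always_eventually allI)
    qed simp
    then show "continuous_on {0..T0} \<Psi>" by (rule continuous_on_subset) (auto simp: T_def)
  qed
  have "continuous_on {0..} (\<lambda>t. 2 * (sqrt (\<Psi> t) + \<bar>U t - U t0\<bar>))"
    by (intro continuous_intros \<Psi>c U_cont)
  then have "((\<lambda>t. 2 * (sqrt (\<Psi> t) + \<bar>U t - U t0\<bar>)) \<longlongrightarrow> 2 * (sqrt (\<Psi> t0) + \<bar>U t0 - U t0\<bar>)) (at t0 within {0..})"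
    using t0 unfolding continuous_on_def by blast
  then have lim: "((\<lambda>t. 2 * (sqrt (\<Psi> t) + \<bar>U t - U t0\<bar>)) \<longlongrightarrow> 0) (at t0 within {0..})"
    by (simp add: \<Psi>_def)
  show ?thesis
  proof (rule Lim_null_comparison[OF _ lim])
    have "norm (H1_norm (\<lambda>x. u x t - u x t0)) \<le> 2 * (sqrt (\<Psi> t) + \<bar>U t - U t0\<bar>)" if t: "t \<ge> 0" for t
    proof -
      have "0 \<le> H1_norm (\<lambda>x. u x t - u x t0)"
      proof -
        obtain g where g: "is_weak_deriv (\<lambda>x. u x t) g" using u_H1[OF t] .
        obtain g' where g': "is_weak_deriv (\<lambda>x. u x t0) g'" using u_H1[OF t0] .
        show ?thesis
          by (rule order_trans[OF L2_norm_nonneg H1_norm_bounds(1)[OF is_weak_deriv_diff[OF g g']]])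
      qed
      then show ?thesis using H1_diff_le[OF t t0] by (simp add: \<Psi>_def)
    qed
    then show "\<forall>\<^sub>F t in at t0 within {0..}. norm (H1_norm (\<lambda>x. u x t - u x t0)) \<le> 2 * (sqrt (\<Psi> t) + \<bar>U t - U t0\<bar>)"
      by (auto simp: eventually_at_filter intro!: always_eventually)
  qed
qed

lemma gen_solution: "gen_sol \<alpha> N \<gamma> b u0 u"
proof -
  have "\<exists>ut ux uxx.
      continuous_on ({0..1} \<times> {0<..}) (\<lambda>(x,t). ut x t) \<and>
      continuous_on ({0..1} \<times> {0<..}) (\<lambda>(x,t). ux x t) \<and>
      continuous_on ({0..1} \<times> {0<..}) (\<lambda>(x,t). uxx x t) \<and>
      (\<forall>x\<in>{0..1}. \<forall>t>0.
         ((\<lambda>s. u x s) has_real_derivative ut x t) (at t) \<and>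
         ((\<lambda>y. u y t) has_real_derivative ux x t) (at x within {0..1}) \<and>
         ((\<lambda>y. ux y t) has_real_derivative uxx x t) (at x within {0..1})) \<and>
      (\<forall>x\<in>{0<..<1}. \<forall>t>0. ut x t - uxx x t - \<alpha> * u x t + b t * (u x t)\<^sup>2 = 0)"
    by (rule exI[of _ ut], rule exI[of _ ux], rule exI[of _ uxx], intro conjI ut_cont ux_cont uxx_cont)
      (use ut_deriv ux_deriv in \<open>auto simp: uxx_def\<close>)
  moreover have "\<forall>t\<ge>0. H1 (\<lambda>x. u x t)" using u_H1 unfolding H1_def by metis
  moreover have "\<forall>t>0. u 0 t = 0 \<and> u 1 t = Ffb \<alpha> N \<gamma> (\<lambda>x. u x t)"
    using u_ends(1) feedback by (simp add: less_imp_le)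
  ultimately show ?thesis
    unfolding gen_sol_def using u_init H1_continuity by blast
qed

lemma b_bounds: "0 \<le> b t" "b t \<le> \<beta>"
  by (simp_all add: b_def bc_range)

end

section \<open>Existence and decay for small data\<close>

context fisher
begin

text \<open>The bound on u0 gives 2 C1 ||u0|| <= 1 / (4 C2), so the solution of the truncated
  problem stays below 1 / (4 C2) < 1 in L^2, where \<open>bc\<close> equals \<beta>; hence it solves
  the original equation.\<close>

lemma closed_loop_exists:
  assumes u0: "u0 \<in> IC \<alpha> N \<gamma>" and small: "L2_norm u0 \<le> 1 / (8 * C1 * C2)"
  shows "\<exists>u. closed_loop_solution \<alpha> \<beta> N \<gamma> u0 u"
proof -
  obtain g0 where wd0: "is_weak_deriv u0 g0" using u0 by (auto simp: IC_def H1_def)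
  define a0 where "a0 k = 2 * L2_inner (\<lambda>x. u0 x - u0 1 * x) (phi k)" for k
  have "is_weak_deriv (\<lambda>x. u0 1 * x) (\<lambda>x. u0 1)"
    by (rule is_weak_derivI) (auto intro!: derivative_eq_intros)
  from is_weak_deriv_diff[OF wd0 this] have w0: "is_weak_deriv (\<lambda>x. u0 x - u0 1 * x) (\<lambda>x. g0 x - u0 1)" .
  have "summable (\<lambda>k. \<bar>a0 k\<bar>)"
    unfolding a0_def by (rule sine_expansion(2)[OF w0]) (use u0 in \<open>auto simp: IC_def\<close>)
  then interpret mild_data Phi gk Lc a0 "u0 1"
  proof unfold_locales
    show "\<bar>Phi v - Phi z\<bar> \<le> Lc * e" "\<bar>gk k v - gk k z\<bar> \<le> Lc * e"
      if "continuous_on {0..1} v" "continuous_on {0..1} z" "\<And>x. x \<in> {0..1} \<Longrightarrow> \<bar>v x - z x\<bar> \<le> e" for k v z e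
      using Phi_lip_Lc[OF that(1,2) sup_to_L2[OF that]] gk_lip[OF that(1,2) sup_to_L2[OF that]] by blast+
  qed (simp_all add: Phi_0 gk_0 Lc)
  obtain u where uc: "continuous_on ({0..1} \<times> {0..}) (\<lambda>(x,t). u x t)"
    and mild: "\<And>x t. x \<in> {0..1} \<Longrightarrow> t \<ge> 0 \<Longrightarrow> u x t = (\<Sum>k. A u k t * phi k x) + x * U u t"
    using mild_exists by blast
  interpret M: fisher_mild \<alpha> \<beta> \<rho> N \<gamma> c u0 g0 u a0
    by unfold_locales (use u0 wd0 uc mild in \<open>auto simp: a0_def A_def U_def\<close>)
  interpret S: fisher_solution \<alpha> \<beta> \<rho> N \<gamma> c M.b u0 u
    by unfold_locales (use M.gen_solution u0 M.b_bounds in auto)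
  have K: "0 < 1 / (4 * C2)" "2 * C1 * L2_norm u0 \<le> 1 / (4 * C2)"
    using small C1_ge C2_ge by (auto simp: field_simps)
  have "M.b t = \<beta>" if t: "t \<ge> 0" for t
  proof -
    have "L2_norm (\<lambda>x. u x t) \<le> 1 / (4 * C2) * exp (- \<mu> * t)"
      using S.L2_decay[OF K(1) order_refl K(2) t] by (simp add: S.n_def)
    also have "\<dots> \<le> 1 * 1" using C2_ge mu t by (intro mult_mono) auto
    finally show ?thesis unfolding M.b_def by (intro bc_one) simp
  qed
  then have "gen_sol \<alpha> N \<gamma> (\<lambda>_. \<beta>) u0 u" using M.gen_solution unfolding gen_sol_def by (simp add: less_imp_le)
  then show ?thesis by (auto simp: closed_loop_solution_iff)
qed

text \<open>The estimate is homogeneous in u0, while \<open>L2_decay\<close> needs K > 0 even for u0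
  = 0. Hence K is 2 C1 ||u0|| plus a slack, which is removed in the limit. The factor 16 leaves half
  of the threshold 1 / (4 C2) for the slack.\<close>

lemma closed_loop_decay:
  assumes u0: "u0 \<in> IC \<alpha> N \<gamma>" and small: "L2_norm u0 \<le> 1 / (16 * C1 * C2)"
    and sol: "closed_loop_solution \<alpha> \<beta> N \<gamma> u0 u" and t: "t \<ge> 0"
  defines "J \<equiv> 1 + 2 * H * sqrt pi_zeta + real N * Cc"
  shows "H1_norm (\<lambda>x. u x t) \<le> (4 + J * (2 * C1)) * exp (- \<mu> * t) * H1_norm u0"
proof -
  interpret S: fisher_solution \<alpha> \<beta> \<rho> N \<gamma> c "\<lambda>_. \<beta>" u0 u
    by unfold_locales (use sol u0 pos in \<open>auto simp: closed_loop_solution_iff\<close>)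
  obtain g0 where g0: "is_weak_deriv u0 g0" using u0 by (auto simp: IC_def H1_def)
  have J: "1 \<le> J" unfolding J_def using H_nonneg pi_zeta_nonneg Cc_nonneg by simp
  have "H1_norm (\<lambda>x. u x t) \<le> (4 + J * (2 * C1)) * exp (- \<mu> * t) * H1_norm u0 + e" if e: "0 < e" for e
  proof -
    \<comment> \<open>The slack is at most e / J because K enters the H^1 bound with the factor J,
      and at most 1 / (8 C2) to keep K below its threshold.\<close>
    define K where "K = 2 * C1 * L2_norm u0 + min (1 / (8 * C2)) (e / J)"
    have "2 * C1 * L2_norm u0 \<le> 1 / (8 * C2)" using small C1_ge C2_ge by (auto simp: field_simps)
    then have "K \<le> 1 / (8 * C2) + 1 / (8 * C2)" unfolding K_def by (intro add_mono) auto
    then have K4: "K \<le> 1 / (4 * C2)" by simp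
    have m: "0 < min (1 / (8 * C2)) (e / J)" using C2_ge J e by simp
    have K0: "0 < K" unfolding K_def using m C1_ge by (intro add_nonneg_pos) auto
    have "1 / (4 * C2) \<le> 1" using C2_ge by simp
    then have K1: "K \<le> 1" using K4 by linarith
    have K2: "2 * C1 * L2_norm u0 \<le> K" unfolding K_def using m by simp
    have "H1_norm (\<lambda>x. u x t) \<le> exp (- \<mu> * t) * (4 * H1_norm u0 + J * K)"
      unfolding J_def using S.H1_decay[OF K0 K1 S.L2_decay[OF K0 K4 K2] t] .
    also have "J * K \<le> J * (2 * C1) * H1_norm u0 + e"
    proof -
      have "J * K = J * (2 * C1) * L2_norm u0 + J * min (1 / (8 * C2)) (e / J)"
        by (simp add: K_def algebra_simps)
      also have "J * min (1 / (8 * C2)) (e / J) \<le> J * (e / J)" using J by (intro mult_left_mono) auto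
      also have "J * (e / J) = e" using J by simp
      also have "J * (2 * C1) * L2_norm u0 \<le> J * (2 * C1) * H1_norm u0"
        using J C1_ge by (intro mult_left_mono H1_norm_bounds(1)[OF g0]) auto
      finally show ?thesis by simp
    qed
    finally have "H1_norm (\<lambda>x. u x t) \<le> exp (- \<mu> * t) * (4 * H1_norm u0 + (J * (2 * C1) * H1_norm u0 + e))"
      by (simp add: mult_left_mono)
    also have "\<dots> = (4 + J * (2 * C1)) * exp (- \<mu> * t) * H1_norm u0 + exp (- \<mu> * t) * e"
      by (simp add: algebra_simps)
    also have "exp (- \<mu> * t) * e \<le> 1 * e" using mu t e by (intro mult_right_mono) auto
    finally show ?thesis by simp
  qed
  then show ?thesis by (rule field_le_epsilon)
qed

end

theorem theorem3p2:
  fixes \<alpha> \<beta> \<rho> :: real and N :: nat and \<gamma> :: "nat \<Rightarrow> real"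
  assumes "\<alpha> > 0" and "\<beta> > 0" and "\<rho> > 0"
    and "N \<ge> 1"
    and "\<forall>j\<in>{1..N}. lam \<alpha> j < \<rho>"
    and "\<forall>j\<ge>N+1. lam \<alpha> j \<ge> \<rho>"
    and "\<rho> < \<gamma> 1"
    and "\<forall>k\<in>{1..<N}. \<gamma> k < \<gamma> (k+1)"
    and "\<forall>j\<in>{1..N}. \<forall>V::real. \<exists>\<psi> \<psi>' \<psi>''.
           \<psi> 0 = 0 \<and> \<psi> 1 = V \<and>
           (\<forall>x\<in>{0..1}. (\<psi> has_real_derivative \<psi>' x) (at x within {0..1}) \<and>
                         (\<psi>' has_real_derivative \<psi>'' x) (at x within {0..1})) \<and>
           (\<forall>x\<in>{0<..<1}. \<gamma> j * \<psi> x + \<psi>'' x - \<alpha> * \<psi> x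
               - 2 * (\<Sum>k\<in>{1..N}. lam \<alpha> k * L2_inner \<psi> (phi k) * phi k x) = 0)"
  shows "\<exists>C \<mu> \<delta>::real. C > 0 \<and> \<mu> > 0 \<and> \<delta> > 0 \<and>
           (\<forall>u0\<in>IC \<alpha> N \<gamma>. L2_norm u0 \<le> \<delta> \<longrightarrow>
              (\<exists>u. closed_loop_solution \<alpha> \<beta> N \<gamma> u0 u) \<and>
              (\<forall>u. closed_loop_solution \<alpha> \<beta> N \<gamma> u0 u \<longrightarrow>
                 (\<forall>t\<ge>0. H1_norm (\<lambda>x. u x t) \<le> C * exp (- \<mu> * t) * H1_norm u0)))"
proof -
  \<comment> \<open>Monotonicity is given between neighbours only; induction spreads it over 1..N.
    It yields both \<rho> < \<open>\<gamma> k\<close> and the distinct nodes of the Cauchy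
    matrix.\<close>
  have less: "\<gamma> i < \<gamma> j" if "1 \<le> i" "i < j" "j \<le> N" for i j
    using that(2,3)
  proof (induction j)
    case (Suc j)
    have step: "\<gamma> j < \<gamma> (Suc j)" if "1 \<le> j" using assms(8) that Suc.prems by auto
    show ?case
    proof (cases "i = j")
      case True
      then show ?thesis using step \<open>1 \<le> i\<close> by simp
    next
      case False
      then have "\<gamma> i < \<gamma> j" using Suc by simp
      then show ?thesis using step Suc.prems \<open>1 \<le> i\<close> by simp
    qed
  qed simp
  have gam: "\<rho> < \<gamma> k" if "k \<in> {1..N}" for k
    using less[of 1 k] that assms(7) by (cases "k = 1") auto
  have inj: "inj_on \<gamma> {1..N}"
    by (rule linorder_inj_onI') (use less in \<open>force\<close>)
  obtain c where c: "\<And>k u. Fk \<alpha> N \<gamma> k u = (\<Sum>j\<in>{1..N}. c k j * L2_inner u (phi j))"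
    "is_one_on {1..N} (mmul {1..N} c (\<lambda>i k. dphi1 i / (\<gamma> k - lam \<alpha> i)))"
    "is_one_on {1..N} (mmul {1..N} (\<lambda>i k. dphi1 i / (\<gamma> k - lam \<alpha> i)) c)"
    by (rule feedback_gains[OF assms(5) gam inj]) blast+
  interpret fisher \<alpha> \<beta> \<rho> N \<gamma> c
    by unfold_locales (use assms gam c in auto)
  define J where "J = 1 + 2 * H * sqrt pi_zeta + real N * Cc"
  \<comment> \<open>The smaller of the two radii: the decay estimate asks for half of what existence
    needs.\<close>
  define \<delta> where "\<delta> = 1 / (16 * C1 * C2)"
  have J: "1 \<le> J" unfolding J_def using H_nonneg pi_zeta_nonneg Cc_nonneg by simp
  have C: "0 < 4 + J * (2 * C1)" using J C1_ge by (intro add_pos_nonneg) auto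
  have \<delta>: "0 < \<delta>" using C1_ge C2_ge by (simp add: \<delta>_def)
  have le: "\<delta> \<le> 1 / (8 * C1 * C2)" unfolding \<delta>_def using C1_ge C2_ge
    by (intro divide_left_mono) (auto intro!: mult_right_mono)
  have ex: "\<exists>u. closed_loop_solution \<alpha> \<beta> N \<gamma> u0 u" if "u0 \<in> IC \<alpha> N \<gamma>" "L2_norm u0 \<le> \<delta>" for u0
    by (rule closed_loop_exists[OF that(1) order_trans[OF that(2) le]])
  have dec: "H1_norm (\<lambda>x. u x t) \<le> (4 + J * (2 * C1)) * exp (- \<mu> * t) * H1_norm u0"
    if "u0 \<in> IC \<alpha> N \<gamma>" "L2_norm u0 \<le> \<delta>" "closed_loop_solution \<alpha> \<beta> N \<gamma> u0 u" "t \<ge> 0" for u0 u t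
    using closed_loop_decay[OF that(1) _ that(3,4)] that(2) unfolding J_def \<delta>_def by simp
  show ?thesis
    by (rule exI[of _ "4 + J * (2 * C1)"], rule exI[of _ \<mu>], rule exI[of _ \<delta>], intro conjI ballI impI allI)
      (rule C mu(1) \<delta> ex dec; assumption)+
qed

end
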